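(* Let $1<r<p^*\le s<q^*$, let $c\in L^\infty(\Omega)$ be a nonnegative function such that $c(x)\le C\,a(x)^{s/q}$ for a.a. $x\in\Omega$, for some constant $C>0$, and let $$\mathcal C(x,t)=t^r+c(x)\,t^s,\quad(x,t)\in\Omega\times[0,\infty).$$ Then the embedding $W^{1,\mathcal A}_0(\Omega)\hookrightarrow L^{\mathcal C}(\Omega)$ is compact.
   Context: Standing assumptions: $N\ge2$, $\Omega\subset\mathbb R^N$ is a smooth bounded domain, $1<p<q<N$ with $q/p\le N/(N-1)$, and $0\le a\in L^\infty(\Omega)\cap C^{0,\frac Np(q-p)}(\Omega)$. Put $p^*=Np/(N-p)$, $q^*=Nq/(N-q)$ (so $q<p^*<q^*$). For $\varphi:\Omega\times[0,\infty)\to[0,\infty)$ equal to $\mathcal A(x,t)=t^p+a(x)t^q$ or to $\mathcal C$, let $\rho_\varphi(u)=\int_\Omega\varphi(x,|u|)\,dx$; $L^\varphi(\Omega)$ is the space of measurable $u:\Omega\to\mathbb R$ with $\rho_\varphi(u)<\infty$, with the Luxemburg norm $\|u\|_\varphi=\inf\{\tau>0:\rho_\varphi(u/\tau)\le1\}$. $W^{1,\mathcal A}(\Omega)$ is the space of $u\in L^{\mathcal A}(\Omega)$ with $|\nabla u|\in L^{\mathcal A}(\Omega)$, normed by $\|u\|_{\mathcal A}+\|\,|\nabla u|\,\|_{\mathcal A}$, and $W^{1,\mathcal A}_0(\Omega)$ is the completion of $C_0^\infty(\Omega)$ in $W^{1,\mathcal A}(\Omega)$. *)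

theory Defs
  imports "HOL-Analysis.Analysis"
begin

text \<open>
  Functions on a domain \<open>\<Omega>\<close> are represented by total functions; their values outside \<open>\<Omega>\<close> are
  irrelevant, and functions that agree almost everywhere on \<open>\<Omega>\<close> are not identified, so the norms
  below are seminorms on sets of representatives.
\<close>

definition partial_deriv :: "'a::euclidean_space \<Rightarrow> ('a \<Rightarrow> real) \<Rightarrow> 'a \<Rightarrow> real" where
  "partial_deriv i f x = frechet_derivative f (at x) i"

primrec Ck :: "nat \<Rightarrow> ('a::euclidean_space \<Rightarrow> real) \<Rightarrow> bool" where
  "Ck 0 f \<longleftrightarrow> continuous_on UNIV f"
| "Ck (Suc k) f \<longleftrightarrow>
     (\<forall>x. f differentiable (at x)) \<and> (\<forall>i\<in>Basis. Ck k (partial_deriv i f))"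

definition smooth :: "('a::euclidean_space \<Rightarrow> real) \<Rightarrow> bool" where
  "smooth f \<longleftrightarrow> (\<forall>k. Ck k f)"

definition test_functions :: "'a::euclidean_space set \<Rightarrow> ('a \<Rightarrow> real) set" where
  "test_functions \<Omega> =
     {f. smooth f \<and> compact (closure {x. f x \<noteq> 0}) \<and> closure {x. f x \<noteq> 0} \<subseteq> \<Omega>}"

text \<open>
  The boundary is locally the graph of a smooth function over a coordinate hyperplane, with the
  domain on one side of it. The direction \<open>d\<close> is plus or minus a coordinate vector, and \<open>\<gamma>\<close>, a
  function of the remaining \<open>N - 1\<close> coordinates, is encoded as a function on the whole space that is
  constant in direction \<open>d\<close>.
\<close>

definition smooth_boundary :: "'a::euclidean_space set \<Rightarrow> bool" where
  "smooth_boundary \<Omega> \<longleftrightarrow>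
     (\<forall>x0 \<in> frontier \<Omega>. \<exists>\<delta>>0. \<exists>d \<gamma>.
        (d \<in> Basis \<or> - d \<in> Basis) \<and> smooth \<gamma> \<and> (\<forall>x t. \<gamma> (x + t *\<^sub>R d) = \<gamma> x) \<and>
        \<Omega> \<inter> ball x0 \<delta> = {x \<in> ball x0 \<delta>. x \<bullet> d > \<gamma> x})"

definition smooth_bounded_domain :: "'a::euclidean_space set \<Rightarrow> bool" where
  "smooth_bounded_domain \<Omega> \<longleftrightarrow>
     \<Omega> \<noteq> {} \<and> open \<Omega> \<and> connected \<Omega> \<and> bounded \<Omega> \<and> smooth_boundary \<Omega>"

definition L_infty :: "'a::euclidean_space set \<Rightarrow> ('a \<Rightarrow> real) set" where
  "L_infty \<Omega> =
     {f \<in> borel_measurable (lebesgue_on \<Omega>). \<exists>M. AE x in lebesgue_on \<Omega>. \<bar>f x\<bar> \<le> M}"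

text \<open>Hoelder continuity is uniform on \<open>\<Omega>\<close>, and the exponent is not restricted to \<open>\<alpha> \<le> 1\<close>.\<close>

definition holder_space :: "real \<Rightarrow> 'a::euclidean_space set \<Rightarrow> ('a \<Rightarrow> real) set" where
  "holder_space \<alpha> \<Omega> =
     {f. \<exists>K. \<forall>x\<in>\<Omega>. \<forall>y\<in>\<Omega>. \<bar>f x - f y\<bar> \<le> K * dist x y powr \<alpha>}"

definition sobolev_exponent :: "nat \<Rightarrow> real \<Rightarrow> real" where
  "sobolev_exponent N p = real N * p / (real N - p)"

definition double_phase :: "real \<Rightarrow> real \<Rightarrow> ('a \<Rightarrow> real) \<Rightarrow> 'a \<Rightarrow> real \<Rightarrow> real" where
  "double_phase p q a x t = t powr p + a x * t powr q"

definition modular ::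
    "'a::euclidean_space set \<Rightarrow> ('a \<Rightarrow> real \<Rightarrow> real) \<Rightarrow> ('a \<Rightarrow> real) \<Rightarrow> ennreal" where
  "modular \<Omega> \<phi> u = (\<integral>\<^sup>+ x. ennreal (\<phi> x \<bar>u x\<bar>) \<partial>lebesgue_on \<Omega>)"

definition musielak_space ::
    "'a::euclidean_space set \<Rightarrow> ('a \<Rightarrow> real \<Rightarrow> real) \<Rightarrow> ('a \<Rightarrow> real) set" where
  "musielak_space \<Omega> \<phi> = {u \<in> borel_measurable (lebesgue_on \<Omega>). modular \<Omega> \<phi> u < \<infinity>}"

definition luxemburg_norm ::
    "'a::euclidean_space set \<Rightarrow> ('a \<Rightarrow> real \<Rightarrow> real) \<Rightarrow> ('a \<Rightarrow> real) \<Rightarrow> real" where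
  "luxemburg_norm \<Omega> \<phi> u = Inf {\<tau>. \<tau> > 0 \<and> modular \<Omega> \<phi> (\<lambda>x. u x / \<tau>) \<le> 1}"

definition locally_integrable ::
    "'a::euclidean_space set \<Rightarrow> ('a \<Rightarrow> 'b::euclidean_space) \<Rightarrow> bool" where
  "locally_integrable \<Omega> f \<longleftrightarrow> (\<forall>K. compact K \<and> K \<subseteq> \<Omega> \<longrightarrow> f absolutely_integrable_on K)"

definition has_weak_gradient ::
    "'a::euclidean_space set \<Rightarrow> ('a \<Rightarrow> real) \<Rightarrow> ('a \<Rightarrow> 'a) \<Rightarrow> bool" where
  "has_weak_gradient \<Omega> u G \<longleftrightarrow>
     locally_integrable \<Omega> u \<and> locally_integrable \<Omega> G \<and>
     (\<forall>f \<in> test_functions \<Omega>. \<forall>i\<in>Basis.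
        (\<integral>x. u x * partial_deriv i f x \<partial>lebesgue_on \<Omega>) = - (\<integral>x. (G x \<bullet> i) * f x \<partial>lebesgue_on \<Omega>))"

text \<open>The weak gradient is unique almost everywhere on \<open>\<Omega>\<close>, so the choice does not affect norms.\<close>

definition weak_gradient :: "'a::euclidean_space set \<Rightarrow> ('a \<Rightarrow> real) \<Rightarrow> 'a \<Rightarrow> 'a" where
  "weak_gradient \<Omega> u = (SOME G. has_weak_gradient \<Omega> u G)"

definition musielak_sobolev_space ::
    "'a::euclidean_space set \<Rightarrow> ('a \<Rightarrow> real \<Rightarrow> real) \<Rightarrow> ('a \<Rightarrow> real) set" where
  "musielak_sobolev_space \<Omega> \<phi> =
     {u \<in> musielak_space \<Omega> \<phi>.
        \<exists>G. has_weak_gradient \<Omega> u G \<and> (\<lambda>x. norm (G x)) \<in> musielak_space \<Omega> \<phi>}"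

definition musielak_sobolev_norm ::
    "'a::euclidean_space set \<Rightarrow> ('a \<Rightarrow> real \<Rightarrow> real) \<Rightarrow> ('a \<Rightarrow> real) \<Rightarrow> real" where
  "musielak_sobolev_norm \<Omega> \<phi> u =
     luxemburg_norm \<Omega> \<phi> u + luxemburg_norm \<Omega> \<phi> (\<lambda>x. norm (weak_gradient \<Omega> u x))"

text \<open>The completion of the test functions inside the Sobolev space, that is, their closure there.\<close>

definition musielak_sobolev_space_0 ::
    "'a::euclidean_space set \<Rightarrow> ('a \<Rightarrow> real \<Rightarrow> real) \<Rightarrow> ('a \<Rightarrow> real) set" where
  "musielak_sobolev_space_0 \<Omega> \<phi> =
     {u \<in> musielak_sobolev_space \<Omega> \<phi>.
        \<forall>\<epsilon>>0. \<exists>f \<in> test_functions \<Omega>. musielak_sobolev_norm \<Omega> \<phi> (\<lambda>x. u x - f x) < \<epsilon>}"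

text \<open>
  The inclusion is defined, bounded, and maps bounded sequences to sequences with a subsequence that
  converges in the target.
\<close>

definition compactly_embedded ::
    "('a \<Rightarrow> real) set \<Rightarrow> (('a \<Rightarrow> real) \<Rightarrow> real) \<Rightarrow>
     ('a \<Rightarrow> real) set \<Rightarrow> (('a \<Rightarrow> real) \<Rightarrow> real) \<Rightarrow> bool" where
  "compactly_embedded X nX Y nY \<longleftrightarrow>
     X \<subseteq> Y \<and>
     (\<exists>K. \<forall>u\<in>X. nY u \<le> K * nX u) \<and>
     (\<forall>v M. (\<forall>k::nat. v k \<in> X \<and> nX (v k) \<le> M) \<longrightarrow>
        (\<exists>u\<in>Y. \<exists>\<sigma>. strict_mono \<sigma> \<and> (\<lambda>k. nY (\<lambda>x. v (\<sigma> k) x - u x)) \<longlonglongrightarrow> 0))"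

end

theory Submission
  imports Defs "HOL-Probability.Probability_Measure" "HOL-Complex_Analysis.Great_Picard"
begin

text \<open>
  All exponents are strictly subcritical, so neither the Gagliardo-Nirenberg nor the
  Hardy-Littlewood-Sobolev inequality is needed. For a test function \<open>f\<close>, integrating \<open>grad f\<close> along
  the segments from \<open>x\<close> to \<open>x + L w\<close>, with \<open>w \<in> [1, 2]\<^sup>N\<close> and \<open>L\<close> so large that the end point lies
  outside \<open>\<Omega>\<close>, bounds \<open>\<bar>f x\<bar>\<close> by an average of \<open>\<bar>grad f\<bar>\<close> over \<open>w\<close> and over the position
  \<open>\<rho> \<in> (0, 1)\<close> on the segment. Two applications of Jensen's inequality show that such averages map
  \<open>L\<^sup>P\<close> boundedly to \<open>L\<^sup>t\<close> whenever \<open>N (1/P - 1/t) < 1\<close>, and \<open>N (1/P - 1/t) < 1 + \<kappa>\<close> in the presence of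
  an additional factor \<open>\<rho>\<^sup>\<kappa>\<close>. The Hoelder continuity of \<open>a\<close> gives
  \<open>a(x)\<^sup>1\<^sup>/\<^sup>q \<le> a(y)\<^sup>1\<^sup>/\<^sup>q + K \<bar>x - y\<bar>\<^sup>\<kappa>\<close> with \<open>\<kappa> = N/p - N/q\<close>; this exponent is exactly the gain that lifts
  \<open>\<bar>grad f\<bar> \<in> L\<^sup>p\<close> to the exponents below \<open>q\<^sup>*\<close>. Hence \<open>f\<close> and \<open>a\<^sup>1\<^sup>/\<^sup>q f\<close> are bounded in spaces with exponents
  slightly larger than \<open>r\<close> and \<open>s\<close>. Averages over dyadic cubes yield subsequences converging almost
  everywhere, and interpolation turns this into convergence with the exponents \<open>r\<close> and \<open>s\<close>.
\<close>

section \<open>Smooth bump functions\<close>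

text \<open>Elements of the closure are only norm limits of test functions, and
  \<open>weak_gradient\<close> is a choice, determined only almost everywhere. Every inequality is
  therefore proved for compactly supported C^1 functions and carried over by Fatou's lemma;
  uniqueness of weak gradients makes the norm computable from any gradient at hand. The modulars are
  not homogeneous, so estimates are stated for functions whose gradient modular is at most 1, and a
  general \<open>u\<close> is divided by \<open>2 * \<theta>\<close> for some \<theta> above its
  norm; the 2 absorbs the approximation error. The hypothesis c <= C a^(s/q) gives c |w|^s <= C
  (a^(1/q) |w|)^s, which reduces the target modular to an unweighted integral with exponent r and a
  weighted one with exponent s. A cube of directions replaces the sphere: it carries a uniform
  probability measure, its dilations have a constant Jacobian, and its points stay away from 0, so
  that one length L takes every segment out of the domain.\<close>

lemma partial_deriv_eq: "(f has_derivative f') (at x) \<Longrightarrow> partial_deriv i f x = f' i"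
  by (simp add: partial_deriv_def frechet_derivative_at[symmetric])

lemma has_derivative_partial:
  "f differentiable (at x) \<Longrightarrow> (f has_derivative (\<lambda>h. partial_deriv h f x)) (at x)"
  by (simp add: partial_deriv_def[abs_def] frechet_derivative_works)

lemma Ck_SucD: "Ck (Suc k) f \<Longrightarrow> Ck k f"
proof (induction k arbitrary: f)
  case 0
  then show ?case
    by (auto intro!: differentiable_imp_continuous_on simp: differentiable_on_def
        intro: differentiable_at_withinI)
qed auto

lemma Ck_const: "Ck k (\<lambda>x. c)"
proof (induction k arbitrary: c)
  case (Suc k)
  have "partial_deriv i (\<lambda>x. c) = (\<lambda>x::'a. 0)" for i
    by (auto simp: partial_deriv_def frechet_derivative_const)
  then show ?case using Suc by auto
qed auto

lemma Ck_add: "Ck k f \<Longrightarrow> Ck k g \<Longrightarrow> Ck k (\<lambda>x. f x + g x)"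
proof (induction k arbitrary: f g)
  case (Suc k)
  have "partial_deriv i (\<lambda>x. f x + g x) = (\<lambda>x. partial_deriv i f x + partial_deriv i g x)" for i
    using Suc.prems by (auto intro!: ext partial_deriv_eq derivative_eq_intros has_derivative_partial)
  then show ?case using Suc by auto
qed (auto intro: continuous_intros)

lemma partial_deriv_mult:
  assumes "f differentiable at x" "g differentiable at x"
  shows "partial_deriv i (\<lambda>x. f x * g x) x = f x * partial_deriv i g x + partial_deriv i f x * g x"
  using assms by (intro partial_deriv_eq) (auto intro!: derivative_eq_intros has_derivative_partial)

lemma Ck_mult: "Ck k f \<Longrightarrow> Ck k g \<Longrightarrow> Ck k (\<lambda>x. f x * g x)"
proof (induction k arbitrary: f g)
  case (Suc k)
  have eq: "partial_deriv i (\<lambda>x. f x * g x) =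
      (\<lambda>x. f x * partial_deriv i g x + partial_deriv i f x * g x)" for i
    using Suc.prems by (auto simp: partial_deriv_mult)
  have "Ck k f" "Ck k g" using Suc.prems Ck_SucD by blast+
  then show ?case using Suc by (auto simp: eq intro!: Ck_add)
qed (auto intro: continuous_intros)

lemma Ck_prod: "finite I \<Longrightarrow> (\<And>i. i \<in> I \<Longrightarrow> Ck k (f i)) \<Longrightarrow> Ck k (\<lambda>x. \<Prod>i\<in>I. f i x)"
  by (induction I rule: finite_induct) (auto intro: Ck_const Ck_mult)

text \<open>The powers t^(-j) make the family closed under differentiation up to linear
  combinations, so smoothness of the standard cut-off follows from one formula. The parameter m is
  later sent to 0, which drives the member with j = 0 to the indicator of the positive half
  line.\<close>

definition flat :: "real \<Rightarrow> nat \<Rightarrow> real \<Rightarrow> real" where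
  "flat m j t = (if t > 0 then exp (- (m / t)) / t ^ j else 0)"

lemma power_le_fact_exp:
  fixes x :: real
  assumes "0 \<le> x"
  shows "x ^ n \<le> fact n * exp x"
proof -
  have s: "summable (\<lambda>n. inverse (fact n) * x ^ n)"
    using summable_exp_generic[of x] by (simp add: field_simps)
  have "(\<Sum>k\<in>{n}. inverse (fact k) * x ^ k) \<le> (\<Sum>k. inverse (fact k) * x ^ k)"
    by (rule sum_le_suminf[OF s]) (use assms in auto)
  also have "\<dots> = exp x" by (simp add: exp_def field_simps)
  finally show ?thesis by (simp add: field_simps)
qed

text \<open>The exponential is traded for its series term of order j + 2: j powers cancel the
  denominator, and the remaining t^2 forces the derivative at 0 to vanish.\<close>

lemma flat_bound:
  assumes "m > 0"
  shows "\<bar>flat m j t\<bar> \<le> fact (j + 2) / m ^ (j + 2) * t\<^sup>2"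
proof (cases "t > 0")
  case True
  have "(m / t) ^ (j + 2) \<le> fact (j + 2) * exp (m / t)"
    using assms True by (intro power_le_fact_exp) auto
  then have "exp (- (m / t)) \<le> fact (j + 2) / m ^ (j + 2) * t ^ (j + 2)"
    using assms True by (simp add: exp_minus field_simps del: fact_Suc)
  then show ?thesis
    using assms True by (simp add: flat_def divide_le_eq power_add power2_eq_square mult_ac)
qed (use assms in \<open>auto simp: flat_def\<close>)

lemma flat_deriv:
  assumes m: "m > 0"
  shows "(flat m j has_real_derivative m * flat m (j + 2) t - j * flat m (j + 1) t) (at t)"
proof -
  consider "t > 0" | "t < 0" | "t = 0" by linarith
  then show ?thesis
  proof cases
    case 1
    have d: "((\<lambda>t. exp (- (m / t)) / t ^ j) has_real_derivative m * flat m (j + 2) t - j * flat m (j + 1) t) (at t)"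
    proof -
      have A: "((\<lambda>t. exp (- (m / t))) has_real_derivative exp (- (m / t)) * (m / t\<^sup>2)) (at t)"
        using 1 by (auto intro!: derivative_eq_intros simp: power2_eq_square)
      have B: "((\<lambda>t. t ^ j) has_real_derivative real j * t ^ (j - 1)) (at t)"
        by (auto intro!: derivative_eq_intros)
      have "(exp (- (m / t)) * (m / t\<^sup>2) * t ^ j - exp (- (m / t)) * (real j * t ^ (j - 1))) / (t ^ j * t ^ j)
          = m * flat m (j + 2) t - j * flat m (j + 1) t"
        using 1 by (cases j) (simp_all add: flat_def field_simps power2_eq_square)
      with DERIV_divide[OF A B] 1 show ?thesis by simp
    qed
    have "eventually (\<lambda>s. s > 0) (nhds t)" using 1 eventually_nhds_in_open[of "{0<..}" t] by auto
    then have e: "eventually (\<lambda>s. exp (- (m / s)) / s ^ j = flat m j s) (nhds t)"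
      by eventually_elim (auto simp: flat_def)
    show ?thesis by (rule DERIV_cong_ev[OF refl e refl, THEN iffD1, OF d])
  next
    case 2
    have d: "((\<lambda>t. 0) has_real_derivative m * flat m (j + 2) t - j * flat m (j + 1) t) (at t)"
      using 2 by (auto simp: flat_def)
    have "eventually (\<lambda>s. s < 0) (nhds t)" using 2 eventually_nhds_in_open[of "{..<0}" t] by auto
    then have e: "eventually (\<lambda>s. 0 = flat m j s) (nhds t)"
      by eventually_elim (auto simp: flat_def)
    show ?thesis by (rule DERIV_cong_ev[OF refl e refl, THEN iffD1, OF d])
  next
    case 3
    have "((\<lambda>h. (flat m j (0 + h) - flat m j 0) / h) \<longlongrightarrow> 0) (at 0)"
    proof (rule Lim_null_comparison)
      show "eventually (\<lambda>h. norm ((flat m j (0 + h) - flat m j 0) / h) \<le> fact (j + 2) / m ^ (j + 2) * \<bar>h\<bar>) (at 0)"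
      proof (rule eventually_at_filter[THEN iffD2], intro always_eventually allI impI)
        fix h :: real assume "h \<noteq> 0"
        then show "norm ((flat m j (0 + h) - flat m j 0) / h) \<le> fact (j + 2) / m ^ (j + 2) * \<bar>h\<bar>"
          using m flat_bound[OF m, of j h]
          by (simp add: flat_def[of m j 0] divide_le_eq power2_eq_square mult.assoc del: fact_Suc)
      qed
      show "((\<lambda>h. fact (j + 2) / m ^ (j + 2) * \<bar>h\<bar>) \<longlongrightarrow> 0) (at (0::real))"
        using tendsto_mult_right_zero[OF tendsto_rabs_zero[OF tendsto_ident_at]] by blast
    qed
    then show ?thesis using 3 by (simp add: DERIV_def flat_def)
  qed
qed

text \<open>The induction on k ranges over all j, since differentiation raises j by 1 and by
  2.\<close>

lemma Ck_flat_affine: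
  fixes v :: "'a::euclidean_space"
  assumes m: "m > 0"
  shows "Ck k (\<lambda>x. flat m j (x \<bullet> v + d))"
proof (induction k arbitrary: j)
  case 0
  have "isCont (flat m j) t" for t using flat_deriv[OF m] by (rule DERIV_isCont)
  then have "continuous_on UNIV (flat m j)" by (simp add: continuous_at_imp_continuous_on)
  then show ?case
    by (auto intro!: continuous_on_compose2[of UNIV "flat m j"] continuous_intros)
next
  case (Suc k)
  define f' where "f' x = m * flat m (j + 2) (x \<bullet> v + d) - j * flat m (j + 1) (x \<bullet> v + d)" for x
  have D: "((\<lambda>x. flat m j (x \<bullet> v + d)) has_derivative (\<lambda>h. (h \<bullet> v) * f' x)) (at x)" for x
  proof -
    have *: "(flat m j has_derivative (\<lambda>h. h * f' x)) (at (x \<bullet> v + d))"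
      using flat_deriv[OF m, of j "x \<bullet> v + d"] by (simp add: f'_def has_field_derivative_def mult_commute_abs)
    show ?thesis
      by (rule has_derivative_compose[where f="\<lambda>x. x \<bullet> v + d", OF _ *]) (auto intro!: derivative_eq_intros)
  qed
  have "partial_deriv i (\<lambda>x. flat m j (x \<bullet> v + d)) = (\<lambda>x. ((i \<bullet> v) * m) * flat m (j + 2) (x \<bullet> v + d)
         + (- (i \<bullet> v) * j) * flat m (j + 1) (x \<bullet> v + d))" for i
    unfolding partial_deriv_def frechet_derivative_at[OF D, symmetric] by (auto simp: f'_def algebra_simps)
  moreover have "Ck k (\<lambda>x. ((i \<bullet> v) * m) * flat m (j + 2) (x \<bullet> v + d)
         + (- (i \<bullet> v) * j) * flat m (j + 1) (x \<bullet> v + d))" for i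
    by (intro Ck_add Ck_mult Ck_const Suc)
  ultimately show ?case using D by (auto simp: differentiable_def)
qed

text \<open>The parameter 1/(n+1) tends to 0, so the bumps rise to the indicator of the open box
  while staying below 1, which suits dominated convergence.\<close>

definition box_bump :: "nat \<Rightarrow> 'a::euclidean_space \<Rightarrow> 'a \<Rightarrow> 'a \<Rightarrow> real" where
  "box_bump n a b x =
     (\<Prod>i\<in>Basis. flat (1 / Suc n) 0 (x \<bullet> i - a \<bullet> i) * flat (1 / Suc n) 0 (b \<bullet> i - x \<bullet> i))"

lemma smooth_box_bump: "smooth (box_bump n a b)"
proof -
  have 1: "Ck k (\<lambda>x. flat (1 / Suc n) 0 (x \<bullet> i - a \<bullet> i))" for i :: 'a and k
    using Ck_flat_affine[of "1 / Suc n" k 0 i "- (a \<bullet> i)"] by simp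
  have 2: "Ck k (\<lambda>x. flat (1 / Suc n) 0 (b \<bullet> i - x \<bullet> i))" for i :: 'a and k
    using Ck_flat_affine[of "1 / Suc n" k 0 "- i" "b \<bullet> i"] by simp
  have "Ck k (\<lambda>x. \<Prod>i\<in>Basis. flat (1 / Suc n) 0 (x \<bullet> i - a \<bullet> i) * flat (1 / Suc n) 0 (b \<bullet> i - x \<bullet> i))" for k
    by (intro Ck_prod Ck_mult 1 2) auto
  then show ?thesis by (simp add: smooth_def box_bump_def[abs_def])
qed

lemma box_bump_outside: "x \<notin> box a b \<Longrightarrow> box_bump n a b x = 0"
  by (auto simp: box_bump_def mem_box flat_def)

lemma box_bump_bounds: "0 \<le> box_bump n a b x" "box_bump n a b x \<le> 1"
  unfolding box_bump_def by (auto intro!: prod_nonneg prod_le_1 mult_nonneg_nonneg mult_le_one simp: flat_def)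

lemma box_bump_test:
  assumes "cbox a b \<subseteq> \<Omega>"
  shows "box_bump n a b \<in> test_functions \<Omega>"
proof -
  have "{x. box_bump n a b x \<noteq> 0} \<subseteq> box a b" using box_bump_outside by blast
  then have *: "closure {x. box_bump n a b x \<noteq> 0} \<subseteq> cbox a b"
    by (meson box_subset_cbox closed_cbox closure_minimal order_trans)
  then have "compact (closure {x. box_bump n a b x \<noteq> 0})"
    by (meson bounded_cbox bounded_subset closed_closure compact_eq_bounded_closed)
  with * assms smooth_box_bump show ?thesis by (auto simp: test_functions_def)
qed

lemma box_bump_tendsto: "(\<lambda>n. box_bump n a b x) \<longlonglongrightarrow> indicator (box a b) x"
proof (cases "x \<in> box a b")
  case True
  have "(\<lambda>n. flat (1 / Suc n) 0 t) \<longlonglongrightarrow> 1" if "t > 0" for t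
  proof -
    have "(\<lambda>n. exp (- (inverse (real (Suc n)) * inverse t))) \<longlonglongrightarrow> exp (- (0 * inverse t))"
      by (intro tendsto_intros LIMSEQ_inverse_real_of_nat)
    then show ?thesis using that by (simp add: flat_def field_simps)
  qed
  then have "(\<lambda>n. box_bump n a b x) \<longlonglongrightarrow> (\<Prod>i\<in>(Basis::'a set). 1 * 1)"
    unfolding box_bump_def using True by (intro tendsto_intros) (auto simp: mem_box)
  then show ?thesis using True by simp
qed (simp add: box_bump_outside)

section \<open>Weak gradients of test functions, and uniqueness of weak gradients\<close>

definition grad :: "('a::euclidean_space \<Rightarrow> real) \<Rightarrow> 'a \<Rightarrow> 'a" where
  "grad f x = (\<Sum>i\<in>Basis. partial_deriv i f x *\<^sub>R i)"

lemma grad_inner_Basis [simp]: "i \<in> Basis \<Longrightarrow> grad f x \<bullet> i = partial_deriv i f x"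
  by (simp add: grad_def inner_sum_left inner_Basis if_distrib cong: if_cong)

lemma partial_deriv_eq_grad:
  assumes "f differentiable (at x)"
  shows "partial_deriv h f x = grad f x \<bullet> h"
proof -
  have l: "linear (\<lambda>h. partial_deriv h f x)"
    using has_derivative_linear[OF has_derivative_partial[OF assms]] .
  have "partial_deriv h f x = partial_deriv (\<Sum>i\<in>Basis. (h \<bullet> i) *\<^sub>R i) f x"
    by (simp add: euclidean_representation)
  also have "\<dots> = (\<Sum>i\<in>Basis. (h \<bullet> i) * partial_deriv i f x)"
    using linear_sum[OF l, of "\<lambda>i. (h \<bullet> i) *\<^sub>R i" Basis] linear_cmul[OF l] by simp
  also have "\<dots> = grad f x \<bullet> h"
    by (simp add: grad_def inner_sum_left mult.commute inner_commute[of h])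
  finally show ?thesis .
qed

lemma has_derivative_grad:
  "f differentiable (at x) \<Longrightarrow> (f has_derivative (\<lambda>h. grad f x \<bullet> h)) (at x)"
  using has_derivative_partial[of f x] by (simp add: partial_deriv_eq_grad)

text \<open>A class wider than the test functions that records first order information only.
  Products and multiples stay inside it without any argument on higher derivatives, and one compact
  set confines both the function and its gradient.\<close>

definition C1_supp :: "'a::euclidean_space set \<Rightarrow> ('a \<Rightarrow> real) \<Rightarrow> bool" where
  "C1_supp \<Omega> f \<longleftrightarrow> (\<forall>x. f differentiable (at x)) \<and> continuous_on UNIV (grad f) \<and>
     (\<exists>K. compact K \<and> K \<subseteq> \<Omega> \<and> (\<forall>x. x \<notin> K \<longrightarrow> f x = 0 \<and> grad f x = 0))"

lemma test_functions_C1_supp: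
  assumes "f \<in> test_functions \<Omega>"
  shows "C1_supp \<Omega> f"
proof -
  have "Ck (Suc 0) f" using assms unfolding test_functions_def smooth_def by blast
  then have d: "\<And>x. f differentiable (at x)" and c: "\<And>i. i \<in> Basis \<Longrightarrow> continuous_on UNIV (partial_deriv i f)"
    by auto
  have "continuous_on UNIV (grad f)"
    unfolding grad_def[abs_def] using c by (intro continuous_intros) auto
  moreover have "f x = 0 \<and> grad f x = 0" if "x \<notin> closure {x. f x \<noteq> 0}" for x
  proof -
    \<comment> \<open>The complement of the closed support is open, so f vanishes near x and its
      derivative vanishes with it.\<close>
    have ev: "eventually (\<lambda>y. f y = 0) (nhds x)"
      by (rule eventually_mono[OF eventually_nhds_in_open[of "- closure {x. f x \<noteq> 0}" x]])
         (use that closure_subset[of "{x. f x \<noteq> 0}"] in auto)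
    then have "f x = 0" by (rule eventually_nhds_x_imp_x)
    have "(f has_derivative (\<lambda>h. 0)) (at x)"
      by (rule has_derivative_transform_eventually[of "\<lambda>_. 0"]) (use ev \<open>f x = 0\<close> in \<open>auto simp: eventually_at_filter elim: eventually_mono\<close>)
    then have "partial_deriv i f x = 0" for i using partial_deriv_eq by blast
    with \<open>f x = 0\<close> show ?thesis by (simp add: grad_def)
  qed
  ultimately show ?thesis using d assms unfolding C1_supp_def test_functions_def by blast
qed

lemma C1_suppD:
  assumes "C1_supp \<Omega> f"
  shows "f differentiable (at x)" "continuous_on UNIV (grad f)" "continuous_on UNIV f"
    "x \<notin> \<Omega> \<Longrightarrow> f x = 0" "x \<notin> \<Omega> \<Longrightarrow> grad f x = 0"
  using assms unfolding C1_supp_def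
  by (auto intro!: differentiable_imp_continuous_on simp: differentiable_on_def intro: differentiable_at_withinI)

lemma C1_supp_measurable [measurable_dest]:
  assumes "C1_supp \<Omega> f"
  shows "f \<in> borel_measurable borel" "grad f \<in> borel_measurable borel"
  using C1_suppD[OF assms] by (auto intro: borel_measurable_continuous_onI)

lemma C1_supp_bounded_grad:
  assumes "C1_supp \<Omega> f"
  obtains B where "B > 0" "\<And>x. norm (grad f x) \<le> B"
proof -
  from assms obtain K where K: "compact K" "\<And>x. x \<notin> K \<Longrightarrow> grad f x = 0"
    unfolding C1_supp_def by blast
  have "compact (grad f ` K)"
    using K C1_suppD(2)[OF assms] by (intro compact_continuous_image) (auto intro: continuous_on_subset)
  then obtain B where B: "B > 0" "\<And>x. x \<in> K \<Longrightarrow> norm (grad f x) \<le> B"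
    using compact_imp_bounded bounded_pos by (metis image_eqI)
  show thesis
    by (rule that[of B]) (use B K in \<open>force+\<close>)
qed

lemma C1_supp_bounded:
  assumes "C1_supp \<Omega> f"
  obtains B where "B > 0" "\<And>x. norm (f x) \<le> B"
proof -
  from assms obtain K where K: "compact K" "\<And>x. x \<notin> K \<Longrightarrow> f x = 0"
    unfolding C1_supp_def by blast
  have "compact (f ` K)"
    using K C1_suppD(3)[OF assms] by (intro compact_continuous_image) (auto intro: continuous_on_subset)
  then obtain B where B: "B > 0" "\<And>x. x \<in> K \<Longrightarrow> norm (f x) \<le> B"
    using compact_imp_bounded bounded_pos by (metis image_eqI)
  show thesis
    by (rule that[of B]) (use B K in \<open>force+\<close>)
qed

lemma C1_supp_mult:
  assumes f: "C1_supp \<Omega> f" and g: "C1_supp \<Omega> g"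
  shows "C1_supp \<Omega> (\<lambda>x. f x * g x)"
proof -
  note F = C1_suppD[OF f] and G = C1_suppD[OF g]
  have eq: "grad (\<lambda>x. f x * g x) = (\<lambda>x. f x *\<^sub>R grad g x + g x *\<^sub>R grad f x)"
    using F(1) G(1) by (simp add: grad_def fun_eq_iff partial_deriv_mult scaleR_add_left sum.distrib scaleR_sum_right mult.commute)
  obtain K where "compact K" "K \<subseteq> \<Omega>" "\<forall>x. x \<notin> K \<longrightarrow> f x = 0 \<and> grad f x = 0"
    using f unfolding C1_supp_def by blast
  moreover have "continuous_on UNIV (grad (\<lambda>x. f x * g x))"
    unfolding eq using F G by (intro continuous_intros)
  ultimately show ?thesis unfolding C1_supp_def using F(1) G(1)
    by (auto simp: eq)
qed

text \<open>Each difference quotient integrates to 0 because Lebesgue measure is translation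
  invariant, and dominated convergence passes this to the derivative. The ball of radius R + 1
  contains the supports of all difference quotients with step at most 1.\<close>

lemma C1_supp_integral_partial:
  assumes h: "C1_supp \<Omega> h" and i: "i \<in> Basis"
  shows "(\<integral>x. partial_deriv i h x \<partial>lborel) = 0"
proof -
  note H = C1_suppD[OF h]
  note [measurable] = C1_supp_measurable[OF h]
  obtain K where K: "compact K" "\<And>x. x \<notin> K \<Longrightarrow> h x = 0" "\<And>x. x \<notin> K \<Longrightarrow> grad h x = 0"
    using h unfolding C1_supp_def by blast
  obtain B where B: "B > 0" "\<And>x. norm (grad h x) \<le> B"
    using C1_supp_bounded_grad[OF h] by blast
  obtain R where R: "\<And>x. x \<in> K \<Longrightarrow> norm x \<le> R"
    using compact_imp_bounded[OF K(1)] bounded_iff by blast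
  have inth: "integrable lborel h"
  proof -
    have "integrable lborel (\<lambda>x. indicator K x *\<^sub>R h x)"
      using K(1) H(3) by (intro borel_integrable_compact) (auto intro: continuous_on_subset)
    moreover have "(\<lambda>x. indicator K x *\<^sub>R h x) = h" using K(2) by (auto simp: fun_eq_iff indicator_def)
    ultimately show ?thesis by simp
  qed
  define t where "t n = 1 / real (Suc n)" for n
  define s where "s n x = (h (t n *\<^sub>R i + x) - h x) / t n" for n x
  have tpos: "t n > 0" "t n \<le> 1" for n by (auto simp: t_def)
  have tlim: "t \<longlonglongrightarrow> 0"
    unfolding t_def using LIMSEQ_inverse_real_of_nat by (simp add: inverse_eq_divide)
  have lim: "(\<lambda>n. \<integral>x. s n x \<partial>lborel) \<longlonglongrightarrow> (\<integral>x. partial_deriv i h x \<partial>lborel)"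
  proof (rule integral_dominated_convergence[where w="\<lambda>x. indicator (cball 0 (R + 1)) x *\<^sub>R B"])
    have "(\<lambda>x. grad h x \<bullet> i) \<in> borel_measurable lborel" by measurable
    then show "partial_deriv i h \<in> borel_measurable lborel"
      using i by (simp cong: measurable_cong)
    show "integrable lborel (\<lambda>x. indicator (cball 0 (R + 1)) x *\<^sub>R B)"
      by (intro borel_integrable_compact) (auto intro: continuous_intros)
    show "AE x in lborel. (\<lambda>n. s n x) \<longlonglongrightarrow> partial_deriv i h x"
    proof (rule AE_I2)
      fix x
      have "((\<lambda>\<tau>. h (x + \<tau> *\<^sub>R i)) has_derivative (\<lambda>d. grad h x \<bullet> (d *\<^sub>R i))) (at 0)"
        by (rule has_derivative_compose[where f="\<lambda>\<tau>. x + \<tau> *\<^sub>R i"])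
           (use has_derivative_grad[OF H(1), of x] in \<open>auto intro!: derivative_eq_intros\<close>)
      then have "((\<lambda>\<tau>. h (x + \<tau> *\<^sub>R i)) has_real_derivative partial_deriv i h x) (at 0)"
        using i by (simp add: has_field_derivative_def mult_commute_abs)
      then have "((\<lambda>\<tau>. (h (x + \<tau> *\<^sub>R i) - h x) / \<tau>) \<longlongrightarrow> partial_deriv i h x) (at 0)"
        by (simp add: DERIV_def)
      then have "((\<lambda>n. (h (x + t n *\<^sub>R i) - h x) / t n) \<longlonglongrightarrow> partial_deriv i h x)"
        by (rule filterlim_compose)
           (use tpos tlim in \<open>auto simp: filterlim_at intro!: always_eventually less_imp_neq[THEN not_sym]\<close>)
      then show "(\<lambda>n. s n x) \<longlonglongrightarrow> partial_deriv i h x" by (simp add: s_def add.commute)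
    qed
    show "AE x in lborel. norm (s n x) \<le> indicator (cball 0 (R + 1)) x *\<^sub>R B" for n
    proof (rule AE_I2)
      fix x
      have cs: "\<bar>grad h y \<bullet> v\<bar> \<le> B * norm v" for y v
        using Cauchy_Schwarz_ineq2[of "grad h y" v] mult_right_mono[OF B(2)[of y], of "norm v"] by simp
      have lip: "norm (h (t n *\<^sub>R i + x) - h x) \<le> B * norm ((t n *\<^sub>R i + x) - x)"
        by (rule differentiable_bound[where S=UNIV and f'="\<lambda>x h'. grad h x \<bullet> h'"])
           (use has_derivative_grad[OF H(1)] cs in \<open>auto intro!: onorm_le\<close>)
      have "norm (s n x) \<le> B"
        using lip i tpos(1)[of n] by (simp add: s_def divide_le_eq)
      moreover have "s n x = 0" if "x \<notin> cball 0 (R + 1)"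
      proof -
        have "norm x > R + 1" using that by auto
        moreover have "norm (t n *\<^sub>R i + x) \<ge> norm x - norm (t n *\<^sub>R i)"
          using norm_triangle_ineq2[of x "- (t n *\<^sub>R i)"] by (simp add: add.commute)
        moreover have "norm (t n *\<^sub>R i) \<le> 1" using i tpos[of n] by simp
        ultimately have "x \<notin> K" "t n *\<^sub>R i + x \<notin> K" using R by force+
        then show ?thesis using K(2) by (simp add: s_def)
      qed
      ultimately show "norm (s n x) \<le> indicator (cball 0 (R + 1)) x *\<^sub>R B"
        by (auto simp: indicator_def)
    qed
    show "s n \<in> borel_measurable lborel" for n unfolding s_def by measurable
  qed
  have "(\<integral>x. s n x \<partial>lborel) = 0" for n
  proof -
    let ?d = "t n *\<^sub>R i"
    have "integrable (distr lborel borel ((+) ?d)) h" using inth by (simp add: lborel_distr_plus)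
    then have int2: "integrable lborel (\<lambda>x. h (?d + x))" by (simp add: integrable_distr_eq)
    have "(\<integral>x. h (?d + x) \<partial>lborel) = integral\<^sup>L (distr lborel borel ((+) ?d)) h"
      by (simp add: integral_distr)
    also have "\<dots> = integral\<^sup>L lborel h" by (simp add: lborel_distr_plus)
    finally show ?thesis unfolding s_def using int2 inth by simp
  qed
  then have "0 = (\<integral>x. partial_deriv i h x \<partial>lborel)"
    using lim by (simp only: LIMSEQ_const_iff)
  then show ?thesis by simp
qed

lemma continuous_locally_integrable:
  fixes f :: "'a::euclidean_space \<Rightarrow> 'b::euclidean_space"
  assumes "continuous_on UNIV f"
  shows "locally_integrable \<Omega> f"
  unfolding locally_integrable_def
proof (intro allI impI)
  fix K assume K: "compact K \<and> K \<subseteq> \<Omega>"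
  have "integrable lborel (\<lambda>x. indicator K x *\<^sub>R f x)"
    using K assms by (intro borel_integrable_compact) (auto intro: continuous_on_subset)
  then have "integrable lebesgue (\<lambda>x. indicator K x *\<^sub>R f x)"
    by (subst integrable_completion) auto
  then show "f absolutely_integrable_on K" by (simp add: set_integrable_def)
qed

lemma integral_lebesgue_on_eq_lborel:
  fixes F :: "'a::euclidean_space \<Rightarrow> real"
  assumes "\<Omega> \<in> sets lebesgue" "F \<in> borel_measurable borel" "\<And>x. x \<notin> \<Omega> \<Longrightarrow> F x = 0"
  shows "integral\<^sup>L (lebesgue_on \<Omega>) F = integral\<^sup>L lborel F"
proof -
  have "(\<lambda>x. indicator \<Omega> x *\<^sub>R F x) = F" using assms(3) by (auto simp: fun_eq_iff indicator_def)
  then show ?thesis using assms by (simp add: integral_restrict_space integral_completion)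
qed

lemma C1_supp_integrable_mult:
  assumes f: "C1_supp \<Omega> f" and g: "continuous_on UNIV (g :: 'a::euclidean_space \<Rightarrow> real)"
  shows "integrable lborel (\<lambda>x. f x * g x)"
proof -
  obtain K where K: "compact K" "\<And>x. x \<notin> K \<Longrightarrow> f x = 0"
    using f unfolding C1_supp_def by blast
  have "integrable lborel (\<lambda>x. indicator K x *\<^sub>R (f x * g x))"
    using K(1) g C1_suppD(3)[OF f]
    by (intro borel_integrable_compact continuous_intros) (auto intro: continuous_on_subset)
  moreover have "(\<lambda>x. indicator K x *\<^sub>R (f x * g x)) = (\<lambda>x. f x * g x)"
    using K(2) by (auto simp: fun_eq_iff indicator_def)
  ultimately show ?thesis by simp
qed

text \<open>The product rule splits the integral of a partial derivative of f g, which is 0, into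
  the two sides of integration by parts.\<close>

lemma has_weak_gradient_grad:
  assumes \<Omega>: "open \<Omega>" and f: "C1_supp \<Omega> f"
  shows "has_weak_gradient \<Omega> f (grad f)"
  unfolding has_weak_gradient_def
proof (intro conjI ballI)
  note F = C1_suppD[OF f] and [measurable] = C1_supp_measurable[OF f]
  show "locally_integrable \<Omega> f" "locally_integrable \<Omega> (grad f)"
    using F by (auto intro: continuous_locally_integrable)
  fix g and i :: 'a assume "g \<in> test_functions \<Omega>" and i: "i \<in> Basis"
  then have g: "C1_supp \<Omega> g" by (simp add: test_functions_C1_supp)
  note G = C1_suppD[OF g] and [measurable] = C1_supp_measurable[OF g]
  have [measurable]: "\<Omega> \<in> sets lebesgue" using \<Omega> by simp
  have pd: "partial_deriv i f = (\<lambda>x. grad f x \<bullet> i)" "partial_deriv i g = (\<lambda>x. grad g x \<bullet> i)"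
    using i by auto
  have c: "continuous_on UNIV (\<lambda>x. grad f x \<bullet> i)" "continuous_on UNIV (\<lambda>x. grad g x \<bullet> i)"
    using F G by (auto intro!: continuous_intros)
  have I: "integrable lborel (\<lambda>x. f x * (grad g x \<bullet> i))" "integrable lborel (\<lambda>x. (grad f x \<bullet> i) * g x)"
    using C1_supp_integrable_mult[OF f c(2)] C1_supp_integrable_mult[OF g c(1)] by (simp_all add: mult.commute)
  have "0 = (\<integral>x. partial_deriv i (\<lambda>x. f x * g x) x \<partial>lborel)"
    using C1_supp_integral_partial[OF C1_supp_mult[OF f g] i] by simp
  also have "\<dots> = (\<integral>x. f x * (grad g x \<bullet> i) + (grad f x \<bullet> i) * g x \<partial>lborel)"
    using F(1) G(1) by (simp add: partial_deriv_mult pd)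
  also have "\<dots> = (\<integral>x. f x * (grad g x \<bullet> i) \<partial>lborel) + (\<integral>x. (grad f x \<bullet> i) * g x \<partial>lborel)"
    using I by simp
  finally have *: "(\<integral>x. f x * (grad g x \<bullet> i) \<partial>lborel) = - (\<integral>x. (grad f x \<bullet> i) * g x \<partial>lborel)" by simp
  show "(\<integral>x. f x * partial_deriv i g x \<partial>lebesgue_on \<Omega>) = - (\<integral>x. (grad f x \<bullet> i) * g x \<partial>lebesgue_on \<Omega>)"
    unfolding pd by (subst (1 2) integral_lebesgue_on_eq_lborel) (use * F G in auto)
qed

lemma has_weak_gradientD:
  assumes "has_weak_gradient \<Omega> u G" "f \<in> test_functions \<Omega>" "i \<in> Basis"
  shows "(\<integral>x. u x * partial_deriv i f x \<partial>lebesgue_on \<Omega>) = - (\<integral>x. (G x \<bullet> i) * f x \<partial>lebesgue_on \<Omega>)"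
  using assms unfolding has_weak_gradient_def by blast

text \<open>The defining identities of both gradients are subtracted and tested with box bumps. In
  the limit the bumps see the open box only, and its boundary has measure 0.\<close>

lemma weak_gradient_integral_box:
  assumes \<Omega>: "open \<Omega>" and G: "has_weak_gradient \<Omega> u G" and G': "has_weak_gradient \<Omega> u G'"
    and ab: "cbox a b \<subseteq> \<Omega>" and i: "i \<in> Basis"
  shows "(\<lambda>x. (G x - G' x) \<bullet> i) absolutely_integrable_on (cbox a b)"
    "integral (cbox a b) (\<lambda>x. (G x - G' x) \<bullet> i) = 0"
proof -
  let ?H = "\<lambda>x. (G x - G' x) \<bullet> i"
  have AI: "G absolutely_integrable_on cbox a b" "G' absolutely_integrable_on cbox a b"
    using G G' ab unfolding has_weak_gradient_def locally_integrable_def by auto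
  then have AIi: "(\<lambda>x. G x \<bullet> i) absolutely_integrable_on cbox a b" "(\<lambda>x. G' x \<bullet> i) absolutely_integrable_on cbox a b"
    using absolutely_integrable_component by blast+
  then show H: "?H absolutely_integrable_on cbox a b"
    by (simp add: inner_diff_left set_integral_diff(1))
  define \<phi> where "\<phi> n = box_bump n a b" for n
  have \<phi>0: "\<phi> n x = 0" if "x \<notin> box a b" for n x using that by (simp add: \<phi>_def box_bump_outside)
  have [measurable]: "\<phi> n \<in> borel_measurable borel" for n
    using C1_supp_measurable(1)[OF test_functions_C1_supp[OF box_bump_test[OF ab]]] by (simp add: \<phi>_def)
  have [measurable]: "\<phi> n \<in> borel_measurable lebesgue" for n
    by (simp add: measurable_completion)
  have sp: "\<Omega> \<in> sets lebesgue" using \<Omega> by simp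
  have I: "integrable lebesgue (\<lambda>x. (g x \<bullet> i) * \<phi> n x)"
    if g: "(\<lambda>x. g x \<bullet> i) absolutely_integrable_on cbox a b" for g n
  proof (rule Bochner_Integration.integrable_bound)
    have J: "integrable lebesgue (\<lambda>x. indicator (cbox a b) x *\<^sub>R (g x \<bullet> i))"
      using g by (simp add: set_integrable_def)
    then show "integrable lebesgue (\<lambda>x. indicator (cbox a b) x *\<^sub>R (g x \<bullet> i))" .
    have "(\<lambda>x. (g x \<bullet> i) * \<phi> n x) = (\<lambda>x. (indicator (cbox a b) x *\<^sub>R (g x \<bullet> i)) * \<phi> n x)"
      using \<phi>0 box_subset_cbox[of a b] by (force simp: indicator_def fun_eq_iff)
    also have "\<dots> \<in> borel_measurable lebesgue" using J by measurable
    finally show "(\<lambda>x. (g x \<bullet> i) * \<phi> n x) \<in> borel_measurable lebesgue" .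
    show "AE x in lebesgue. norm ((g x \<bullet> i) * \<phi> n x) \<le> norm (indicator (cbox a b) x *\<^sub>R (g x \<bullet> i))"
    proof (rule AE_I2)
      fix x
      have "\<bar>\<phi> n x\<bar> \<le> 1" using box_bump_bounds[of n a b x] by (auto simp: \<phi>_def)
      then show "norm ((g x \<bullet> i) * \<phi> n x) \<le> norm (indicator (cbox a b) x *\<^sub>R (g x \<bullet> i))"
        using \<phi>0[of x n] box_subset_cbox[of a b]
        by (cases "x \<in> box a b") (auto simp: abs_mult subsetD intro: mult_left_le)
    qed
  qed
  have on: "integral\<^sup>L (lebesgue_on \<Omega>) (\<lambda>x. (g x \<bullet> i) * \<phi> n x) = integral\<^sup>L lebesgue (\<lambda>x. (g x \<bullet> i) * \<phi> n x)" for g n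
  proof -
    have "(\<lambda>x. indicator \<Omega> x *\<^sub>R ((g x \<bullet> i) * \<phi> n x)) = (\<lambda>x. (g x \<bullet> i) * \<phi> n x)"
      using \<phi>0 box_subset_cbox[of a b] ab by (force simp: indicator_def fun_eq_iff)
    then show ?thesis using sp by (simp add: integral_restrict_space)
  qed
  have z: "(\<integral>x. ?H x * \<phi> n x \<partial>lebesgue) = 0" for n
  proof -
    have "\<phi> n \<in> test_functions \<Omega>" using box_bump_test[OF ab] by (simp add: \<phi>_def)
    then have "(\<integral>x. (G x \<bullet> i) * \<phi> n x \<partial>lebesgue_on \<Omega>) = (\<integral>x. (G' x \<bullet> i) * \<phi> n x \<partial>lebesgue_on \<Omega>)"
      using has_weak_gradientD[OF G _ i] has_weak_gradientD[OF G' _ i] by simp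
    then show ?thesis
      using I[OF AIi(1), of n] I[OF AIi(2), of n] by (simp add: on inner_diff_left left_diff_distrib)
  qed
  have J: "integrable lebesgue (\<lambda>x. indicator (cbox a b) x *\<^sub>R ?H x)"
    using H by (simp add: set_integrable_def)
  have lim: "(\<lambda>n. \<integral>x. ?H x * \<phi> n x \<partial>lebesgue) \<longlonglongrightarrow> (\<integral>x. indicator (cbox a b) x *\<^sub>R ?H x \<partial>lebesgue)"
  proof (rule integral_dominated_convergence[where w="\<lambda>x. norm (indicator (cbox a b) x *\<^sub>R ?H x)"])
    show "integrable lebesgue (\<lambda>x. norm (indicator (cbox a b) x *\<^sub>R ?H x))" using J by simp
    show "(\<lambda>x. indicator (cbox a b) x *\<^sub>R ?H x) \<in> borel_measurable lebesgue" using J by measurable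
    show "(\<lambda>x. ?H x * \<phi> n x) \<in> borel_measurable lebesgue" for n
      using I[of "\<lambda>x. G x - G' x" n] AIi by (simp add: inner_diff_left set_integral_diff(1) borel_measurable_integrable)
    show "AE x in lebesgue. norm (?H x * \<phi> n x) \<le> norm (indicator (cbox a b) x *\<^sub>R ?H x)" for n
    proof (rule AE_I2)
      fix x
      have "\<bar>\<phi> n x\<bar> \<le> 1" using box_bump_bounds[of n a b x] by (auto simp: \<phi>_def)
      then show "norm (?H x * \<phi> n x) \<le> norm (indicator (cbox a b) x *\<^sub>R ?H x)"
        using \<phi>0[of x n] box_subset_cbox[of a b]
        by (cases "x \<in> box a b") (auto simp: abs_mult subsetD intro: mult_left_le)
    qed
    have "negligible (cbox a b - box a b)" using negligible_frontier_interval .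
    then have "AE x in lebesgue. x \<notin> cbox a b - box a b"
      by (intro AE_not_in) (simp add: negligible_iff_null_sets)
    then show "AE x in lebesgue. (\<lambda>n. ?H x * \<phi> n x) \<longlonglongrightarrow> indicator (cbox a b) x *\<^sub>R ?H x"
    proof eventually_elim
      case (elim x)
      have "(\<lambda>n. ?H x * \<phi> n x) \<longlonglongrightarrow> ?H x * indicator (box a b) x"
        unfolding \<phi>_def by (intro tendsto_intros box_bump_tendsto)
      then show ?case using elim box_subset_cbox[of a b] by (cases "x \<in> box a b") (auto simp: subsetD)
    qed
  qed
  have "0 = (\<integral>x. indicator (cbox a b) x *\<^sub>R ?H x \<partial>lebesgue)"
    using lim by (simp only: z LIMSEQ_const_iff)
  then show "integral (cbox a b) ?H = 0"
    using set_lebesgue_integral_eq_integral(2)[OF H] by (simp only: set_lebesgue_integral_def)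
qed

text \<open>Lebesgue differentiation recovers each component of the difference from its integrals
  over small cubes, all of which vanish; countably many boxes then exhaust the domain.\<close>

lemma weak_gradient_unique:
  assumes \<Omega>: "open \<Omega>" and G: "has_weak_gradient \<Omega> u G" and G': "has_weak_gradient \<Omega> u G'"
  shows "AE x in lebesgue_on \<Omega>. G x = G' x"
proof -
  have loc: "negligible {x \<in> cbox a b. (G x - G' x) \<bullet> i \<noteq> 0}"
    if ab: "cbox a b \<subseteq> \<Omega>" and i: "i \<in> Basis" for a b i
  proof -
    define F where "F x = (if x \<in> cbox a b then (G x - G' x) \<bullet> i else 0)" for x
    have "F absolutely_integrable_on UNIV"
      using absolutely_integrable_restrict_UNIV[THEN iffD2, OF weak_gradient_integral_box(1)[OF \<Omega> G G' ab i]]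
      by (simp add: F_def[abs_def])
    then have "F integrable_on cbox c d" for c d
      by (meson absolutely_integrable_on_def integrable_on_subcbox subset_UNIV)
    then obtain N where N: "negligible N" "\<And>x e. x \<notin> N \<Longrightarrow> 0 < e \<Longrightarrow>
        \<exists>d>0. \<forall>h. 0 < h \<and> h < d \<longrightarrow> norm (integral (cbox x (x + h *\<^sub>R One)) F /\<^sub>R h ^ DIM('a) - F x) < e"
      using integrable_ccontinuous_explicit[of F] by blast
    have "F x = 0" if x: "x \<in> box a b" "x \<notin> N" for x
    proof (rule ccontr)
      assume ne: "F x \<noteq> 0"
      then obtain d where d: "d > 0" "\<And>h. 0 < h \<Longrightarrow> h < d \<Longrightarrow>
          norm (integral (cbox x (x + h *\<^sub>R One)) F /\<^sub>R h ^ DIM('a) - F x) < norm (F x)"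
        using N(2)[OF x(2), of "norm (F x)"] by auto
      \<comment> \<open>The half of \<open>d\<close> keeps the step admissible for the
        differentiation theorem, and the minimum over the coordinates keeps the cube with lower
        corner x inside the box.\<close>
      define h where "h = min (d / 2) (Min ((\<lambda>i. b \<bullet> i - x \<bullet> i) ` Basis))"
      have "h \<le> b \<bullet> j - x \<bullet> j" if "j \<in> Basis" for j
        unfolding h_def using that by (intro min.coboundedI2 Min_le) auto
      then have h: "0 < h" "h < d" "\<And>i. i \<in> Basis \<Longrightarrow> x \<bullet> i + h \<le> b \<bullet> i"
        using d(1) x(1) by (auto simp: h_def mem_box add_le_imp_le_diff algebra_simps)
      have sub: "cbox x (x + h *\<^sub>R One) \<subseteq> cbox a b"
        using x(1) h(3) by (auto simp: subset_box mem_box inner_simps less_imp_le) 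
      have "integral (cbox x (x + h *\<^sub>R One)) F = integral (cbox x (x + h *\<^sub>R One)) (\<lambda>x. (G x - G' x) \<bullet> i)"
        using sub by (intro integral_cong) (auto simp: F_def)
      also have "\<dots> = 0"
        by (rule weak_gradient_integral_box(2)[OF \<Omega> G G' _ i]) (use sub ab in auto)
      finally show False using d(2)[OF h(1,2)] by simp
    qed
    then have "{x \<in> cbox a b. (G x - G' x) \<bullet> i \<noteq> 0} \<subseteq> N \<union> (cbox a b - box a b)"
      by (force simp: F_def)
    then show ?thesis
      using N(1) negligible_frontier_interval negligible_subset negligible_Un by blast
  qed
  obtain \<D> where \<D>: "countable \<D>" "\<D> \<subseteq> Pow \<Omega>" "\<And>X. X \<in> \<D> \<Longrightarrow> \<exists>a b. X = cbox a b" "\<Union>\<D> = \<Omega>"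
    using open_countable_Union_open_cbox[OF \<Omega>] by metis
  have "negligible (\<Union>X\<in>\<D>. {x \<in> X. G x \<noteq> G' x})"
  proof (rule negligible_countable_Union)
    show "countable ((\<lambda>X. {x \<in> X. G x \<noteq> G' x}) ` \<D>)" using \<D>(1) by simp
    fix Y assume "Y \<in> (\<lambda>X. {x \<in> X. G x \<noteq> G' x}) ` \<D>"
    then obtain X where X: "X \<in> \<D>" "Y = {x \<in> X. G x \<noteq> G' x}" by blast
    obtain a b where ab: "X = cbox a b" using \<D>(3) X(1) by blast
    have "Y \<subseteq> (\<Union>i\<in>Basis. {x \<in> cbox a b. (G x - G' x) \<bullet> i \<noteq> 0})"
      using X ab by (auto simp: euclidean_eq_iff[of "G _"] inner_diff_left)
    moreover have "negligible (\<Union>i\<in>Basis. {x \<in> cbox a b. (G x - G' x) \<bullet> i \<noteq> 0})"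
      using loc ab X(1) \<D>(2) by (intro negligible_Union) auto
    ultimately show "negligible Y" using negligible_subset by blast
  qed
  moreover have "(\<Union>X\<in>\<D>. {x \<in> X. G x \<noteq> G' x}) = {x \<in> \<Omega>. G x \<noteq> G' x}" using \<D>(4) by auto
  ultimately have "{x \<in> \<Omega>. G x \<noteq> G' x} \<in> null_sets lebesgue" by (simp add: negligible_iff_null_sets)
  then have "AE x in lebesgue. x \<notin> {x \<in> \<Omega>. G x \<noteq> G' x}" by (rule AE_not_in)
  then show ?thesis using \<Omega> by (subst AE_restrict_space_iff) auto
qed

lemma has_weak_gradient_diff:
  assumes \<Omega>: "open \<Omega>" and u: "has_weak_gradient \<Omega> u G" and f: "f \<in> test_functions \<Omega>"
  shows "has_weak_gradient \<Omega> (\<lambda>x. u x - f x) (\<lambda>x. G x - grad f x)"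
proof -
  have fw: "has_weak_gradient \<Omega> f (grad f)"
    using has_weak_gradient_grad[OF \<Omega> test_functions_C1_supp[OF f]] .
  \<comment> \<open>The Bochner integral is additive only on integrable functions, so each product
    with a test function or its derivative is first shown integrable.\<close>
  have I: "integrable (lebesgue_on \<Omega>) (\<lambda>x. w x * h x)"
    if w: "locally_integrable \<Omega> w" and h: "continuous_on UNIV h" and K: "compact K" "K \<subseteq> \<Omega>" "\<And>x. x \<notin> K \<Longrightarrow> h x = 0"
    for w h :: "'a \<Rightarrow> real" and K
  proof -
    have w1: "integrable lebesgue (\<lambda>x. indicator K x *\<^sub>R w x)"
      using w K unfolding locally_integrable_def set_integrable_def by blast
    have "compact (h ` K)" using h K(1) by (intro compact_continuous_image) (auto intro: continuous_on_subset)
    then obtain B where B: "B > 0" "\<And>x. x \<in> K \<Longrightarrow> norm (h x) \<le> B"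
      using compact_imp_bounded bounded_pos by (metis image_eqI)
    have hm [measurable]: "h \<in> borel_measurable lebesgue"
      using h by (intro measurable_completion) (simp add: borel_measurable_continuous_onI)
    have "integrable lebesgue (\<lambda>x. (indicator K x *\<^sub>R w x) * h x)"
    proof (rule Bochner_Integration.integrable_bound)
      show "integrable lebesgue (\<lambda>x. B * (indicator K x *\<^sub>R w x))" using w1 by (rule integrable_mult_right)
      show "(\<lambda>x. (indicator K x *\<^sub>R w x) * h x) \<in> borel_measurable lebesgue"
        using borel_measurable_integrable[OF w1] by measurable
      show "AE x in lebesgue. norm ((indicator K x *\<^sub>R w x) * h x) \<le> norm (B * (indicator K x *\<^sub>R w x))"
        using B by (intro AE_I2) (auto simp: indicator_def abs_mult mult.commute intro!: mult_right_mono)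
    qed
    moreover have "(\<lambda>x. indicator \<Omega> x *\<^sub>R (w x * h x)) = (\<lambda>x. (indicator K x *\<^sub>R w x) * h x)"
      using K(2,3) by (auto simp: fun_eq_iff indicator_def)
    ultimately show ?thesis using \<Omega> by (simp add: integrable_restrict_space)
  qed
  show ?thesis
    unfolding has_weak_gradient_def
  proof (intro conjI ballI)
    show "locally_integrable \<Omega> (\<lambda>x. u x - f x)" "locally_integrable \<Omega> (\<lambda>x. G x - grad f x)"
      using u fw unfolding has_weak_gradient_def locally_integrable_def by (auto intro: set_integral_diff(1))
    fix g and i :: 'a assume g: "g \<in> test_functions \<Omega>" and i: "i \<in> Basis"
    note g' = test_functions_C1_supp[OF g]
    obtain K where K: "compact K" "K \<subseteq> \<Omega>" "\<And>x. x \<notin> K \<Longrightarrow> g x = 0" "\<And>x. x \<notin> K \<Longrightarrow> grad g x = 0"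
      using g' unfolding C1_supp_def by blast
    have pd: "partial_deriv i g = (\<lambda>x. grad g x \<bullet> i)" using i by auto
    have c: "continuous_on UNIV g" "continuous_on UNIV (\<lambda>x. grad g x \<bullet> i)"
      using C1_suppD[OF g'] by (auto intro!: continuous_intros)
    have comp: "locally_integrable \<Omega> (\<lambda>x. H x \<bullet> i)" if "locally_integrable \<Omega> H" for H :: "'a \<Rightarrow> 'a"
      using that absolutely_integrable_component unfolding locally_integrable_def by blast
    have l: "locally_integrable \<Omega> u" "locally_integrable \<Omega> f" "locally_integrable \<Omega> (\<lambda>x. G x \<bullet> i)" "locally_integrable \<Omega> (\<lambda>x. grad f x \<bullet> i)"
      using u fw comp unfolding has_weak_gradient_def by blast+
    have J: "integrable (lebesgue_on \<Omega>) (\<lambda>x. u x * (grad g x \<bullet> i))" "integrable (lebesgue_on \<Omega>) (\<lambda>x. f x * (grad g x \<bullet> i))"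
      "integrable (lebesgue_on \<Omega>) (\<lambda>x. (G x \<bullet> i) * g x)" "integrable (lebesgue_on \<Omega>) (\<lambda>x. (grad f x \<bullet> i) * g x)"
      using l c K by (auto intro!: I[where K=K])
    have "(\<integral>x. u x * (grad g x \<bullet> i) \<partial>lebesgue_on \<Omega>) = - (\<integral>x. (G x \<bullet> i) * g x \<partial>lebesgue_on \<Omega>)"
      "(\<integral>x. f x * (grad g x \<bullet> i) \<partial>lebesgue_on \<Omega>) = - (\<integral>x. (grad f x \<bullet> i) * g x \<partial>lebesgue_on \<Omega>)"
      using has_weak_gradientD[OF u g i] has_weak_gradientD[OF fw g i] by (simp_all add: pd)
    then show "(\<integral>x. (u x - f x) * partial_deriv i g x \<partial>lebesgue_on \<Omega>) = - (\<integral>x. ((G x - grad f x) \<bullet> i) * g x \<partial>lebesgue_on \<Omega>)"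
      unfolding pd inner_diff_left left_diff_distrib using J by simp
  qed
qed

text \<open>\<open>weak_gradient\<close> of the difference is a fresh choice, unrelated to the one
  made for u; uniqueness links it to \<open>G\<close> and \<open>grad f\<close>.\<close>

lemma AE_weak_gradient_diff:
  assumes \<Omega>: "open \<Omega>" and u: "has_weak_gradient \<Omega> u G" and f: "f \<in> test_functions \<Omega>"
  shows "AE x in lebesgue_on \<Omega>. weak_gradient \<Omega> (\<lambda>x. u x - f x) x = G x - grad f x"
proof -
  note d = has_weak_gradient_diff[OF assms]
  then have "has_weak_gradient \<Omega> (\<lambda>x. u x - f x) (weak_gradient \<Omega> (\<lambda>x. u x - f x))"
    unfolding weak_gradient_def by (rule someI[where P="has_weak_gradient \<Omega> (\<lambda>x. u x - f x)"])
  from weak_gradient_unique[OF \<Omega> this d] show ?thesis .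
qed

lemma AE_weak_gradient:
  assumes "open \<Omega>" "has_weak_gradient \<Omega> u G"
  shows "AE x in lebesgue_on \<Omega>. weak_gradient \<Omega> u x = G x"
  using weak_gradient_unique[OF assms(1) someI[of "has_weak_gradient \<Omega> u", OF assms(2)] assms(2)]
  by (simp add: weak_gradient_def)

section \<open>A subcritical potential estimate\<close>

definition unif01 :: "real measure" where
  "unif01 = density lborel (indicator {0<..<1})"

text \<open>The cube [1, 2]^N has volume 1, so no normalising factor appears, and it avoids the
  origin.\<close>

definition unif_box :: "'a::euclidean_space measure" where
  "unif_box = density lborel (indicator (cbox One (2 *\<^sub>R One)))"

lemma sets_unif [simp, measurable_cong]: "sets unif01 = sets borel" "sets unif_box = sets borel"
  by (auto simp: unif01_def unif_box_def)

lemma space_unif [simp]: "space unif01 = UNIV" "space unif_box = UNIV"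
  by (auto simp: unif01_def unif_box_def)

lemma prob_space_unif01: "prob_space unif01"
  by (rule prob_spaceI) (simp add: unif01_def emeasure_density)

lemma prob_space_unif_box: "prob_space unif_box"
  by (rule prob_spaceI) (simp add: unif_box_def emeasure_density emeasure_lborel_cbox inner_simps)

lemma nn_integral_unif01:
  "F \<in> borel_measurable borel \<Longrightarrow> (\<integral>\<^sup>+\<rho>. F \<rho> \<partial>unif01) = (\<integral>\<^sup>+\<rho>. F \<rho> * indicator {0<..<1} \<rho> \<partial>lborel)"
  unfolding unif01_def by (subst nn_integral_density) (auto simp: mult.commute)

lemma nn_integral_unif_box:
  "F \<in> borel_measurable borel \<Longrightarrow>
    (\<integral>\<^sup>+w. F w \<partial>unif_box) = (\<integral>\<^sup>+w. F w * indicator (cbox One (2 *\<^sub>R One)) w \<partial>lborel)"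
  unfolding unif_box_def by (subst nn_integral_density) (auto simp: mult.commute)

lemma AE_unif01: "AE \<rho> in unif01. 0 < \<rho> \<and> \<rho> < 1"
  unfolding unif01_def by (subst AE_density) (auto simp: indicator_def split: if_splits)

lemma AE_unif_box: "AE w in unif_box. w \<in> cbox One (2 *\<^sub>R One)"
  unfolding unif_box_def by (subst AE_density) (auto simp: indicator_def split: if_splits)

lemma nn_integral_has_integral_on:
  fixes f :: "'a::euclidean_space \<Rightarrow> real"
  assumes [measurable]: "f \<in> borel_measurable borel" "S \<in> sets borel"
    and "\<And>x. 0 \<le> f x" and I: "(f has_integral I) S"
  shows "(\<integral>\<^sup>+x. ennreal (indicator S x * f x) \<partial>lborel) = ennreal I"
proof (rule nn_integral_has_integral_lborel)
  have "(\<lambda>x. indicator S x * f x) = (\<lambda>x. if x \<in> S then f x else 0)" by auto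
  then show "((\<lambda>x. indicator S x * f x) has_integral I) UNIV" using I by (simp only: has_integral_restrict_UNIV)
qed (use assms in auto)

text \<open>Fundamental theorem of calculus along the segment, written as an average for a
  probability measure so that Tonelli and Jensen apply directly.\<close>

lemma C1_supp_diff_le:
  assumes f: "C1_supp \<Omega> f"
  shows "ennreal \<bar>f (x + h) - f x\<bar> \<le> (\<integral>\<^sup>+\<theta>. ennreal (norm h * norm (grad f (x + \<theta> *\<^sub>R h))) \<partial>unif01)"
proof -
  note F = C1_suppD[OF f] and [measurable] = C1_supp_measurable[OF f]
  let ?g = "\<lambda>\<theta>. norm h * norm (grad f (x + \<theta> *\<^sub>R h))"
  have cg: "continuous_on {0..1} (\<lambda>\<theta>. grad f (x + \<theta> *\<^sub>R h))"
    by (rule continuous_on_compose2[OF F(2)]) (auto intro!: continuous_intros)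
  have D: "((\<lambda>\<theta>. f (x + \<theta> *\<^sub>R h)) has_vector_derivative grad f (x + \<theta> *\<^sub>R h) \<bullet> h) (at \<theta> within {0..1})" for \<theta>
  proof -
    have "((\<lambda>\<theta>. f (x + \<theta> *\<^sub>R h)) has_derivative (\<lambda>d. grad f (x + \<theta> *\<^sub>R h) \<bullet> (d *\<^sub>R h))) (at \<theta> within {0..1})"
      by (rule has_derivative_compose[where f="\<lambda>\<tau>. x + \<tau> *\<^sub>R h", OF _ has_derivative_grad[OF F(1)]])
         (auto intro!: derivative_eq_intros)
    then show ?thesis by (simp add: has_vector_derivative_def)
  qed
  have I: "((\<lambda>\<theta>. grad f (x + \<theta> *\<^sub>R h) \<bullet> h) has_integral (f (x + h) - f x)) {0..1}"
    using fundamental_theorem_of_calculus[of 0 1 "\<lambda>\<theta>. f (x + \<theta> *\<^sub>R h)" "\<lambda>\<theta>. grad f (x + \<theta> *\<^sub>R h) \<bullet> h"] D by simp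
  have J: "(?g has_integral integral {0..1} ?g) {0..1}"
    using cg by (intro integrable_integral integrable_continuous_real continuous_intros)
  have "norm (f (x + h) - f x) \<le> integral {0..1} ?g"
    by (subst integral_unique[OF I, symmetric], rule integral_norm_bound_integral)
       (use I J in \<open>auto simp: has_integral_iff mult.commute[of "norm h"] Cauchy_Schwarz_ineq2\<close>)
  then have "ennreal \<bar>f (x + h) - f x\<bar> \<le> ennreal (integral {0..1} ?g)" by (simp add: ennreal_leI)
  also have "\<dots> = (\<integral>\<^sup>+\<theta>. ennreal (indicator {0..1} \<theta> * ?g \<theta>) \<partial>lborel)"
    by (rule nn_integral_has_integral_on[where f="?g", symmetric]) (use J in auto)
  also have "\<dots> = (\<integral>\<^sup>+\<theta>. ennreal (?g \<theta>) * indicator {0<..<1} \<theta> \<partial>lborel)"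
  proof (rule nn_integral_cong_AE)
    have "AE \<theta> in lborel. \<theta> \<noteq> (0::real)" "AE \<theta> in lborel. \<theta> \<noteq> (1::real)"
      by (rule AE_lborel_singleton)+
    then show "AE \<theta> in lborel. ennreal (indicator {0..1} \<theta> * ?g \<theta>) = ennreal (?g \<theta>) * indicator {0<..<1} \<theta>"
      by eventually_elim (auto simp: indicator_def)
  qed
  also have "\<dots> = (\<integral>\<^sup>+\<theta>. ennreal (?g \<theta>) \<partial>unif01)"
    by (rule nn_integral_unif01[symmetric]) measurable
  finally show ?thesis .
qed

text \<open>If neither argument is 0 this is convexity of the power; otherwise it reduces to s^t <=
  s for s in (0, 1).\<close>

lemma powr_convex_nonneg:
  fixes s x z t :: real
  assumes t: "1 \<le> t" and "0 < s" "s < 1" "0 \<le> x" "0 \<le> z"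
  shows "((1 - s) * x + s * z) powr t \<le> (1 - s) * x powr t + s * z powr t"
proof -
  have sc: "(s * z) powr t \<le> s * z powr t" if "0 < s" "s < 1" "0 \<le> z" for s z :: real
  proof -
    have "s powr t \<le> s powr 1" using that t by (intro powr_mono') auto
    then show ?thesis using that by (simp add: powr_mult mult_right_mono)
  qed
  show ?thesis
  proof (cases "x = 0 \<or> z = 0")
    case True
    then show ?thesis using assms sc[of s z] sc[of "1 - s" x] by auto
  next
    case False
    then show ?thesis using convex_onD[OF powr_convex[OF t], of s x z] assms by simp
  qed
qed

text \<open>An infinite right side leaves nothing to show. A finite one makes \<open>X\<close>
  integrable, because X <= 1 + X^t and the measure is finite, and then the classical inequality
  applies.\<close>

lemma powr_jensen_nn:
  assumes M: "prob_space M" and X[measurable]: "X \<in> borel_measurable M" and pos: "\<And>x. 0 \<le> X x"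
    and t: "1 \<le> t" and y: "0 \<le> y" "ennreal y \<le> (\<integral>\<^sup>+x. ennreal (X x) \<partial>M)"
  shows "ennreal (y powr t) \<le> (\<integral>\<^sup>+x. ennreal (X x powr t) \<partial>M)"
proof (cases "(\<integral>\<^sup>+x. ennreal (X x powr t) \<partial>M) = \<infinity>")
  case False
  interpret prob_space M by fact
  have i1: "integrable M (\<lambda>x. X x powr t)"
    using False by (intro integrableI_nonneg) (auto simp: top.not_eq_extremum)
  have i2: "integrable M X"
  proof (rule Bochner_Integration.integrable_bound)
    show "integrable M (\<lambda>x. 1 + X x powr t)" using i1 by simp
    show "AE x in M. norm (X x) \<le> norm (1 + X x powr t)"
    proof (rule AE_I2)
      fix x
      have "X x \<le> 1 + X x powr t"
      proof (cases "X x \<le> 1")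
        case False
        then have "X x powr 1 \<le> X x powr t" using t by (intro powr_mono) auto
        then show ?thesis using False by simp
      qed (simp add: add_increasing2)
      then show "norm (X x) \<le> norm (1 + X x powr t)" using pos[of x] by simp
    qed
  qed simp
  have "(\<integral>\<^sup>+x. ennreal (X x) \<partial>M) = ennreal (expectation X)"
    using i2 pos by (intro nn_integral_eq_integral) auto
  then have yE: "y \<le> expectation X" using y pos by (simp add: integral_nonneg_AE)
  \<comment> \<open>With the absolute value the power is convex on the whole line, so Jensen's
    inequality asks nothing about the range of \<open>X\<close>.\<close>
  have cv: "convex_on UNIV (\<lambda>x. \<bar>x\<bar> powr t)"
  proof (rule convex_onI)
    fix s x z :: real assume s: "0 < s" "s < 1"
    have "\<bar>(1 - s) * x + s * z\<bar> \<le> (1 - s) * \<bar>x\<bar> + s * \<bar>z\<bar>"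
      using s by (intro order_trans[OF abs_triangle_ineq]) (simp add: abs_mult)
    then have "\<bar>(1 - s) * x + s * z\<bar> powr t \<le> ((1 - s) * \<bar>x\<bar> + s * \<bar>z\<bar>) powr t"
      using t by (intro powr_mono2) auto
    also have "\<dots> \<le> (1 - s) * \<bar>x\<bar> powr t + s * \<bar>z\<bar> powr t"
      using powr_convex_nonneg[OF t s, of "\<bar>x\<bar>" "\<bar>z\<bar>"] by simp
    finally show "\<bar>(1 - s) *\<^sub>R x + s *\<^sub>R z\<bar> powr t \<le> (1 - s) * \<bar>x\<bar> powr t + s * \<bar>z\<bar> powr t" by simp
  qed simp
  have "\<bar>expectation X\<bar> powr t \<le> expectation (\<lambda>x. \<bar>X x\<bar> powr t)"
    by (rule jensens_inequality[where I=UNIV]) (use i1 i2 pos cv in auto)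
  then have "y powr t \<le> expectation (\<lambda>x. X x powr t)"
    using powr_mono2[OF _ y(1) yE, of t] y(1) yE t pos by simp
  then have "ennreal (y powr t) \<le> ennreal (expectation (\<lambda>x. X x powr t))" by (rule ennreal_leI)
  also have "\<dots> = (\<integral>\<^sup>+x. ennreal (X x powr t) \<partial>M)"
    using i1 by (intro nn_integral_eq_integral[symmetric]) auto
  finally show ?thesis .
qed simp

text \<open>For nonnegative G the substitution y = x + \<rho> L w shows that this is dominated, up
  to constants, by a truncated Riesz potential of order 1 + \<kappa>, with kernel |x - y|^(1 +
  \<kappa> - N). Both averages are kept explicit, so the kernel never has to be computed.\<close>

definition riesz :: "real \<Rightarrow> real \<Rightarrow> ('a::euclidean_space \<Rightarrow> real) \<Rightarrow> 'a \<Rightarrow> ennreal" where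
  "riesz \<kappa> L G x = (\<integral>\<^sup>+\<rho>. \<integral>\<^sup>+w. ennreal (\<rho> powr \<kappa> * G (x + (\<rho> * L) *\<^sub>R w)) \<partial>unif_box \<partial>unif01)"

lemma nn_integral_scale_le:
  fixes F :: "'a::euclidean_space \<Rightarrow> ennreal"
  assumes [measurable]: "F \<in> borel_measurable borel" and c: "c > 0" and I: "(\<integral>\<^sup>+x. F x \<partial>lborel) \<le> 1"
  shows "(\<integral>\<^sup>+w. F (x + c *\<^sub>R w) \<partial>lborel) \<le> ennreal (c powr - real DIM('a))"
proof -
  have "(\<integral>\<^sup>+x. F x \<partial>lborel) = ennreal (\<bar>c\<bar> ^ DIM('a)) * (\<integral>\<^sup>+w. F (x + c *\<^sub>R w) \<partial>lborel)"
    using c by (subst lborel_affine[of c x]) (simp_all add: nn_integral_density nn_integral_distr nn_integral_cmult)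
  then have le: "ennreal (c ^ DIM('a)) * (\<integral>\<^sup>+w. F (x + c *\<^sub>R w) \<partial>lborel) \<le> 1"
    using I c by simp
  have "(\<integral>\<^sup>+w. F (x + c *\<^sub>R w) \<partial>lborel) =
      ennreal (c powr - real DIM('a)) * (ennreal (c ^ DIM('a)) * (\<integral>\<^sup>+w. F (x + c *\<^sub>R w) \<partial>lborel))"
    using c by (simp add: mult.assoc[symmetric] ennreal_mult'[symmetric] powr_minus powr_realpow)
  also have "\<dots> \<le> ennreal (c powr - real DIM('a)) * 1" by (intro mult_left_mono le) simp
  finally show ?thesis by simp
qed

lemma nn_integral_translate:
  fixes F :: "'a::euclidean_space \<Rightarrow> ennreal"
  assumes [measurable]: "F \<in> borel_measurable borel"
  shows "(\<integral>\<^sup>+x. F (x + c) \<partial>lborel) = (\<integral>\<^sup>+x. F x \<partial>lborel)"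
proof -
  have "(\<integral>\<^sup>+x. F x \<partial>lborel) = (\<integral>\<^sup>+x. F x \<partial>distr lborel borel ((+) c))" by (simp add: lborel_distr_plus)
  also have "\<dots> = (\<integral>\<^sup>+x. F (x + c) \<partial>lborel)" by (simp add: nn_integral_distr add.commute)
  finally show ?thesis by simp
qed

lemma nn_integral_powr_unit:
  assumes "\<beta> > -1"
  shows "(\<integral>\<^sup>+\<rho>. ennreal (\<rho> powr \<beta>) * indicator {0<..<1} \<rho> \<partial>lborel) = ennreal (1 / (\<beta> + 1))"
proof -
  have "((\<lambda>\<rho>. \<rho> powr \<beta>) has_integral (1 / (\<beta> + 1))) {0..1::real}"
    using has_integral_powr_from_0[OF assms, of 1] by simp
  then have "(\<integral>\<^sup>+\<rho>. ennreal (indicator {0..1} \<rho> * \<rho> powr \<beta>) \<partial>lborel) = ennreal (1 / (\<beta> + 1))"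
    by (intro nn_integral_has_integral_on[where f="\<lambda>\<rho>. \<rho> powr \<beta>"]) auto
  moreover have "(\<integral>\<^sup>+\<rho>. ennreal (indicator {0..1} \<rho> * \<rho> powr \<beta>) \<partial>lborel)
      = (\<integral>\<^sup>+\<rho>. ennreal (\<rho> powr \<beta>) * indicator {0<..<1} \<rho> \<partial>lborel)"
  proof (rule nn_integral_cong_AE)
    have "AE \<theta> in lborel. \<theta> \<noteq> (0::real)" "AE \<theta> in lborel. \<theta> \<noteq> (1::real)"
      by (rule AE_lborel_singleton)+
    then show "AE \<rho> in lborel. ennreal (indicator {0..1} \<rho> * \<rho> powr \<beta>) = ennreal (\<rho> powr \<beta>) * indicator {0<..<1} \<rho>"
      by eventually_elim (auto simp: indicator_def)
  qed
  ultimately show ?thesis by simp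
qed

text \<open>In \<open>m\<^sup>t = m\<^sup>P m\<^sup>(\<^sup>t\<^sup>-\<^sup>P\<^sup>)\<close> the second factor is bounded by its supremum, through Jensen's inequality and
  scaling, and the first one is integrated.\<close>

lemma box_average_powr:
  fixes G :: "'a::euclidean_space \<Rightarrow> real"
  assumes P: "1 \<le> P" "P \<le> t" and [measurable]: "G \<in> borel_measurable borel"
    and G0: "\<And>x. 0 \<le> G x" and GB: "\<And>x. G x \<le> B"
    and I: "(\<integral>\<^sup>+x. ennreal (G x powr P) \<partial>lborel) \<le> 1" and c: "c > 0"
  shows "(\<integral>\<^sup>+x. ennreal (enn2real (\<integral>\<^sup>+w. ennreal (G (x + c *\<^sub>R w)) \<partial>unif_box) powr t) \<partial>lborel)
    \<le> ennreal (c powr (- real DIM('a) * (t / P - 1)))"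
proof -
  interpret W: prob_space "unif_box :: 'a measure" by (rule prob_space_unif_box)
  interpret PW: pair_sigma_finite "lborel :: 'a measure" "unif_box :: 'a measure" ..
  define M where "M x = (\<integral>\<^sup>+w. ennreal (G (x + c *\<^sub>R w) powr P) \<partial>unif_box)" for x
  define m where "m x = enn2real (\<integral>\<^sup>+w. ennreal (G (x + c *\<^sub>R w)) \<partial>unif_box)" for x
  have [measurable]: "M \<in> borel_measurable borel" unfolding M_def by measurable
  have fin: "(\<integral>\<^sup>+w. ennreal (G (x + c *\<^sub>R w)) \<partial>unif_box) < \<infinity>" for x
  proof -
    have "(\<integral>\<^sup>+w. ennreal (G (x + c *\<^sub>R w)) \<partial>unif_box) \<le> (\<integral>\<^sup>+w. ennreal B \<partial>(unif_box :: 'a measure))"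
      by (intro nn_integral_mono ennreal_leI GB)
    also have "\<dots> < \<infinity>" by (simp add: W.emeasure_space_1[simplified])
    finally show ?thesis .
  qed
  have 1: "ennreal (m x powr P) \<le> M x" for x
    unfolding M_def
    by (rule powr_jensen_nn[OF prob_space_unif_box]) (use fin[of x] G0 P in \<open>auto simp: m_def\<close>)
  have 2: "M x \<le> ennreal (c powr - real DIM('a))" for x
  proof -
    have "M x \<le> (\<integral>\<^sup>+w. ennreal (G (x + c *\<^sub>R w) powr P) \<partial>lborel)"
      unfolding M_def by (subst nn_integral_unif_box) (auto intro!: nn_integral_mono simp: indicator_def)
    also have "\<dots> \<le> ennreal (c powr - real DIM('a))"
      by (rule nn_integral_scale_le[where F="\<lambda>x. ennreal (G x powr P)"]) (use I c in auto)
    finally show ?thesis .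
  qed
  have 3: "ennreal (m x powr t) \<le> ennreal (c powr (- real DIM('a) * (t / P - 1))) * M x" for x
  proof -
    have m0: "0 \<le> m x" by (simp add: m_def)
    have "m x powr P \<le> c powr - real DIM('a)"
      using order_trans[OF 1 2] by (subst (asm) ennreal_le_iff) auto
    then have "(m x powr P) powr (t / P - 1) \<le> (c powr - real DIM('a)) powr (t / P - 1)"
      using P by (intro powr_mono2) auto
    then have le: "m x powr (P * (t / P - 1)) \<le> c powr (- real DIM('a) * (t / P - 1))" by (simp add: powr_powr)
    have "m x powr t = m x powr (P * (t / P - 1)) * m x powr P"
      using P by (simp add: powr_add[symmetric] field_simps)
    also have "\<dots> \<le> c powr (- real DIM('a) * (t / P - 1)) * m x powr P"
      by (rule mult_right_mono[OF le]) simp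
    finally have "ennreal (m x powr t) \<le> ennreal (c powr (- real DIM('a) * (t / P - 1))) * ennreal (m x powr P)"
      by (simp add: ennreal_mult'[symmetric] ennreal_leI)
    also have "\<dots> \<le> ennreal (c powr (- real DIM('a) * (t / P - 1))) * M x" by (rule mult_left_mono[OF 1]) simp
    finally show ?thesis .
  qed
  have 4: "(\<integral>\<^sup>+x. M x \<partial>lborel) \<le> 1"
  proof -
    have "(\<integral>\<^sup>+x. M x \<partial>lborel) = (\<integral>\<^sup>+w. \<integral>\<^sup>+x. ennreal (G (x + c *\<^sub>R w) powr P) \<partial>lborel \<partial>unif_box)"
      unfolding M_def by (rule PW.Fubini'[symmetric]) measurable
    also have "\<dots> = (\<integral>\<^sup>+w. (\<integral>\<^sup>+x. ennreal (G x powr P) \<partial>lborel) \<partial>(unif_box :: 'a measure))"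
      by (intro nn_integral_cong nn_integral_translate[where F="\<lambda>x. ennreal (G x powr P)"]) measurable
    also have "\<dots> \<le> 1" using I by (simp add: W.emeasure_space_1[simplified])
    finally show ?thesis .
  qed
  have "(\<integral>\<^sup>+x. ennreal (m x powr t) \<partial>lborel)
      \<le> (\<integral>\<^sup>+x. ennreal (c powr (- real DIM('a) * (t / P - 1))) * M x \<partial>lborel)"
    by (intro nn_integral_mono 3)
  also have "\<dots> = ennreal (c powr (- real DIM('a) * (t / P - 1))) * (\<integral>\<^sup>+x. M x \<partial>lborel)"
    by (rule nn_integral_cmult) measurable
  also have "\<dots> \<le> ennreal (c powr (- real DIM('a) * (t / P - 1))) * 1"
    by (rule mult_left_mono[OF 4]) simp
  finally show ?thesis by (simp add: m_def)
qed

lemma riesz_eq_average: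
  assumes [measurable]: "G \<in> borel_measurable borel" and GB: "\<And>x. 0 \<le> G x" "\<And>x. G x \<le> B"
  shows "riesz \<kappa> L G x = (\<integral>\<^sup>+\<rho>. ennreal (\<rho> powr \<kappa> * enn2real (\<integral>\<^sup>+w. ennreal (G (x + (\<rho> * L) *\<^sub>R w)) \<partial>unif_box)) \<partial>unif01)"
proof -
  interpret W: prob_space "unif_box :: 'a measure" by (rule prob_space_unif_box)
  have "(\<integral>\<^sup>+w. ennreal (G (x + c *\<^sub>R w)) \<partial>unif_box) < \<infinity>" for c
  proof -
    have "(\<integral>\<^sup>+w. ennreal (G (x + c *\<^sub>R w)) \<partial>unif_box) \<le> (\<integral>\<^sup>+w. ennreal B \<partial>(unif_box :: 'a measure))"
      by (intro nn_integral_mono ennreal_leI GB)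
    also have "\<dots> < \<infinity>" by (simp add: W.emeasure_space_1[simplified])
    finally show ?thesis .
  qed
  then show ?thesis
    unfolding riesz_def by (intro nn_integral_cong) (simp add: ennreal_mult' nn_integral_cmult GB)
qed

lemma riesz_finite:
  assumes [measurable]: "G \<in> borel_measurable borel" and GB: "\<And>x. 0 \<le> G x" "\<And>x. G x \<le> B" and \<kappa>: "0 \<le> \<kappa>"
  shows "riesz \<kappa> L G x < \<infinity>"
proof -
  interpret U: prob_space unif01 by (rule prob_space_unif01)
  interpret W: prob_space "unif_box :: 'a measure" by (rule prob_space_unif_box)
  have "riesz \<kappa> L G x \<le> (\<integral>\<^sup>+\<rho>. \<integral>\<^sup>+w. ennreal B \<partial>(unif_box :: 'a measure) \<partial>unif01)"
    unfolding riesz_def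
  proof (rule nn_integral_mono_AE, rule AE_mp[OF AE_unif01 AE_I2], rule impI, rule nn_integral_mono, rule ennreal_leI)
    fix \<rho> :: real and w :: 'a assume \<rho>: "0 < \<rho> \<and> \<rho> < 1"
    have "\<rho> powr \<kappa> * G (x + (\<rho> * L) *\<^sub>R w) \<le> 1 * B"
      using \<rho> \<kappa> GB by (intro mult_mono) (auto intro: powr_le1)
    then show "\<rho> powr \<kappa> * G (x + (\<rho> * L) *\<^sub>R w) \<le> B" by simp
  qed
  also have "\<dots> < \<infinity>" by (simp add: W.emeasure_space_1[simplified] U.emeasure_space_1[simplified])
  finally show ?thesis .
qed

lemma riesz_measurable [measurable]:
  assumes [measurable]: "G \<in> borel_measurable borel"
  shows "riesz \<kappa> L G \<in> borel_measurable borel"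
proof -
  interpret U: prob_space unif01 by (rule prob_space_unif01)
  interpret W: prob_space "unif_box :: 'a measure" by (rule prob_space_unif_box)
  show ?thesis unfolding riesz_def[abs_def] by measurable
qed

text \<open>Jensen's inequality in \<rho>, after inserting a probability density that may be
  singular at 0, followed by Tonelli and the estimate for one fixed \<rho>. The density is tuned so
  that the remaining integral of a power of \<rho> converges; subcriticality leaves room for this
  choice.\<close>

lemma riesz_bound:
  assumes P: "1 \<le> P" "P \<le> t" and t: "1 < t" and \<kappa>: "0 \<le> \<kappa>" and L: "0 < L"
    and sub: "real DIM('a) * (1 / P - 1 / t) < 1 + \<kappa>"
  obtains C where "\<And>(G :: 'a::euclidean_space \<Rightarrow> real) B. \<lbrakk>G \<in> borel_measurable borel; \<And>x. 0 \<le> G x; \<And>x. G x \<le> B;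
      (\<integral>\<^sup>+x. ennreal (G x powr P) \<partial>lborel) \<le> 1\<rbrakk> \<Longrightarrow>
      (\<integral>\<^sup>+x. ennreal (enn2real (riesz \<kappa> L G x) powr t) \<partial>lborel) \<le> ennreal C"
proof -
  let ?N = "real DIM('a)"
  \<comment> \<open>Solving \<open>\<beta> > -1\<close> for \<open>\<eta>\<close> gives
    \<open>\<eta> > z\<close>, and the subcritical inequality is equivalent to z < 1. Hence some
    \<open>\<eta>\<close> in [0, 1) lies above z: the density \<open>wt\<close> stays integrable at
    0 and is singular enough.\<close>
  define z where "z = (?N * (t / P - 1) - 1 - \<kappa> * t) / (t - 1)"
  have "?N * (t / P - 1) = t * (?N * (1 / P - 1 / t))" using t by (simp add: field_simps)
  also have "\<dots> < t * (1 + \<kappa>)" using sub t by (intro mult_strict_left_mono) auto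
  finally have "z < 1" using t by (simp add: z_def field_simps)
  define \<eta> where "\<eta> = max 0 ((z + 1) / 2)"
  have \<eta>: "0 \<le> \<eta>" "\<eta> < 1" "z < \<eta>" using \<open>z < 1\<close> by (auto simp: \<eta>_def less_max_iff_disj)
  define \<beta> where "\<beta> = \<kappa> * t + \<eta> * (t - 1) - ?N * (t / P - 1)"
  have \<beta>: "\<beta> > -1" using \<eta>(3) t by (simp add: z_def \<beta>_def field_simps)
  define wt where "wt \<rho> = (1 - \<eta>) * \<rho> powr (- \<eta>)" for \<rho> :: real
  define V where "V = density lborel (\<lambda>\<rho>. ennreal (wt \<rho>) * indicator {0<..<1} \<rho>)"
  have wt0: "wt \<rho> > 0" if "\<rho> > 0" for \<rho> using that \<eta> by (simp add: wt_def)
  have [measurable]: "wt \<in> borel_measurable borel" unfolding wt_def by measurable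
  have sV [measurable_cong]: "sets V = sets borel" by (simp add: V_def)
  have prV: "prob_space V"
  proof (rule prob_spaceI)
    have "emeasure V (space V) = (\<integral>\<^sup>+\<rho>. ennreal (1 - \<eta>) * (ennreal (\<rho> powr (- \<eta>)) * indicator {0<..<1} \<rho>) \<partial>lborel)"
      using \<eta> by (simp add: V_def emeasure_density wt_def ennreal_mult' mult.assoc)
    also have "\<dots> = ennreal (1 - \<eta>) * ennreal (1 / (- \<eta> + 1))"
      using nn_integral_powr_unit[of "- \<eta>"] \<eta> by (simp add: nn_integral_cmult)
    also have "\<dots> = 1" using \<eta> by (simp add: ennreal_mult'[symmetric])
    finally show "emeasure V (space V) = 1" .
  qed
  have Vint: "(\<integral>\<^sup>+\<rho>. F \<rho> \<partial>V) = (\<integral>\<^sup>+\<rho>. ennreal (wt \<rho>) * F \<rho> * indicator {0<..<1} \<rho> \<partial>lborel)"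
    if "F \<in> borel_measurable borel" for F
    using that unfolding V_def by (subst nn_integral_density) (auto simp: mult_ac)
  define C where "C = (1 - \<eta>) powr (1 - t) * L powr (- ?N * (t / P - 1)) * (1 / (\<beta> + 1))"
  show thesis
  proof (rule that[of C])
    fix G :: "'a \<Rightarrow> real" and B
    assume G [measurable]: "G \<in> borel_measurable borel" and GB: "\<And>x. 0 \<le> G x" "\<And>x. G x \<le> B"
      and I: "(\<integral>\<^sup>+x. ennreal (G x powr P) \<partial>lborel) \<le> 1"
    interpret W: prob_space "unif_box :: 'a measure" by (rule prob_space_unif_box)
    define m where "m x \<rho> = enn2real (\<integral>\<^sup>+w. ennreal (G (x + (\<rho> * L) *\<^sub>R w)) \<partial>unif_box)" for x \<rho>
    have m0: "0 \<le> m x \<rho>" for x \<rho> by (simp add: m_def)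
    have mm [measurable]: "(\<lambda>(x, \<rho>). m x \<rho>) \<in> borel_measurable (borel \<Otimes>\<^sub>M borel)"
      unfolding m_def by measurable
    have [measurable]: "m x \<in> borel_measurable borel" for x
      unfolding m_def by measurable
    define T where "T x = enn2real (riesz \<kappa> L G x)" for x
    have T1: "ennreal (T x powr t) \<le> (\<integral>\<^sup>+\<rho>. ennreal ((1 - \<eta>) powr (1 - t) * \<rho> powr (\<kappa> * t + \<eta> * (t - 1)) * m x \<rho> powr t)
        * indicator {0<..<1} \<rho> \<partial>lborel)" for x
    proof -
      \<comment> \<open>Dividing by the density turns the integral over (0, 1) into an expectation
        under \<open>V\<close>; after Jensen the density survives with the power 1 - t.\<close>
      let ?X = "\<lambda>\<rho>. if 0 < \<rho> then \<rho> powr \<kappa> * m x \<rho> / wt \<rho> else 0"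
      have "ennreal (T x) = riesz \<kappa> L G x"
        using riesz_finite[OF G GB \<kappa>, of L x] by (simp add: T_def)
      also have "\<dots> = (\<integral>\<^sup>+\<rho>. ennreal (\<rho> powr \<kappa> * m x \<rho>) * indicator {0<..<1} \<rho> \<partial>lborel)"
        by (subst riesz_eq_average[OF G GB], subst nn_integral_unif01) (auto simp: m_def[symmetric])
      also have "\<dots> = (\<integral>\<^sup>+\<rho>. ennreal (?X \<rho>) \<partial>V)"
        by (subst Vint, measurable, intro nn_integral_cong)
           (use wt0 in \<open>auto simp: indicator_def ennreal_mult''[symmetric] m0 less_imp_neq[OF wt0, THEN not_sym] less_imp_le[OF wt0]\<close>)
      finally have "ennreal (T x powr t) \<le> (\<integral>\<^sup>+\<rho>. ennreal (?X \<rho> powr t) \<partial>V)"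
        by (intro powr_jensen_nn[OF prV]) (use t wt0 m0 in \<open>auto simp: T_def less_imp_le[OF wt0]\<close>)
      also have "\<dots> = (\<integral>\<^sup>+\<rho>. ennreal ((1 - \<eta>) powr (1 - t) * \<rho> powr (\<kappa> * t + \<eta> * (t - 1)) * m x \<rho> powr t)
        * indicator {0<..<1} \<rho> \<partial>lborel)"
      proof (subst Vint, measurable, intro nn_integral_cong)
        fix \<rho> :: real
        show "ennreal (wt \<rho>) * ennreal (?X \<rho> powr t) * indicator {0<..<1} \<rho> =
           ennreal ((1 - \<eta>) powr (1 - t) * \<rho> powr (\<kappa> * t + \<eta> * (t - 1)) * m x \<rho> powr t) * indicator {0<..<1} \<rho>"
        proof (cases "0 < \<rho> \<and> \<rho> < 1")
          case True
          then have w: "wt \<rho> > 0" using wt0 by auto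
          have "wt \<rho> powr (1 - t) = (1 - \<eta>) powr (1 - t) * \<rho> powr (\<eta> * (t - 1))"
          proof -
            have "- \<eta> * (1 - t) = \<eta> * (t - 1)" by (simp add: algebra_simps)
            then show ?thesis unfolding wt_def using True \<eta> by (simp add: powr_mult powr_powr)
          qed
          moreover have "wt \<rho> * (\<rho> powr \<kappa> * m x \<rho> / wt \<rho>) powr t = wt \<rho> powr (1 - t) * (\<rho> powr (\<kappa> * t) * m x \<rho> powr t)"
            using True w m0[of x \<rho>] by (simp add: powr_divide powr_mult powr_powr powr_diff)
          ultimately have "wt \<rho> * (\<rho> powr \<kappa> * m x \<rho> / wt \<rho>) powr t
              = (1 - \<eta>) powr (1 - t) * \<rho> powr (\<kappa> * t + \<eta> * (t - 1)) * m x \<rho> powr t"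
            by (simp add: powr_add mult_ac)
          then show ?thesis using True w by (simp add: ennreal_mult'[symmetric])
        qed (auto simp: indicator_def)
      qed
      finally show ?thesis .
    qed
    let ?H = "\<lambda>\<rho>. (1 - \<eta>) powr (1 - t) * \<rho> powr (\<kappa> * t + \<eta> * (t - 1))"
    have "(\<integral>\<^sup>+x. ennreal (T x powr t) \<partial>lborel) \<le>
        (\<integral>\<^sup>+x. \<integral>\<^sup>+\<rho>. ennreal (?H \<rho> * m x \<rho> powr t) * indicator {0<..<1} \<rho> \<partial>lborel \<partial>lborel)"
      by (intro nn_integral_mono T1)
    also have "\<dots> = (\<integral>\<^sup>+\<rho>. \<integral>\<^sup>+x. ennreal (?H \<rho> * m x \<rho> powr t) * indicator {0<..<1} \<rho> \<partial>lborel \<partial>lborel)"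
      by (rule lborel_pair.Fubini'[symmetric]) measurable
    also have "\<dots> = (\<integral>\<^sup>+\<rho>. ennreal (?H \<rho>) * indicator {0<..<1} \<rho> * (\<integral>\<^sup>+x. ennreal (m x \<rho> powr t) \<partial>lborel) \<partial>lborel)"
      by (intro nn_integral_cong, subst nn_integral_cmult[symmetric])
         (auto simp: ennreal_mult' mult_ac intro!: nn_integral_cong)
    also have "\<dots> \<le> (\<integral>\<^sup>+\<rho>. ennreal ((1 - \<eta>) powr (1 - t) * L powr (- ?N * (t / P - 1))) * (ennreal (\<rho> powr \<beta>) * indicator {0<..<1} \<rho>) \<partial>lborel)"
    proof (intro nn_integral_mono)
      fix \<rho> :: real
      show "ennreal (?H \<rho>) * indicator {0<..<1} \<rho> * (\<integral>\<^sup>+x. ennreal (m x \<rho> powr t) \<partial>lborel)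
         \<le> ennreal ((1 - \<eta>) powr (1 - t) * L powr (- ?N * (t / P - 1))) * (ennreal (\<rho> powr \<beta>) * indicator {0<..<1} \<rho>)"
      proof (cases "0 < \<rho> \<and> \<rho> < 1")
        case True
        have "(\<integral>\<^sup>+x. ennreal (m x \<rho> powr t) \<partial>lborel) \<le> ennreal ((\<rho> * L) powr (- ?N * (t / P - 1)))"
          unfolding m_def by (rule box_average_powr[OF P G GB I]) (use True L in auto)
        then have "ennreal (?H \<rho>) * (\<integral>\<^sup>+x. ennreal (m x \<rho> powr t) \<partial>lborel)
            \<le> ennreal (?H \<rho>) * ennreal ((\<rho> * L) powr (- ?N * (t / P - 1)))"
          by (rule mult_left_mono) simp
        also have "\<dots> = ennreal ((1 - \<eta>) powr (1 - t) * L powr (- ?N * (t / P - 1)) * \<rho> powr \<beta>)"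
        proof -
          have "\<rho> powr \<beta> = \<rho> powr (\<kappa> * t + \<eta> * (t - 1)) * \<rho> powr (- ?N * (t / P - 1))"
            unfolding powr_add[symmetric] \<beta>_def by (simp add: algebra_simps)
          then show ?thesis using True L by (simp add: ennreal_mult'[symmetric] powr_mult mult_ac)
        qed
        finally show ?thesis using True by (simp add: ennreal_mult')
      qed (auto simp: indicator_def)
    qed
    also have "\<dots> = ennreal C"
      using \<beta> \<eta> by (subst nn_integral_cmult, measurable) (simp add: nn_integral_powr_unit C_def ennreal_mult'[symmetric])
    finally show "(\<integral>\<^sup>+x. ennreal (enn2real (riesz \<kappa> L G x) powr t) \<partial>lborel) \<le> ennreal C"
      by (simp add: T_def)
  qed
qed

section \<open>Sobolev bounds for test functions\<close>

text \<open>By homogeneity one may divide by x + y; then u <= u^e on [0, 1], and the two fractions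
  add up to 1.\<close>

lemma powr_add_le_concave:
  fixes x y e :: real
  assumes "0 \<le> x" "0 \<le> y" "0 \<le> e" "e \<le> 1"
  shows "(x + y) powr e \<le> x powr e + y powr e"
proof (cases "x + y = 0")
  case False
  then have s: "x + y > 0" using assms by auto
  have "u \<le> u powr e" if "0 \<le> u" "u \<le> 1" for u :: real
    using powr_mono'[of e 1 u] that assms by simp
  note u = this
  have le: "x / (x + y) \<le> (x / (x + y)) powr e" "y / (x + y) \<le> (y / (x + y)) powr e"
    by (rule u; use s assms in simp)+
  have "x / (x + y) + y / (x + y) = 1" using s by (simp add: add_divide_distrib[symmetric])
  with le have "1 \<le> (x / (x + y)) powr e + (y / (x + y)) powr e" by linarith
  also have "\<dots> = (x powr e + y powr e) / (x + y) powr e"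
    using s assms by (simp add: powr_divide add_divide_distrib)
  finally show ?thesis using s by (simp add: le_divide_eq)
qed (use assms in auto)

lemma powr_add_le:
  fixes x y t :: real
  assumes "0 \<le> x" "0 \<le> y" "0 \<le> t"
  shows "(x + y) powr t \<le> 2 powr t * (x powr t + y powr t)"
proof -
  have "(x + y) powr t \<le> (2 * max x y) powr t" using assms by (intro powr_mono2) auto
  also have "\<dots> = 2 powr t * max x y powr t" using assms by (simp add: powr_mult)
  also have "\<dots> \<le> 2 powr t * (x powr t + y powr t)"
    by (intro mult_left_mono) (auto simp: max_def)
  finally show ?thesis .
qed

text \<open>Keeps the end point of the segment at distance at least L from x, whatever direction is
  drawn.\<close>

lemma norm_unif_box_ge_1:
  assumes "w \<in> cbox One (2 *\<^sub>R One :: 'a::euclidean_space)"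
  shows "1 \<le> norm w"
proof -
  obtain i :: 'a where i: "i \<in> Basis" using nonempty_Basis by blast
  have "1 \<le> w \<bullet> i" using assms i by (auto simp: mem_box)
  also have "\<dots> \<le> norm w" using Basis_le_norm[OF i, of w] by simp
  finally show ?thesis .
qed

text \<open>\<open>A\<close> stands for the weight at x, \<open>b\<close> for the gradient times the
  weight at the moving point, and \<open>le\<close> is the price of moving the weight from x to y.
  On the segment |x - y| <= \<rho> D L, so the factor |x - y|^\<kappa> produces the \<rho>^\<kappa>
  inside \<open>riesz\<close>. The left side does not depend on w and can be averaged over the
  cube.\<close>

lemma weighted_le_riesz:
  fixes \<Omega> :: "'a::euclidean_space set"
  assumes R: "\<And>x. x \<in> \<Omega> \<Longrightarrow> norm x \<le> R" "0 \<le> R" and L: "L = 2 * R + 1"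
    and D: "\<And>w. w \<in> cbox One (2 *\<^sub>R One :: 'a) \<Longrightarrow> norm w \<le> D"
    and f: "C1_supp \<Omega> f" and x: "x \<in> \<Omega>" and A: "0 \<le> A"
    and b[measurable]: "b \<in> borel_measurable borel" and b0: "\<And>y. 0 \<le> b y" and \<kappa>: "0 \<le> \<kappa>" and K: "0 \<le> K"
    and le: "\<And>y. A * norm (grad f y) \<le> b y + K * dist x y powr \<kappa> * norm (grad f y)"
  shows "ennreal (A * \<bar>f x\<bar>) \<le> ennreal (D * L) *
    (riesz 0 L b x + ennreal (K * (D * L) powr \<kappa>) * riesz \<kappa> L (\<lambda>y. norm (grad f y)) x)"
proof -
  interpret W: prob_space "unif_box :: 'a measure" by (rule prob_space_unif_box)
  interpret U: prob_space unif01 by (rule prob_space_unif01)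
  interpret P: pair_sigma_finite unif01 "unif_box :: 'a measure" ..
  note F = C1_suppD[OF f] and [measurable] = C1_supp_measurable[OF f]
  let ?g = "\<lambda>y. norm (grad f y)"
  have L0: "L > 0" using L R by simp
  have D0: "D \<ge> 1"
  proof -
    have "(One :: 'a) \<in> cbox One (2 *\<^sub>R One)" by (auto simp: mem_box)
    then show ?thesis using D norm_unif_box_ge_1 order_trans by blast
  qed
  let ?B = "\<lambda>\<rho> w. ennreal (D * L) * (ennreal (b (x + (\<rho> * L) *\<^sub>R w)) + ennreal (K * (D * L) powr \<kappa>) * ennreal (\<rho> powr \<kappa> * ?g (x + (\<rho> * L) *\<^sub>R w)))"
  have 1: "ennreal (A * \<bar>f x\<bar>) \<le> (\<integral>\<^sup>+\<rho>. ?B \<rho> w \<partial>unif01)" if w: "w \<in> cbox One (2 *\<^sub>R One)" for w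
  proof -
    have nw: "1 \<le> norm w" "norm w \<le> D" using norm_unif_box_ge_1[OF w] D[OF w] by auto
    \<comment> \<open>Two points of the domain are at most 2 R apart, while the step has length at
      least L = 2 R + 1.\<close>
    have "x + L *\<^sub>R w \<notin> \<Omega>"
    proof
      assume "x + L *\<^sub>R w \<in> \<Omega>"
      then have "norm (L *\<^sub>R w) \<le> R + R"
        using R(1)[OF x] R(1)[of "x + L *\<^sub>R w"] norm_triangle_ineq4[of "x + L *\<^sub>R w" x] by simp
      moreover have "L \<le> norm (L *\<^sub>R w)" using nw L0 by simp
      ultimately show False using L by simp
    qed
    then have "ennreal \<bar>f x\<bar> \<le> (\<integral>\<^sup>+\<rho>. ennreal (norm (L *\<^sub>R w) * ?g (x + \<rho> *\<^sub>R L *\<^sub>R w)) \<partial>unif01)"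
      using C1_supp_diff_le[OF f, of x "L *\<^sub>R w"] F(4) by simp
    then have "ennreal A * ennreal \<bar>f x\<bar> \<le> ennreal A * (\<integral>\<^sup>+\<rho>. ennreal (norm (L *\<^sub>R w) * ?g (x + \<rho> *\<^sub>R L *\<^sub>R w)) \<partial>unif01)"
      by (rule mult_left_mono) simp
    also have "\<dots> = (\<integral>\<^sup>+\<rho>. ennreal (A * (norm (L *\<^sub>R w) * ?g (x + \<rho> *\<^sub>R L *\<^sub>R w))) \<partial>unif01)"
      using A by (subst nn_integral_cmult[symmetric]) (auto simp: ennreal_mult')
    also have "\<dots> \<le> (\<integral>\<^sup>+\<rho>. ?B \<rho> w \<partial>unif01)"
    proof (rule nn_integral_mono_AE, rule AE_mp[OF AE_unif01 AE_I2], rule impI)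
      fix \<rho> :: real assume \<rho>: "0 < \<rho> \<and> \<rho> < 1"
      let ?y = "x + (\<rho> * L) *\<^sub>R w"
      have "dist x ?y = \<rho> * (L * norm w)" using \<rho> L0 by (simp add: dist_norm)
      also have "\<dots> \<le> \<rho> * (D * L)" using nw \<rho> L0 by (simp add: mult.commute)
      finally have dpow: "dist x ?y powr \<kappa> \<le> (\<rho> * (D * L)) powr \<kappa>" using \<kappa> by (intro powr_mono2) auto
      have "A * ?g ?y \<le> b ?y + K * dist x ?y powr \<kappa> * ?g ?y" by (rule le)
      also have "\<dots> \<le> b ?y + K * (\<rho> * (D * L)) powr \<kappa> * ?g ?y"
        using dpow K by (intro add_left_mono mult_right_mono mult_left_mono) auto
      also have "\<dots> = b ?y + K * (D * L) powr \<kappa> * (\<rho> powr \<kappa> * ?g ?y)"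
        using \<rho> D0 L0 by (simp add: powr_mult)
      finally have "A * ?g ?y \<le> b ?y + K * (D * L) powr \<kappa> * (\<rho> powr \<kappa> * ?g ?y)" .
      then have "norm (L *\<^sub>R w) * (A * ?g ?y) \<le> (D * L) * (b ?y + K * (D * L) powr \<kappa> * (\<rho> powr \<kappa> * ?g ?y))"
        using nw L0 D0 A by (intro mult_mono) auto
      then have "ennreal (A * (norm (L *\<^sub>R w) * ?g (x + \<rho> *\<^sub>R L *\<^sub>R w))) \<le> ennreal ((D * L) * (b ?y + K * (D * L) powr \<kappa> * (\<rho> powr \<kappa> * ?g ?y)))"
        by (intro ennreal_leI) (simp add: mult_ac)
      also have "\<dots> = ?B \<rho> w"
        using D0 L0 K b0 by (simp add: ennreal_mult' ennreal_plus)
      finally show "ennreal (A * (norm (L *\<^sub>R w) * ?g (x + \<rho> *\<^sub>R L *\<^sub>R w))) \<le> ?B \<rho> w" .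
    qed
    finally show ?thesis using A by (simp add: ennreal_mult')
  qed
  have "ennreal (A * \<bar>f x\<bar>) = (\<integral>\<^sup>+w. ennreal (A * \<bar>f x\<bar>) \<partial>(unif_box :: 'a measure))"
    by (simp add: W.emeasure_space_1[simplified])
  also have "\<dots> \<le> (\<integral>\<^sup>+w. \<integral>\<^sup>+\<rho>. ?B \<rho> w \<partial>unif01 \<partial>unif_box)"
    by (rule nn_integral_mono_AE, rule AE_mp[OF AE_unif_box AE_I2]) (use 1 in blast)
  also have "\<dots> = (\<integral>\<^sup>+\<rho>. \<integral>\<^sup>+w. ?B \<rho> w \<partial>unif_box \<partial>unif01)"
    by (rule P.Fubini') measurable
  also have "\<dots> = ennreal (D * L) * (riesz 0 L b x + ennreal (K * (D * L) powr \<kappa>) * riesz \<kappa> L ?g x)"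
  proof -
    have "riesz 0 L b x = (\<integral>\<^sup>+\<rho>. \<integral>\<^sup>+w. ennreal (b (x + (\<rho> * L) *\<^sub>R w)) \<partial>unif_box \<partial>unif01)"
      unfolding riesz_def by (intro nn_integral_cong_AE AE_mp[OF AE_unif01 AE_I2]) auto
    then show ?thesis unfolding riesz_def by (simp add: nn_integral_cmult nn_integral_add)
  qed
  finally show ?thesis .
qed

lemma C1_supp_cmult:
  assumes f: "C1_supp \<Omega> f"
  shows "C1_supp \<Omega> (\<lambda>x. c * f x)" "grad (\<lambda>x. c * f x) = (\<lambda>x. c *\<^sub>R grad f x)"
proof -
  note F = C1_suppD[OF f]
  show g: "grad (\<lambda>x. c * f x) = (\<lambda>x. c *\<^sub>R grad f x)"
  proof
    fix x
    have "partial_deriv i (\<lambda>x. c * f x) x = c * partial_deriv i f x" for i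
      by (rule partial_deriv_eq) (auto intro!: derivative_eq_intros has_derivative_partial F(1))
    then show "grad (\<lambda>x. c * f x) x = c *\<^sub>R grad f x" by (simp add: grad_def scaleR_sum_right)
  qed
  show "C1_supp \<Omega> (\<lambda>x. c * f x)"
    using f unfolding C1_supp_def g by (force intro!: continuous_intros)
qed

text \<open>The two summands that Hoelder continuity yields are treated separately. One keeps the
  gradient with its own weight and is estimated from L^q with \<kappa> = 0; the other loses the
  weight, gains \<rho>^(\<alpha>/q), and is estimated from L^p. The two inequalities in
  \<open>sub\<close> are the subcriticality conditions of these estimates.\<close>

lemma weighted_sobolev_bound:
  fixes \<Omega> :: "'a::euclidean_space set"
  assumes \<Omega>: "bounded \<Omega>" and p: "1 < p" "p \<le> q" "q \<le> t" "0 \<le> \<alpha>"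
    and sub: "real DIM('a) * (1 / q - 1 / t) < 1" "real DIM('a) * (1 / p - 1 / t) < 1 + \<alpha> / q"
    and a[measurable]: "a \<in> borel_measurable borel" and a0: "\<And>x. 0 \<le> a x" and aA: "\<And>x. a x \<le> A"
    and K: "0 \<le> K" "\<And>x y. x \<in> \<Omega> \<Longrightarrow> y \<in> \<Omega> \<Longrightarrow> \<bar>a x - a y\<bar> \<le> K * dist x y powr \<alpha>"
  obtains C where "\<And>f. \<lbrakk>C1_supp \<Omega> f; (\<integral>\<^sup>+x. ennreal (norm (grad f x) powr p) \<partial>lborel) \<le> 1;
      (\<integral>\<^sup>+x. ennreal (a x * norm (grad f x) powr q) \<partial>lborel) \<le> 1\<rbrakk> \<Longrightarrow>
      (\<integral>\<^sup>+x. ennreal ((a x powr (1 / q) * \<bar>f x\<bar>) powr t) \<partial>lborel) \<le> ennreal C"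
proof -
  obtain R where R: "0 < R" "\<And>x. x \<in> \<Omega> \<Longrightarrow> norm x \<le> R" using \<Omega> bounded_pos by blast
  have R': "\<And>x. x \<in> \<Omega> \<Longrightarrow> norm x \<le> R" "0 \<le> R" using R by auto
  obtain D where D: "D > 0" "\<And>w. w \<in> cbox One (2 *\<^sub>R One :: 'a) \<Longrightarrow> norm w \<le> D"
    using bounded_cbox[of One "2 *\<^sub>R One :: 'a"] bounded_pos by metis
  define L where "L = 2 * R + 1"
  have L0: "0 < L" using R by (simp add: L_def)
  have q: "1 < q" "1 < t" "1 \<le> q" "1 \<le> p" "p \<le> t" using p by auto
  have \<kappa>: "0 \<le> \<alpha> / q" using p by auto
  obtain C1 where C1: "\<And>(G :: 'a \<Rightarrow> real) B. \<lbrakk>G \<in> borel_measurable borel; \<And>x. 0 \<le> G x; \<And>x. G x \<le> B;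
      (\<integral>\<^sup>+x. ennreal (G x powr q) \<partial>lborel) \<le> 1\<rbrakk> \<Longrightarrow>
      (\<integral>\<^sup>+x. ennreal (enn2real (riesz 0 L G x) powr t) \<partial>lborel) \<le> ennreal C1"
    using riesz_bound[where 'a='a and P=q and t=t and \<kappa>=0 and L=L] q p sub L0 by auto
  obtain C2 where C2: "\<And>(G :: 'a \<Rightarrow> real) B. \<lbrakk>G \<in> borel_measurable borel; \<And>x. 0 \<le> G x; \<And>x. G x \<le> B;
      (\<integral>\<^sup>+x. ennreal (G x powr p) \<partial>lborel) \<le> 1\<rbrakk> \<Longrightarrow>
      (\<integral>\<^sup>+x. ennreal (enn2real (riesz (\<alpha> / q) L G x) powr t) \<partial>lborel) \<le> ennreal C2"
    using riesz_bound[where 'a='a and P=p and t=t and \<kappa>="\<alpha> / q" and L=L] q p sub L0 \<kappa> by auto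
  define K1 where "K1 = K powr (1 / q)"
  define K2 where "K2 = K1 * (D * L) powr (\<alpha> / q)"
  have K2: "0 \<le> K2" by (simp add: K2_def K1_def)
  define C where "C = (D * L) powr t * 2 powr t * (\<bar>C1\<bar> + K2 powr t * \<bar>C2\<bar>)"
  show thesis
  proof (rule that[of C])
    fix f assume f: "C1_supp \<Omega> f" and I: "(\<integral>\<^sup>+x. ennreal (norm (grad f x) powr p) \<partial>lborel) \<le> 1"
      "(\<integral>\<^sup>+x. ennreal (a x * norm (grad f x) powr q) \<partial>lborel) \<le> 1"
    note F = C1_suppD[OF f] and [measurable] = C1_supp_measurable[OF f]
    obtain B where B: "B > 0" "\<And>x. norm (grad f x) \<le> B" using C1_supp_bounded_grad[OF f] by blast
    define g where "g x = norm (grad f x)" for x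
    define b where "b x = a x powr (1 / q) * g x" for x
    have [measurable]: "g \<in> borel_measurable borel" unfolding g_def by measurable
    have [measurable]: "b \<in> borel_measurable borel" unfolding b_def by measurable
    have g0: "0 \<le> g x" "g x \<le> B" for x using B by (auto simp: g_def)
    have b0: "0 \<le> b x" for x by (simp add: b_def g0)
    have bB: "b x \<le> A powr (1 / q) * B" for x
      unfolding b_def using a0 aA g0 q by (intro mult_mono powr_mono2) auto
    have bq: "b x powr q = a x * g x powr q" for x
      using q a0[of x] g0(1)[of x] by (simp add: b_def powr_mult powr_powr)
    define T1 where "T1 x = enn2real (riesz 0 L b x)" for x
    define T2 where "T2 x = enn2real (riesz (\<alpha> / q) L g x)" for x
    have i1: "(\<integral>\<^sup>+x. ennreal (T1 x powr t) \<partial>lborel) \<le> ennreal C1"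
      unfolding T1_def by (rule C1[OF _ b0 bB]) (use I bq in \<open>auto simp: g_def\<close>)
    have i2: "(\<integral>\<^sup>+x. ennreal (T2 x powr t) \<partial>lborel) \<le> ennreal C2"
      unfolding T2_def by (rule C2[OF _ g0]) (use I in \<open>auto simp: g_def\<close>)
    have T0: "0 \<le> T1 x" "0 \<le> T2 x" for x by (simp_all add: T1_def T2_def)
    have [measurable]: "T1 \<in> borel_measurable borel" "T2 \<in> borel_measurable borel"
      unfolding T1_def T2_def by measurable
    have pw: "(a x powr (1 / q) * \<bar>f x\<bar>) powr t \<le> (D * L) powr t * 2 powr t * (T1 x powr t + K2 powr t * T2 x powr t)" for x
    proof (cases "x \<in> \<Omega>")
      case True
      have "ennreal (a x powr (1 / q) * \<bar>f x\<bar>) \<le> ennreal (D * L) *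
         (riesz 0 L b x + ennreal (K1 * (D * L) powr (\<alpha> / q)) * riesz (\<alpha> / q) L (\<lambda>y. norm (grad f y)) x)"
      proof (rule weighted_le_riesz[OF R' L_def D(2) f True])
        fix y
        show "a x powr (1 / q) * norm (grad f y) \<le> b y + K1 * dist x y powr (\<alpha> / q) * norm (grad f y)"
        proof (cases "y \<in> \<Omega>")
          case y: True
          have "a x \<le> a y + K * dist x y powr \<alpha>" using K(2)[OF True y] by auto
          then have "a x powr (1 / q) \<le> (a y + K * dist x y powr \<alpha>) powr (1 / q)"
            using a0 q by (intro powr_mono2) auto
          also have "\<dots> \<le> a y powr (1 / q) + (K * dist x y powr \<alpha>) powr (1 / q)"
            using a0 q K by (intro powr_add_le_concave) auto
          also have "(K * dist x y powr \<alpha>) powr (1 / q) = K1 * dist x y powr (\<alpha> / q)"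
            using K by (simp add: powr_mult powr_powr K1_def)
          finally have "a x powr (1 / q) * g y \<le> (a y powr (1 / q) + K1 * dist x y powr (\<alpha> / q)) * g y"
            by (intro mult_right_mono g0)
          then show ?thesis by (simp add: b_def g_def algebra_simps)
        qed (simp add: F b_def g_def)
      qed (use b0 \<kappa> in \<open>auto simp: K1_def\<close>)
      moreover have "riesz 0 L b x = ennreal (T1 x)"
        using riesz_finite[of b, OF _ b0 bB] by (simp add: T1_def)
      moreover have "riesz (\<alpha> / q) L g x = ennreal (T2 x)"
        using riesz_finite[of g, OF _ g0 \<kappa>] by (simp add: T2_def)
      ultimately have "ennreal (a x powr (1 / q) * \<bar>f x\<bar>) \<le> ennreal (D * L * (T1 x + K2 * T2 x))"
        using D(1) L0 K2 T0[of x] by (simp add: g_def[abs_def] K2_def ennreal_mult' ennreal_plus)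
      then have le: "a x powr (1 / q) * \<bar>f x\<bar> \<le> D * L * (T1 x + K2 * T2 x)"
        using D(1) L0 K2 T0[of x] by (subst (asm) ennreal_le_iff) auto
      then have "(a x powr (1 / q) * \<bar>f x\<bar>) powr t \<le> (D * L * (T1 x + K2 * T2 x)) powr t"
        using q by (intro powr_mono2) auto
      also have "\<dots> = (D * L) powr t * (T1 x + K2 * T2 x) powr t"
        by (rule powr_mult)
      also have "\<dots> \<le> (D * L) powr t * (2 powr t * (T1 x powr t + (K2 * T2 x) powr t))"
        using K2 T0[of x] q by (intro mult_left_mono powr_add_le) auto
      finally show ?thesis using K2 T0[of x] by (simp add: powr_mult mult.assoc)
    qed (simp add: F)
    have "(\<integral>\<^sup>+x. ennreal ((a x powr (1 / q) * \<bar>f x\<bar>) powr t) \<partial>lborel)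
       \<le> (\<integral>\<^sup>+x. ennreal ((D * L) powr t * 2 powr t) * (ennreal (T1 x powr t) + ennreal (K2 powr t) * ennreal (T2 x powr t)) \<partial>lborel)"
      using pw by (intro nn_integral_mono) (simp add: ennreal_mult'[symmetric] ennreal_plus[symmetric] del: ennreal_plus)
    also have "\<dots> = ennreal ((D * L) powr t * 2 powr t) * ((\<integral>\<^sup>+x. ennreal (T1 x powr t) \<partial>lborel) + ennreal (K2 powr t) * (\<integral>\<^sup>+x. ennreal (T2 x powr t) \<partial>lborel))"
      by (simp add: nn_integral_cmult nn_integral_add)
    also have "\<dots> \<le> ennreal ((D * L) powr t * 2 powr t) * (ennreal \<bar>C1\<bar> + ennreal (K2 powr t) * ennreal \<bar>C2\<bar>)"
      using order_trans[OF i1, of "ennreal \<bar>C1\<bar>"] order_trans[OF i2, of "ennreal \<bar>C2\<bar>"]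
      by (intro mult_left_mono add_mono) (auto intro: ennreal_leI)
    also have "\<dots> = ennreal C"
      by (simp add: C_def ennreal_mult'[symmetric] ennreal_plus[symmetric] del: ennreal_plus)
    finally show "(\<integral>\<^sup>+x. ennreal ((a x powr (1 / q) * \<bar>f x\<bar>) powr t) \<partial>lborel) \<le> ennreal C" .
  qed
qed

text \<open>The constant weight 1, with Hoelder constant 0 and q = p, reduces this to the weighted
  estimate.\<close>

lemma sobolev_bound:
  fixes \<Omega> :: "'a::euclidean_space set"
  assumes \<Omega>: "bounded \<Omega>" and p: "1 < p" "p \<le> t" and sub: "real DIM('a) * (1 / p - 1 / t) < 1"
  obtains C where "\<And>f. \<lbrakk>C1_supp \<Omega> f; (\<integral>\<^sup>+x. ennreal (norm (grad f x) powr p) \<partial>lborel) \<le> 1\<rbrakk> \<Longrightarrow>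
      (\<integral>\<^sup>+x. ennreal (\<bar>f x\<bar> powr t) \<partial>lborel) \<le> ennreal C"
  using weighted_sobolev_bound[where q=p and p=p and t=t and \<alpha>=0 and a="\<lambda>_. 1" and A=1 and K=0 and \<Omega>=\<Omega>] assms
  by auto

section \<open>Compactness in \<open>L\<^sup>1\<close>\<close>

text \<open>After Tonelli, translation invariance makes every point of the segment contribute the
  same integral.\<close>

lemma C1_supp_translate_L1:
  fixes f :: "'a::euclidean_space \<Rightarrow> real"
  assumes f: "C1_supp \<Omega> f"
  shows "(\<integral>\<^sup>+x. ennreal \<bar>f (x + h) - f x\<bar> \<partial>lborel) \<le> ennreal (norm h) * (\<integral>\<^sup>+x. ennreal (norm (grad f x)) \<partial>lborel)"
proof -
  interpret U: prob_space unif01 by (rule prob_space_unif01)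
  interpret P: pair_sigma_finite "lborel :: 'a measure" unif01 ..
  note [measurable] = C1_supp_measurable[OF f]
  have "(\<integral>\<^sup>+x. ennreal \<bar>f (x + h) - f x\<bar> \<partial>lborel)
      \<le> (\<integral>\<^sup>+x. \<integral>\<^sup>+\<theta>. ennreal (norm h * norm (grad f (x + \<theta> *\<^sub>R h))) \<partial>unif01 \<partial>lborel)"
    by (intro nn_integral_mono C1_supp_diff_le[OF f])
  also have "\<dots> = (\<integral>\<^sup>+\<theta>. \<integral>\<^sup>+x. ennreal (norm h * norm (grad f (x + \<theta> *\<^sub>R h))) \<partial>lborel \<partial>unif01)"
    by (rule P.Fubini'[symmetric]) measurable
  also have "\<dots> = (\<integral>\<^sup>+\<theta>. \<integral>\<^sup>+x. ennreal (norm h * norm (grad f x)) \<partial>lborel \<partial>unif01)"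
    by (intro nn_integral_cong nn_integral_translate[where F="\<lambda>x. ennreal (norm h * norm (grad f x))"]) measurable
  also have "\<dots> = ennreal (norm h) * (\<integral>\<^sup>+x. ennreal (norm (grad f x)) \<partial>lborel)"
    by (simp add: U.emeasure_space_1[simplified] ennreal_mult' nn_integral_cmult)
  finally show ?thesis .
qed

text \<open>A shift of length 2 R + 1 carries the domain off itself, so on the domain the increment
  has modulus |f|.\<close>

lemma poincare_L1:
  fixes \<Omega> :: "'a::euclidean_space set"
  assumes R: "\<And>x. x \<in> \<Omega> \<Longrightarrow> norm x \<le> R" "0 \<le> R" and f: "C1_supp \<Omega> f"
  shows "(\<integral>\<^sup>+x. ennreal \<bar>f x\<bar> \<partial>lborel) \<le> ennreal (2 * R + 1) * (\<integral>\<^sup>+x. ennreal (norm (grad f x)) \<partial>lborel)"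
proof -
  note F = C1_suppD[OF f]
  obtain i :: 'a where i: "i \<in> Basis" using nonempty_Basis by blast
  define h where "h = (2 * R + 1) *\<^sub>R i"
  have nh: "norm h = 2 * R + 1" using i R by (simp add: h_def)
  have "\<bar>f x\<bar> \<le> \<bar>f (x + h) - f x\<bar>" for x
  proof (cases "x \<in> \<Omega>")
    case True
    have "x + h \<notin> \<Omega>"
    proof
      assume "x + h \<in> \<Omega>"
      then have "norm h \<le> R + R" using R(1)[OF True] R(1)[of "x + h"] norm_triangle_ineq4[of "x + h" x] by simp
      then show False using nh by simp
    qed
    then show ?thesis using F by simp
  qed (simp add: F)
  then have "(\<integral>\<^sup>+x. ennreal \<bar>f x\<bar> \<partial>lborel) \<le> (\<integral>\<^sup>+x. ennreal \<bar>f (x + h) - f x\<bar> \<partial>lborel)"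
    by (intro nn_integral_mono ennreal_leI)
  also have "\<dots> \<le> ennreal (2 * R + 1) * (\<integral>\<^sup>+x. ennreal (norm (grad f x)) \<partial>lborel)"
    using C1_supp_translate_L1[OF f, of h] by (simp add: nh)
  finally show ?thesis .
qed

section \<open>Dyadic averages and extraction of subsequences\<close>

definition grid_corner :: "nat \<Rightarrow> 'a::euclidean_space \<Rightarrow> 'a" where
  "grid_corner n x = (\<Sum>i\<in>Basis. (real_of_int \<lfloor>2 ^ n * (x \<bullet> i)\<rfloor> / 2 ^ n) *\<^sub>R i)"

text \<open>The average is taken over a neighbour of the dyadic cube that contains \<open>x\<close>, which allows
  the uniform measure on \<open>[1, 2]\<^sup>N\<close> to be used here as well.\<close>

definition grid_average :: "nat \<Rightarrow> ('a::euclidean_space \<Rightarrow> real) \<Rightarrow> 'a \<Rightarrow> real" where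
  "grid_average n f x = (\<integral>w. f (grid_corner n x + (1 / 2 ^ n) *\<^sub>R w) \<partial>unif_box)"

lemma grid_corner_measurable [measurable]: "grid_corner n \<in> borel_measurable borel"
  unfolding grid_corner_def[abs_def] by measurable

text \<open>Corners are indexed by integer vectors; countability lets one diagonal subsequence serve
  the averages at all scales.\<close>

lemma countable_range_grid_corner: "countable (range (grid_corner n :: 'a::euclidean_space \<Rightarrow> 'a))"
proof -
  let ?g = "\<lambda>z. (\<Sum>i\<in>(Basis :: 'a set). (real_of_int (z i) / 2 ^ n) *\<^sub>R i)"
  have "range (grid_corner n :: 'a \<Rightarrow> 'a) \<subseteq> ?g ` (Basis \<rightarrow>\<^sub>E UNIV)"
  proof
    fix y assume "y \<in> range (grid_corner n :: 'a \<Rightarrow> 'a)"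
    then obtain x :: 'a where x: "y = grid_corner n x" by blast
    have e: "y = ?g (restrict (\<lambda>i. \<lfloor>2 ^ n * (x \<bullet> i)\<rfloor>) Basis)"
      unfolding x grid_corner_def by (intro sum.cong) auto
    show "y \<in> ?g ` (Basis \<rightarrow>\<^sub>E UNIV)" by (rule image_eqI[where f="?g", OF e]) auto
  qed
  moreover have "countable (?g ` (Basis \<rightarrow>\<^sub>E UNIV))"
    by (intro countable_image countable_PiE) auto
  ultimately show ?thesis by (rule countable_subset)
qed

lemma grid_corner_frac:
  fixes x :: "'a::euclidean_space"
  assumes "i \<in> Basis"
  shows "0 \<le> (2 ^ n *\<^sub>R (x - grid_corner n x)) \<bullet> i" "(2 ^ n *\<^sub>R (x - grid_corner n x)) \<bullet> i \<le> 1"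
proof -
  have "grid_corner n x \<bullet> i = real_of_int \<lfloor>2 ^ n * (x \<bullet> i)\<rfloor> / 2 ^ n"
    using assms by (simp add: grid_corner_def inner_sum_left inner_Basis if_distrib cong: if_cong)
  then have "(2 ^ n *\<^sub>R (x - grid_corner n x)) \<bullet> i = frac (2 ^ n * (x \<bullet> i))"
    by (simp add: inner_diff_left frac_def right_diff_distrib)
  then show "0 \<le> (2 ^ n *\<^sub>R (x - grid_corner n x)) \<bullet> i" "(2 ^ n *\<^sub>R (x - grid_corner n x)) \<bullet> i \<le> 1"
    by (auto simp: less_imp_le[OF frac_lt_1])
qed

lemma grid_average_measurable:
  assumes [measurable]: "f \<in> borel_measurable borel"
  shows "grid_average n f \<in> borel_measurable borel"
proof -
  interpret W: prob_space "unif_box :: 'a measure" by (rule prob_space_unif_box)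
  show ?thesis unfolding grid_average_def[abs_def] by measurable
qed

lemma C1_supp_integrable_unif_box:
  assumes f: "C1_supp \<Omega> f"
  shows "integrable unif_box (\<lambda>w. f (y + c *\<^sub>R w))"
proof -
  interpret W: prob_space "unif_box :: 'a measure" by (rule prob_space_unif_box)
  note [measurable] = C1_supp_measurable[OF f]
  obtain B where "\<And>x. norm (f x) \<le> B" using C1_supp_bounded[OF f] by blast
  then show ?thesis by (intro W.integrable_const_bound[where B=B]) auto
qed

text \<open>The bound depends on f only through its L^1 norm, so for fixed n it is uniform along a
  sequence bounded in L^1.\<close>

lemma grid_average_bound:
  fixes f :: "'a::euclidean_space \<Rightarrow> real"
  assumes f: "C1_supp \<Omega> f" and I: "(\<integral>\<^sup>+x. ennreal \<bar>f x\<bar> \<partial>lborel) \<le> ennreal B" and B: "B > 0"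
  shows "\<bar>grid_average n f x\<bar> \<le> B * (2 ^ n) ^ DIM('a)"
proof -
  note [measurable] = C1_supp_measurable[OF f]
  let ?c = "grid_corner n x" and ?d = "1 / 2 ^ n :: real"
  have "ennreal (norm (grid_average n f x)) \<le> (\<integral>\<^sup>+w. ennreal (norm (f (?c + ?d *\<^sub>R w))) \<partial>unif_box)"
    unfolding grid_average_def by (rule integral_norm_bound_ennreal[OF C1_supp_integrable_unif_box[OF f]])
  also have "\<dots> \<le> (\<integral>\<^sup>+w. ennreal (norm (f (?c + ?d *\<^sub>R w))) \<partial>lborel)"
    by (subst nn_integral_unif_box) (auto intro!: nn_integral_mono simp: indicator_def)
  also have "\<dots> = ennreal B * (\<integral>\<^sup>+w. ennreal (norm (f (?c + ?d *\<^sub>R w)) / B) \<partial>lborel)"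
    using B by (subst nn_integral_cmult[symmetric]) (auto simp: ennreal_mult'[symmetric])
  also have "\<dots> \<le> ennreal B * ennreal (?d powr - real DIM('a))"
  proof (intro mult_left_mono nn_integral_scale_le[where F="\<lambda>x. ennreal (norm (f x) / B)"])
    have "(\<integral>\<^sup>+x. ennreal (norm (f x) / B) \<partial>lborel) = (\<integral>\<^sup>+x. ennreal (1 / B) * ennreal \<bar>f x\<bar> \<partial>lborel)"
      using B by (simp add: ennreal_mult'[symmetric])
    also have "\<dots> = ennreal (1 / B) * (\<integral>\<^sup>+x. ennreal \<bar>f x\<bar> \<partial>lborel)" by (rule nn_integral_cmult) measurable
    also have "\<dots> \<le> ennreal (1 / B) * ennreal B" by (intro mult_left_mono I) simp
    finally show "(\<integral>\<^sup>+x. ennreal (norm (f x) / B) \<partial>lborel) \<le> 1" using B by (simp add: ennreal_mult'[symmetric])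
  qed auto
  also have "?d powr - real DIM('a) = (2 ^ n) ^ DIM('a)"
    by (simp add: powr_minus powr_realpow power_divide)
  finally show ?thesis using B by (simp add: ennreal_mult'[symmetric])
qed

text \<open>Shifting w by the rescaled offset of x from its corner replaces the corner by x. The new
  variable v lies in [0, 2]^N, which no longer depends on x, so Tonelli and the translation estimate
  apply; the volume 2^N of this cube enters the constant.\<close>

lemma grid_average_approx:
  fixes f :: "'a::euclidean_space \<Rightarrow> real"
  assumes D: "D > 0" "\<And>v. v \<in> cbox 0 (2 *\<^sub>R One :: 'a) \<Longrightarrow> norm v \<le> D" and f: "C1_supp \<Omega> f"
  shows "(\<integral>\<^sup>+x. ennreal \<bar>f x - grid_average n f x\<bar> \<partial>lborel)
    \<le> ennreal (2 ^ DIM('a) * D / 2 ^ n) * (\<integral>\<^sup>+x. ennreal (norm (grad f x)) \<partial>lborel)"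
proof -
  interpret W: prob_space "unif_box :: 'a measure" by (rule prob_space_unif_box)
  note [measurable] = C1_supp_measurable[OF f]
  let ?d = "1 / 2 ^ n :: real"
  let ?Q = "cbox 0 (2 *\<^sub>R One) :: 'a set"
  let ?I = "\<integral>\<^sup>+x. ennreal (norm (grad f x)) \<partial>lborel"
  have 1: "ennreal \<bar>f x - grid_average n f x\<bar> \<le> (\<integral>\<^sup>+v. ennreal \<bar>f (x + ?d *\<^sub>R v) - f x\<bar> * indicator ?Q v \<partial>lborel)" for x
  proof -
    let ?fr = "2 ^ n *\<^sub>R (x - grid_corner n x)"
    let ?H = "\<lambda>w. ennreal \<bar>f (grid_corner n x + ?d *\<^sub>R w) - f x\<bar> * indicator (cbox One (2 *\<^sub>R One)) w"
    have "\<bar>f x - grid_average n f x\<bar> = norm (\<integral>w. f (grid_corner n x + ?d *\<^sub>R w) - f x \<partial>unif_box)"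
      unfolding grid_average_def using C1_supp_integrable_unif_box[OF f]
      by (subst Bochner_Integration.integral_diff) (auto simp: W.prob_space[simplified])
    also have "ennreal \<dots> \<le> (\<integral>\<^sup>+w. ennreal (norm (f (grid_corner n x + ?d *\<^sub>R w) - f x)) \<partial>unif_box)"
      by (intro integral_norm_bound_ennreal Bochner_Integration.integrable_diff C1_supp_integrable_unif_box[OF f]) simp
    also have "\<dots> = (\<integral>\<^sup>+w. ?H w \<partial>lborel)" by (subst nn_integral_unif_box) auto
    also have "\<dots> = (\<integral>\<^sup>+v. ?H (v + ?fr) \<partial>lborel)"
      by (rule nn_integral_translate[symmetric]) measurable
    also have "\<dots> \<le> (\<integral>\<^sup>+v. ennreal \<bar>f (x + ?d *\<^sub>R v) - f x\<bar> * indicator ?Q v \<partial>lborel)"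
    proof (intro nn_integral_mono)
      fix v
      have "grid_corner n x + ?d *\<^sub>R (v + ?fr) = x + ?d *\<^sub>R v" by (simp add: scaleR_add_right)
      moreover have "v \<in> ?Q" if "v + ?fr \<in> cbox One (2 *\<^sub>R One)"
        unfolding mem_box
      proof
        fix i :: 'a assume i: "i \<in> Basis"
        have "1 \<le> v \<bullet> i + ?fr \<bullet> i" "v \<bullet> i + ?fr \<bullet> i \<le> 2"
          using that i by (auto simp: mem_box inner_add_left)
        then show "0 \<bullet> i \<le> v \<bullet> i \<and> v \<bullet> i \<le> (2 *\<^sub>R One) \<bullet> i"
          using grid_corner_frac[OF i, of n x] i by auto
      qed
      ultimately show "?H (v + ?fr) \<le> ennreal \<bar>f (x + ?d *\<^sub>R v) - f x\<bar> * indicator ?Q v"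
        by (auto simp: indicator_def)
    qed
    finally show ?thesis .
  qed
  have "(\<integral>\<^sup>+x. ennreal \<bar>f x - grid_average n f x\<bar> \<partial>lborel)
     \<le> (\<integral>\<^sup>+x. \<integral>\<^sup>+v. ennreal \<bar>f (x + ?d *\<^sub>R v) - f x\<bar> * indicator ?Q v \<partial>lborel \<partial>lborel)"
    by (intro nn_integral_mono 1)
  also have "\<dots> = (\<integral>\<^sup>+v. \<integral>\<^sup>+x. ennreal \<bar>f (x + ?d *\<^sub>R v) - f x\<bar> * indicator ?Q v \<partial>lborel \<partial>lborel)"
    by (rule lborel_pair.Fubini'[symmetric]) measurable
  also have "\<dots> = (\<integral>\<^sup>+v. (\<integral>\<^sup>+x. ennreal \<bar>f (x + ?d *\<^sub>R v) - f x\<bar> \<partial>lborel) * indicator ?Q v \<partial>lborel)"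
    by (intro nn_integral_cong nn_integral_multc) measurable
  also have "\<dots> \<le> (\<integral>\<^sup>+v. (ennreal (D / 2 ^ n) * ?I) * indicator ?Q v \<partial>lborel)"
  proof (intro nn_integral_mono)
    fix v :: 'a
    show "(\<integral>\<^sup>+x. ennreal \<bar>f (x + ?d *\<^sub>R v) - f x\<bar> \<partial>lborel) * indicator ?Q v \<le> (ennreal (D / 2 ^ n) * ?I) * indicator ?Q v"
    proof (cases "v \<in> ?Q")
      case True
      have "(\<integral>\<^sup>+x. ennreal \<bar>f (x + ?d *\<^sub>R v) - f x\<bar> \<partial>lborel) \<le> ennreal (norm (?d *\<^sub>R v)) * ?I"
        by (rule C1_supp_translate_L1[OF f])
      also have "\<dots> \<le> ennreal (D / 2 ^ n) * ?I"
        using D(2)[OF True] by (intro mult_right_mono ennreal_leI) (auto simp: divide_right_mono)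
      finally show ?thesis using True by simp
    qed simp
  qed
  also have "\<dots> = (ennreal (D / 2 ^ n) * ?I) * emeasure lborel ?Q"
    by (rule nn_integral_cmult_indicator) simp
  also have "emeasure lborel ?Q = ennreal (2 ^ DIM('a))"
    by (simp add: emeasure_lborel_cbox inner_simps)
  also have "(ennreal (D / 2 ^ n) * ?I) * ennreal (2 ^ DIM('a)) = ennreal (2 ^ DIM('a) * D / 2 ^ n) * ?I"
    using D by (simp add: mult_ac ennreal_mult'[symmetric] mult.assoc[symmetric])
  finally show ?thesis .
qed

lemma C1_supp_integrable:
  assumes f: "C1_supp \<Omega> f"
  shows "integrable lborel f"
  using C1_supp_integrable_mult[OF f, of "\<lambda>_. 1"] by simp

text \<open>A concrete Frechet-Kolmogorov argument: dyadic averages converge pointwise along a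
  diagonal subsequence, they are uniformly close to the functions in L^1, and an L^1 Cauchy sequence
  has a subsequence that is Cauchy almost everywhere.\<close>

lemma C1_supp_L1_compact:
  fixes \<Omega> :: "'a::euclidean_space set" and f :: "nat \<Rightarrow> 'a \<Rightarrow> real"
  assumes \<Omega>: "bounded \<Omega>" and f: "\<And>k. C1_supp \<Omega> (f k)"
    and I: "\<And>k. (\<integral>\<^sup>+x. ennreal (norm (grad (f k) x)) \<partial>lborel) \<le> ennreal B"
  obtains \<sigma> where "strict_mono \<sigma>" "AE x in lborel. Cauchy (\<lambda>k. f (\<sigma> k) x)"
proof -
  obtain R where R: "0 < R" "\<And>x. x \<in> \<Omega> \<Longrightarrow> norm x \<le> R" using \<Omega> bounded_pos by blast
  obtain D where D: "D > 0" "\<And>v. v \<in> cbox 0 (2 *\<^sub>R One :: 'a) \<Longrightarrow> norm v \<le> D"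
    using bounded_cbox[of 0 "2 *\<^sub>R One :: 'a"] bounded_pos by metis
  note F = C1_suppD[OF f] and [measurable] = C1_supp_measurable[OF f]
  define B' where "B' = max B 1"
  have B': "B' > 0" by (simp add: B'_def)
  have I': "(\<integral>\<^sup>+x. ennreal (norm (grad (f k) x)) \<partial>lborel) \<le> ennreal B'" for k
    using order_trans[OF I[of k]] by (simp add: B'_def ennreal_leI)
  define B1 where "B1 = (2 * R + 1) * B'"
  have B1: "B1 > 0" using R B' by (simp add: B1_def)
  have I1: "(\<integral>\<^sup>+x. ennreal \<bar>f k x\<bar> \<partial>lborel) \<le> ennreal B1" for k
  proof -
    have "(\<integral>\<^sup>+x. ennreal \<bar>f k x\<bar> \<partial>lborel) \<le> ennreal (2 * R + 1) * (\<integral>\<^sup>+x. ennreal (norm (grad (f k) x)) \<partial>lborel)"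
      by (rule poincare_L1[OF _ _ f]) (use R in auto)
    also have "\<dots> \<le> ennreal (2 * R + 1) * ennreal B'" by (intro mult_left_mono I') simp
    also have "\<dots> = ennreal B1" unfolding B1_def using R B' by (intro ennreal_mult'[symmetric]) simp
    finally show ?thesis .
  qed
  \<comment> \<open>Division by 2^(n N) lets the single bound \<open>B1\<close> hold at all scales,
    as the joint extraction over the countable set of pairs requires.\<close>
  define G where "G k = (\<lambda>(n, y). (\<integral>w. f k (y + (1 / 2 ^ n) *\<^sub>R w) \<partial>unif_box) / (2 ^ n) ^ DIM('a))" for k and y :: "_ \<times> 'a"
  have gG: "grid_average n (f k) x = G k (n, grid_corner n x) * (2 ^ n) ^ DIM('a)" for n k x
    by (simp add: G_def grid_average_def)
  let ?S = "SIGMA n:UNIV. range (grid_corner n :: 'a \<Rightarrow> 'a)"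
  have cS: "countable ?S" by (intro countable_SIGMA countable_range_grid_corner) auto
  have bS: "norm (G k s) \<le> B1" if sS: "s \<in> ?S" for k s
  proof -
    obtain n x where s: "s = (n, grid_corner n x)" using sS by auto
    have "\<bar>grid_average n (f k) x\<bar> \<le> B1 * (2 ^ n) ^ DIM('a)"
      by (rule grid_average_bound[OF f I1 B1])
    then show ?thesis by (simp add: gG s abs_mult)
  qed
  obtain \<tau> where \<tau>: "strict_mono \<tau>" "\<And>s. s \<in> ?S \<Longrightarrow> \<exists>l. (\<lambda>k. G (\<tau> k) s) \<longlonglongrightarrow> l"
    using function_convergent_subsequence[of ?S G B1] cS bS by blast
  define h where "h k = f (\<tau> k)" for k
  have hf: "C1_supp \<Omega> (h k)" for k by (simp add: h_def f)
  note [measurable] = C1_supp_measurable[OF hf]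
  have h0: "h k x = 0" if "x \<notin> cball 0 R" for k x
  proof -
    have "x \<notin> \<Omega>" using R(2)[of x] that by auto
    then show ?thesis using C1_suppD(4)[OF hf] by blast
  qed
  have conv: "convergent (\<lambda>k. grid_average n (h k) x)" for n x
  proof -
    obtain l where "(\<lambda>k. G (\<tau> k) (n, grid_corner n x)) \<longlonglongrightarrow> l" using \<tau>(2) by blast
    then have "(\<lambda>k. G (\<tau> k) (n, grid_corner n x) * (2 ^ n) ^ DIM('a)) \<longlonglongrightarrow> l * (2 ^ n) ^ DIM('a)"
      by (intro tendsto_intros)
    then show ?thesis unfolding gG h_def convergent_def by blast
  qed
  have inth: "integrable lborel (h k)" for k by (rule C1_supp_integrable[OF hf])
  have cauchy: "\<exists>M. \<forall>i\<ge>M. \<forall>j\<ge>M. (LINT x|lborel. norm (h i x - h j x)) < e" if "e > 0" for e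
  proof -
    define E where "E = 2 ^ DIM('a) * D * B'"
    have "E > 0" using D B' by (simp add: E_def)
    \<comment> \<open>The scale is fixed so that averaging costs less than e / 4 for every k at
      once.\<close>
    obtain n where "E / (e / 4) < 2 ^ n" using real_arch_pow[of 2 "E / (e / 4)"] by auto
    then have n: "E / 2 ^ n < e / 4" using that by (simp add: field_simps)
    let ?A = "\<lambda>k. grid_average n (h k)"
    \<comment> \<open>The averages may spill over the domain. The cut-off to a ball containing it
      makes them integrable and, since \<open>h k\<close> vanishes outside the ball, does not
      increase the error.\<close>
    define v where "v k x = indicator (cball 0 R) x * ?A k x" for k x
    define q where "q x = indicator (cball 0 R) x * lim (\<lambda>k. ?A k x)" for x
    define \<Lambda> where "\<Lambda> = B1 * (2 ^ n) ^ DIM('a)"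
    have Ab: "\<bar>?A k x\<bar> \<le> \<Lambda>" for k x
      unfolding \<Lambda>_def h_def by (rule grid_average_bound[OF f I1 B1])
    have [measurable]: "v k \<in> borel_measurable borel" for k
      unfolding v_def
      by (intro borel_measurable_times grid_average_measurable borel_measurable_indicator C1_supp_measurable[OF hf]) auto
    have Alim: "(\<lambda>k. ?A k x) \<longlonglongrightarrow> lim (\<lambda>k. ?A k x)" for x using conv by (simp add: convergent_LIMSEQ_iff)
    have vq: "(\<lambda>k. v k x) \<longlonglongrightarrow> q x" for x unfolding v_def q_def by (intro tendsto_intros Alim)
    have [measurable]: "q \<in> borel_measurable borel"
      by (rule borel_measurable_LIMSEQ_real[OF vq]) measurable
    have vb: "\<bar>v k x\<bar> \<le> indicator (cball 0 R) x *\<^sub>R \<Lambda>" for k x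
      using Ab by (auto simp: v_def indicator_def)
    have qb: "\<bar>q x\<bar> \<le> indicator (cball 0 R) x *\<^sub>R \<Lambda>" for x
      by (rule LIMSEQ_le_const2[OF tendsto_rabs[OF vq]]) (use vb in blast)
    have intL: "integrable lborel (\<lambda>x. indicator (cball 0 R) x *\<^sub>R \<Lambda> :: real)"
      by (intro borel_integrable_compact) (auto intro: continuous_intros)
    have intv: "integrable lborel (v k)" for k
      by (rule Bochner_Integration.integrable_bound[OF intL]) (auto intro!: AE_I2 order_trans[OF vb, simplified])
    have intq: "integrable lborel q"
      by (rule Bochner_Integration.integrable_bound[OF intL]) (auto intro!: AE_I2 order_trans[OF qb, simplified])
    have "(\<lambda>k. LINT x|lborel. \<bar>v k x - q x\<bar>) \<longlonglongrightarrow> (LINT x|(lborel::'a measure). 0)"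
    proof (rule integral_dominated_convergence[where w="\<lambda>x. 2 * (indicator (cball 0 R) x *\<^sub>R \<Lambda>)"])
      show "integrable lborel (\<lambda>x. 2 * (indicator (cball 0 R) x *\<^sub>R \<Lambda>) :: real)" using intL by simp
      show "AE x in lborel. (\<lambda>k. \<bar>v k x - q x\<bar>) \<longlonglongrightarrow> 0"
        using vq by (intro AE_I2 tendsto_rabs_zero) (simp add: LIM_zero_iff)
      show "AE x in lborel. norm \<bar>v k x - q x\<bar> \<le> 2 * (indicator (cball 0 R) x *\<^sub>R \<Lambda>)" for k
      proof (rule AE_I2)
        fix x show "norm \<bar>v k x - q x\<bar> \<le> 2 * (indicator (cball 0 R) x *\<^sub>R \<Lambda>)"
          using vb[of k x] qb[of x] abs_triangle_ineq4[of "v k x" "q x"] by simp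
      qed
    qed measurable
    then have "\<forall>\<^sub>F k in sequentially. (LINT x|lborel. \<bar>v k x - q x\<bar>) < e / 4"
      using that by (intro order_tendstoD(2)) auto
    then obtain M where M: "\<And>k. k \<ge> M \<Longrightarrow> (LINT x|lborel. \<bar>v k x - q x\<bar>) < e / 4"
      by (auto simp: eventually_sequentially)
    have hv: "(LINT x|lborel. \<bar>h k x - v k x\<bar>) < e / 4" for k
    proof -
      have "ennreal (LINT x|lborel. \<bar>h k x - v k x\<bar>) = (\<integral>\<^sup>+x. ennreal \<bar>h k x - v k x\<bar> \<partial>lborel)"
        using inth intv by (intro nn_integral_eq_integral[symmetric]) auto
      also have "\<dots> \<le> (\<integral>\<^sup>+x. ennreal \<bar>h k x - ?A k x\<bar> \<partial>lborel)"
        using h0 by (intro nn_integral_mono ennreal_leI) (auto simp: v_def indicator_def)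
      also have "\<dots> \<le> ennreal (2 ^ DIM('a) * D / 2 ^ n) * (\<integral>\<^sup>+x. ennreal (norm (grad (h k) x)) \<partial>lborel)"
        by (rule grid_average_approx[OF D hf])
      also have "\<dots> \<le> ennreal (2 ^ DIM('a) * D / 2 ^ n) * ennreal B'"
        unfolding h_def by (intro mult_left_mono I') simp
      also have "\<dots> = ennreal (E / 2 ^ n)" using D B' by (simp add: E_def ennreal_mult'[symmetric])
      finally have "(LINT x|lborel. \<bar>h k x - v k x\<bar>) \<le> E / 2 ^ n"
        using \<open>E > 0\<close> by (subst (asm) ennreal_le_iff) auto
      with n show ?thesis by linarith
    qed
    have "(LINT x|lborel. norm (h i x - h j x)) < e" if "i \<ge> M" "j \<ge> M" for i j
    proof -
      have "(LINT x|lborel. norm (h i x - h j x)) \<le>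
          (LINT x|lborel. \<bar>h i x - v i x\<bar> + \<bar>v i x - q x\<bar> + \<bar>v j x - q x\<bar> + \<bar>h j x - v j x\<bar>)"
        using inth intv intq by (intro integral_mono) auto
      also have "\<dots> = (LINT x|lborel. \<bar>h i x - v i x\<bar>) + (LINT x|lborel. \<bar>v i x - q x\<bar>)
          + (LINT x|lborel. \<bar>v j x - q x\<bar>) + (LINT x|lborel. \<bar>h j x - v j x\<bar>)"
        using inth intv intq by simp
      also have "\<dots> < e" using hv[of i] hv[of j] M[OF that(1)] M[OF that(2)] by simp
      finally show ?thesis .
    qed
    then show ?thesis by blast
  qed
  obtain r where r: "strict_mono r" "AE x in lborel. Cauchy (\<lambda>i. h (r i) x)"
    using cauchy_L1_AE_cauchy_subseq[OF inth cauchy] by blast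
  show thesis
  proof (rule that)
    show "strict_mono (\<tau> \<circ> r)" using \<tau>(1) r(1) by (rule strict_mono_o)
    show "AE x in lborel. Cauchy (\<lambda>k. f ((\<tau> \<circ> r) k) x)" using r(2) by (simp add: h_def)
  qed
qed

section \<open>Modulars and Luxemburg norms\<close>

lemma double_phase_nonneg: "0 \<le> a x \<Longrightarrow> 0 \<le> double_phase p q a x t"
  by (simp add: double_phase_def)

lemma double_phase_mono:
  assumes "0 < p" "0 < q" "0 \<le> a x" "0 \<le> s" "s \<le> t"
  shows "double_phase p q a x s \<le> double_phase p q a x t"
  unfolding double_phase_def using assms by (intro add_mono powr_mono2 mult_left_mono) auto

lemma modular_mono:
  assumes "0 < p" "0 < q" "AE x in lebesgue_on \<Omega>. 0 \<le> a x" "AE x in lebesgue_on \<Omega>. \<bar>u x\<bar> \<le> \<bar>v x\<bar>"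
  shows "modular \<Omega> (double_phase p q a) u \<le> modular \<Omega> (double_phase p q a) v"
  unfolding modular_def
proof (rule nn_integral_mono_AE)
  show "AE x in lebesgue_on \<Omega>. ennreal (double_phase p q a x \<bar>u x\<bar>) \<le> ennreal (double_phase p q a x \<bar>v x\<bar>)"
    using assms(3,4) by eventually_elim (intro ennreal_leI double_phase_mono assms(1,2), auto)
qed

text \<open>Replaces homogeneity: one constant dominates both powers of c.\<close>

lemma modular_cmult_le:
  assumes pq: "0 < p" "0 < q" and a: "AE x in lebesgue_on \<Omega>. 0 \<le> a x" and am: "a \<in> borel_measurable (lebesgue_on \<Omega>)"
    and u: "u \<in> borel_measurable (lebesgue_on \<Omega>)" and c: "0 \<le> c" and C: "c powr p \<le> C" "c powr q \<le> C"
  shows "modular \<Omega> (double_phase p q a) (\<lambda>x. c * u x) \<le> ennreal C * modular \<Omega> (double_phase p q a) u"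
proof -
  note [measurable] = u am
  have C0: "0 \<le> C" using C powr_ge_zero order_trans by blast
  have "modular \<Omega> (double_phase p q a) (\<lambda>x. c * u x)
      \<le> (\<integral>\<^sup>+x. ennreal C * ennreal (double_phase p q a x \<bar>u x\<bar>) \<partial>lebesgue_on \<Omega>)"
    unfolding modular_def
  proof (rule nn_integral_mono_AE)
    show "AE x in lebesgue_on \<Omega>. ennreal (double_phase p q a x \<bar>c * u x\<bar>) \<le> ennreal C * ennreal (double_phase p q a x \<bar>u x\<bar>)"
      using a
    proof eventually_elim
      case (elim x)
      have "double_phase p q a x \<bar>c * u x\<bar> = c powr p * \<bar>u x\<bar> powr p + c powr q * (a x * \<bar>u x\<bar> powr q)"
        using c by (simp add: double_phase_def abs_mult powr_mult)
      also have "\<dots> \<le> C * \<bar>u x\<bar> powr p + C * (a x * \<bar>u x\<bar> powr q)"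
        using C elim by (intro add_mono mult_right_mono) auto
      also have "\<dots> = C * double_phase p q a x \<bar>u x\<bar>" by (simp add: double_phase_def algebra_simps)
      finally show ?case using C0 by (simp add: ennreal_mult'[symmetric] ennreal_leI)
    qed
  qed
  also have "\<dots> = ennreal C * modular \<Omega> (double_phase p q a) u"
    unfolding modular_def double_phase_def by (rule nn_integral_cmult) measurable
  finally show ?thesis .
qed

lemma modular_add_le:
  assumes pq: "0 < p" "0 < q" and a: "AE x in lebesgue_on \<Omega>. 0 \<le> a x" and am: "a \<in> borel_measurable (lebesgue_on \<Omega>)"
    and u: "u \<in> borel_measurable (lebesgue_on \<Omega>)" and v: "v \<in> borel_measurable (lebesgue_on \<Omega>)"
    and le: "AE x in lebesgue_on \<Omega>. \<bar>w x\<bar> \<le> \<bar>u x\<bar> + \<bar>v x\<bar>"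
    and fin: "modular \<Omega> (double_phase p q a) u < \<infinity>" "modular \<Omega> (double_phase p q a) v < \<infinity>"
  shows "modular \<Omega> (double_phase p q a) w < \<infinity>"
proof -
  note [measurable] = u v am
  let ?C = "2 powr p + 2 powr q :: real"
  have "modular \<Omega> (double_phase p q a) w
      \<le> (\<integral>\<^sup>+x. ennreal ?C * (ennreal (double_phase p q a x \<bar>u x\<bar>) + ennreal (double_phase p q a x \<bar>v x\<bar>)) \<partial>lebesgue_on \<Omega>)"
    unfolding modular_def
  proof (rule nn_integral_mono_AE)
    show "AE x in lebesgue_on \<Omega>. ennreal (double_phase p q a x \<bar>w x\<bar>)
        \<le> ennreal ?C * (ennreal (double_phase p q a x \<bar>u x\<bar>) + ennreal (double_phase p q a x \<bar>v x\<bar>))"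
      using a le
    proof eventually_elim
      case (elim x)
      have e: "\<bar>w x\<bar> powr e \<le> ?C * (\<bar>u x\<bar> powr e + \<bar>v x\<bar> powr e)" if "e = p \<or> e = q" for e
      proof -
        have "\<bar>w x\<bar> powr e \<le> (\<bar>u x\<bar> + \<bar>v x\<bar>) powr e" using elim that pq by (intro powr_mono2) auto
        also have "\<dots> \<le> 2 powr e * (\<bar>u x\<bar> powr e + \<bar>v x\<bar> powr e)" using that pq by (intro powr_add_le) auto
        also have "\<dots> \<le> ?C * (\<bar>u x\<bar> powr e + \<bar>v x\<bar> powr e)" using that by (intro mult_right_mono) auto
        finally show ?thesis .
      qed
      have "double_phase p q a x \<bar>w x\<bar> \<le> ?C * (\<bar>u x\<bar> powr p + \<bar>v x\<bar> powr p) + a x * (?C * (\<bar>u x\<bar> powr q + \<bar>v x\<bar> powr q))"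
        unfolding double_phase_def using e elim by (intro add_mono mult_left_mono) auto
      also have "\<dots> = ?C * (double_phase p q a x \<bar>u x\<bar> + double_phase p q a x \<bar>v x\<bar>)"
        by (simp add: double_phase_def algebra_simps)
      finally have "ennreal (double_phase p q a x \<bar>w x\<bar>) \<le> ennreal (?C * (double_phase p q a x \<bar>u x\<bar> + double_phase p q a x \<bar>v x\<bar>))"
        by (rule ennreal_leI)
      also have "\<dots> = ennreal ?C * (ennreal (double_phase p q a x \<bar>u x\<bar>) + ennreal (double_phase p q a x \<bar>v x\<bar>))"
        using elim(1) by (subst ennreal_mult') (auto simp: double_phase_nonneg ennreal_plus)
      finally show ?case .
    qed
  qed
  also have "\<dots> = ennreal ?C * (modular \<Omega> (double_phase p q a) u + modular \<Omega> (double_phase p q a) v)"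
    unfolding modular_def double_phase_def by (subst nn_integral_cmult, measurable, subst nn_integral_add) auto
  also have "\<dots> < \<infinity>" using fin by (simp add: ennreal_mult_less_top)
  finally show ?thesis .
qed

text \<open>Convexity of the modular unit ball in the form that replaces the triangle inequality for
  gradients.\<close>

lemma modular_midpoint_le_1:
  assumes pq: "1 \<le> p" "1 \<le> q" and a: "AE x in lebesgue_on \<Omega>. 0 \<le> a x" and am: "a \<in> borel_measurable (lebesgue_on \<Omega>)"
    and u: "u \<in> borel_measurable (lebesgue_on \<Omega>)" and v: "v \<in> borel_measurable (lebesgue_on \<Omega>)"
    and le: "AE x in lebesgue_on \<Omega>. \<bar>w x\<bar> \<le> (\<bar>u x\<bar> + \<bar>v x\<bar>) / 2"
    and fin: "modular \<Omega> (double_phase p q a) u \<le> 1" "modular \<Omega> (double_phase p q a) v \<le> 1"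
  shows "modular \<Omega> (double_phase p q a) w \<le> 1"
proof -
  note [measurable] = u v am
  have "modular \<Omega> (double_phase p q a) w
      \<le> (\<integral>\<^sup>+x. ennreal (1 / 2) * (ennreal (double_phase p q a x \<bar>u x\<bar>) + ennreal (double_phase p q a x \<bar>v x\<bar>)) \<partial>lebesgue_on \<Omega>)"
    unfolding modular_def
  proof (rule nn_integral_mono_AE)
    show "AE x in lebesgue_on \<Omega>. ennreal (double_phase p q a x \<bar>w x\<bar>)
        \<le> ennreal (1 / 2) * (ennreal (double_phase p q a x \<bar>u x\<bar>) + ennreal (double_phase p q a x \<bar>v x\<bar>))"
      using a le
    proof eventually_elim
      case (elim x)
      have e: "\<bar>w x\<bar> powr e \<le> (\<bar>u x\<bar> powr e + \<bar>v x\<bar> powr e) / 2" if "1 \<le> e" for e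
      proof -
        have "\<bar>w x\<bar> powr e \<le> ((1 - 1 / 2) * \<bar>u x\<bar> + 1 / 2 * \<bar>v x\<bar>) powr e"
          using elim that by (intro powr_mono2) auto
        also have "\<dots> \<le> (1 - 1 / 2) * \<bar>u x\<bar> powr e + 1 / 2 * \<bar>v x\<bar> powr e"
          using that by (intro powr_convex_nonneg) auto
        finally show ?thesis by simp
      qed
      have "double_phase p q a x \<bar>w x\<bar> \<le> (\<bar>u x\<bar> powr p + \<bar>v x\<bar> powr p) / 2 + a x * ((\<bar>u x\<bar> powr q + \<bar>v x\<bar> powr q) / 2)"
        unfolding double_phase_def using e[OF pq(1)] e[OF pq(2)] elim by (intro add_mono mult_left_mono) auto
      also have "\<dots> = 1 / 2 * (double_phase p q a x \<bar>u x\<bar> + double_phase p q a x \<bar>v x\<bar>)"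
        by (simp add: double_phase_def algebra_simps add_divide_distrib)
      finally have "ennreal (double_phase p q a x \<bar>w x\<bar>) \<le> ennreal (1 / 2 * (double_phase p q a x \<bar>u x\<bar> + double_phase p q a x \<bar>v x\<bar>))"
        by (rule ennreal_leI)
      also have "\<dots> = ennreal (1 / 2) * (ennreal (double_phase p q a x \<bar>u x\<bar>) + ennreal (double_phase p q a x \<bar>v x\<bar>))"
        using elim(1) by (subst ennreal_mult') (auto simp: double_phase_nonneg ennreal_plus)
      finally show ?case .
    qed
  qed
  also have "\<dots> = ennreal (1 / 2) * (modular \<Omega> (double_phase p q a) u + modular \<Omega> (double_phase p q a) v)"
    unfolding modular_def double_phase_def by (subst nn_integral_cmult, measurable, subst nn_integral_add) auto
  also have "\<dots> \<le> ennreal (1 / 2) * (1 + 1)" using fin by (intro mult_left_mono add_mono) auto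
  also have "\<dots> = ennreal (1 / 2 * 2)" by (subst ennreal_mult') (auto simp: one_add_one)
  finally show ?thesis by simp
qed

lemma modular_parts:
  assumes a: "AE x in lebesgue_on \<Omega>. 0 \<le> a x" and m: "modular \<Omega> (double_phase p q a) u \<le> C"
  shows "(\<integral>\<^sup>+x. ennreal (\<bar>u x\<bar> powr p) \<partial>lebesgue_on \<Omega>) \<le> C" "(\<integral>\<^sup>+x. ennreal (a x * \<bar>u x\<bar> powr q) \<partial>lebesgue_on \<Omega>) \<le> C"
proof -
  have "(\<integral>\<^sup>+x. ennreal (\<bar>u x\<bar> powr p) \<partial>lebesgue_on \<Omega>) \<le> modular \<Omega> (double_phase p q a) u"
    unfolding modular_def
    by (rule nn_integral_mono_AE, use a in eventually_elim) (auto intro!: ennreal_leI simp: double_phase_def)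
  moreover have "(\<integral>\<^sup>+x. ennreal (a x * \<bar>u x\<bar> powr q) \<partial>lebesgue_on \<Omega>) \<le> modular \<Omega> (double_phase p q a) u"
    unfolding modular_def
    by (rule nn_integral_mono_AE, use a in eventually_elim) (auto intro!: ennreal_leI simp: double_phase_def)
  ultimately show "(\<integral>\<^sup>+x. ennreal (\<bar>u x\<bar> powr p) \<partial>lebesgue_on \<Omega>) \<le> C"
    "(\<integral>\<^sup>+x. ennreal (a x * \<bar>u x\<bar> powr q) \<partial>lebesgue_on \<Omega>) \<le> C" using m order_trans by blast+
qed

text \<open>Nonnegativity also rests on the witness \<tau>: without an admissible scale the infimum
  would be taken over the empty set.\<close>

lemma luxemburg_norm_le:
  assumes "0 < \<tau>" "modular \<Omega> \<phi> (\<lambda>x. u x / \<tau>) \<le> 1"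
  shows "luxemburg_norm \<Omega> \<phi> u \<le> \<tau>" "0 \<le> luxemburg_norm \<Omega> \<phi> u"
proof -
  let ?S = "{\<tau>. \<tau> > 0 \<and> modular \<Omega> \<phi> (\<lambda>x. u x / \<tau>) \<le> 1}"
  have "bdd_below ?S" by (rule bdd_belowI[of _ 0]) auto
  then show "luxemburg_norm \<Omega> \<phi> u \<le> \<tau>" unfolding luxemburg_norm_def by (rule cInf_lower[rotated]) (use assms in auto)
  show "0 \<le> luxemburg_norm \<Omega> \<phi> u" unfolding luxemburg_norm_def by (rule cInf_greatest) (use assms in auto)
qed

text \<open>For exponents at least 1 and \<tau> >= 1, both powers of 1/\<tau> are at most 1/\<tau>,
  so a single division brings a finite modular below 1.\<close>

lemma modular_finite_scaled:
  assumes pq: "1 \<le> p" "1 \<le> q" and a: "AE x in lebesgue_on \<Omega>. 0 \<le> a x" and am: "a \<in> borel_measurable (lebesgue_on \<Omega>)"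
    and u: "u \<in> borel_measurable (lebesgue_on \<Omega>)" and fin: "modular \<Omega> (double_phase p q a) u \<le> ennreal m" and \<tau>: "\<tau> \<ge> 1" "\<tau> \<ge> m"
  shows "modular \<Omega> (double_phase p q a) (\<lambda>x. u x / \<tau>) \<le> 1"
proof -
  have t: "(1 / \<tau>) powr e \<le> 1 / \<tau>" if "1 \<le> e" for e
    using powr_mono'[of 1 e "1 / \<tau>"] that \<tau> by simp
  have "modular \<Omega> (double_phase p q a) (\<lambda>x. 1 / \<tau> * u x) \<le> ennreal (1 / \<tau>) * modular \<Omega> (double_phase p q a) u"
    by (rule modular_cmult_le) (use assms t in auto)
  also have "\<dots> \<le> ennreal (1 / \<tau>) * ennreal \<tau>"
    by (intro mult_left_mono order_trans[OF fin] ennreal_leI \<tau>) simp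
  also have "\<dots> = 1" using \<tau> by (simp add: ennreal_mult'[symmetric])
  finally show ?thesis by simp
qed

text \<open>A finite modular guarantees an admissible scale, so the infimum is meaningful. Any l
  above the norm then exceeds some admissible scale, and monotonicity applies.\<close>

lemma luxemburg_norm_nonneg_and_less:
  assumes pq: "1 \<le> p" "1 \<le> q" and a: "AE x in lebesgue_on \<Omega>. 0 \<le> a x" and am: "a \<in> borel_measurable (lebesgue_on \<Omega>)"
    and u: "u \<in> borel_measurable (lebesgue_on \<Omega>)" and fin: "modular \<Omega> (double_phase p q a) u < \<infinity>"
  shows "0 \<le> luxemburg_norm \<Omega> (double_phase p q a) u"
    "luxemburg_norm \<Omega> (double_phase p q a) u < l \<Longrightarrow> modular \<Omega> (double_phase p q a) (\<lambda>x. u x / l) \<le> 1"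
proof -
  let ?S = "{\<tau>. \<tau> > 0 \<and> modular \<Omega> (double_phase p q a) (\<lambda>x. u x / \<tau>) \<le> 1}"
  obtain m where m: "modular \<Omega> (double_phase p q a) u = ennreal m" using fin by (cases "modular \<Omega> (double_phase p q a) u") auto
  have mx: "modular \<Omega> (double_phase p q a) (\<lambda>x. u x / max 1 m) \<le> 1"
    by (rule modular_finite_scaled[OF pq a am u]) (use m in auto)
  then show "0 \<le> luxemburg_norm \<Omega> (double_phase p q a) u" by (intro luxemburg_norm_le(2)) auto
  assume "luxemburg_norm \<Omega> (double_phase p q a) u < l"
  moreover have "?S \<noteq> {}"
  proof -
    have "max 1 m \<in> ?S" using mx by auto
    then show ?thesis by blast
  qed
  ultimately obtain \<tau> where \<tau>: "0 < \<tau>" "\<tau> < l" "modular \<Omega> (double_phase p q a) (\<lambda>x. u x / \<tau>) \<le> 1"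
    unfolding luxemburg_norm_def using cInf_lessD[of ?S l] by blast
  have "modular \<Omega> (double_phase p q a) (\<lambda>x. u x / l) \<le> modular \<Omega> (double_phase p q a) (\<lambda>x. u x / \<tau>)"
    by (rule modular_mono) (use pq a \<tau> in \<open>auto simp: divide_left_mono\<close>)
  with \<tau>(3) show "modular \<Omega> (double_phase p q a) (\<lambda>x. u x / l) \<le> 1" by (rule order_trans[rotated])
qed

lemma modular_cong_AE:
  assumes "AE x in lebesgue_on \<Omega>. u x = v x"
  shows "modular \<Omega> \<phi> u = modular \<Omega> \<phi> v"
  unfolding modular_def by (rule nn_integral_cong_AE) (use assms in eventually_elim, simp)

lemma luxemburg_norm_cong_AE:
  assumes "AE x in lebesgue_on \<Omega>. u x = v x"
  shows "luxemburg_norm \<Omega> \<phi> u = luxemburg_norm \<Omega> \<phi> v"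
proof -
  have "modular \<Omega> \<phi> (\<lambda>x. u x / \<tau>) = modular \<Omega> \<phi> (\<lambda>x. v x / \<tau>)" for \<tau>
    by (rule modular_cong_AE) (use assms in eventually_elim, simp)
  then show ?thesis by (simp add: luxemburg_norm_def)
qed

text \<open>A weak gradient comes with local integrability only; its measurability is glued together
  from countably many closed boxes.\<close>

lemma locally_integrable_measurable:
  fixes f :: "'a::euclidean_space \<Rightarrow> 'b::euclidean_space"
  assumes \<Omega>: "open \<Omega>" and f: "locally_integrable \<Omega> f"
  shows "f \<in> borel_measurable (lebesgue_on \<Omega>)"
proof -
  obtain \<D> where \<D>: "countable \<D>" "\<D> \<subseteq> Pow \<Omega>" "\<And>X. X \<in> \<D> \<Longrightarrow> \<exists>a b. X = cbox a b" "\<Union>\<D> = \<Omega>"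
    using open_countable_Union_open_cbox[OF \<Omega>] by metis
  show ?thesis
  proof (rule measurable_piecewise_restrict[OF \<D>(1)])
    fix X assume X: "X \<in> \<D>"
    then obtain a b where ab: "X = cbox a b" using \<D>(3) by blast
    have sub: "X \<subseteq> \<Omega>" using X \<D>(2) by blast
    have sl: "X \<in> sets lebesgue" "\<Omega> \<in> sets lebesgue" using ab \<Omega> by auto
    show "X \<inter> space (lebesgue_on \<Omega>) \<in> sets (lebesgue_on \<Omega>)"
      using sl sub by (auto simp: sets_restrict_space space_restrict_space)
    have "integrable lebesgue (\<lambda>x. indicator X x *\<^sub>R f x)"
      using f sub unfolding locally_integrable_def set_integrable_def ab by auto
    then have "f \<in> borel_measurable (lebesgue_on X)"
      using sl by (intro borel_measurable_integrable) (simp add: integrable_restrict_space)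
    moreover have "restrict_space (lebesgue_on \<Omega>) X = lebesgue_on X"
      using sub sl by (subst restrict_restrict_space) (auto simp: Int_absorb1)
    ultimately show "f \<in> borel_measurable (restrict_space (lebesgue_on \<Omega>) X)" by simp
  qed (use \<D> in auto)
qed

lemma C1_supp_measurable_lebesgue_on:
  assumes "C1_supp \<Omega> f"
  shows "f \<in> borel_measurable (lebesgue_on \<Omega>)" "grad f \<in> borel_measurable (lebesgue_on \<Omega>)"
  using C1_supp_measurable[OF assms] by (auto intro!: measurable_restrict_space1 measurable_completion)

section \<open>Integration over the domain, and limit theorems\<close>

lemma nn_integral_lebesgue_on_eq:
  fixes F :: "'a::euclidean_space \<Rightarrow> ennreal"
  assumes "open \<Omega>" "\<And>x. x \<in> \<Omega> \<Longrightarrow> F x = H x" "\<And>x. x \<notin> \<Omega> \<Longrightarrow> H x = 0"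
  shows "(\<integral>\<^sup>+x. F x \<partial>lebesgue_on \<Omega>) = (\<integral>\<^sup>+x. H x \<partial>lborel)"
proof -
  have "(\<integral>\<^sup>+x. F x \<partial>lebesgue_on \<Omega>) = (\<integral>\<^sup>+x. F x * indicator \<Omega> x \<partial>lebesgue)"
    using assms(1) by (intro nn_integral_restrict_space) auto
  also have "\<dots> = (\<integral>\<^sup>+x. H x \<partial>lebesgue)"
    using assms(2,3) by (intro nn_integral_cong) (auto simp: indicator_def)
  finally show ?thesis by (simp add: nn_integral_completion)
qed

lemma emeasure_lebesgue_on_finite:
  assumes "open \<Omega>" "bounded \<Omega>"
  shows "finite_measure (lebesgue_on \<Omega>)"
proof
  have "emeasure lborel \<Omega> < \<infinity>" using assms by (intro emeasure_bounded_finite)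
  then show "emeasure (lebesgue_on \<Omega>) (space (lebesgue_on \<Omega>)) \<noteq> \<infinity>"
    using assms by (simp add: emeasure_restrict_space space_restrict_space)
qed

text \<open>The factor 2^k makes the p-th power integrals of \<open>w k\<close> summable, so the
  series of p-th powers is finite almost everywhere and the full sequence tends to 0, without
  passing to a subsequence.\<close>

lemma AE_tendsto_0_of_summable:
  assumes p: "1 \<le> p" and w: "\<And>k. w k \<in> borel_measurable M"
    and I: "\<And>k. (\<integral>\<^sup>+x. ennreal (\<bar>2 ^ k * w k x\<bar> powr p) \<partial>M) \<le> 1"
  shows "AE x in M. (\<lambda>k. w k x) \<longlonglongrightarrow> (0::real)"
proof -
  note [measurable] = w
  have le: "(\<integral>\<^sup>+x. ennreal (\<bar>w k x\<bar> powr p) \<partial>M) \<le> ennreal ((1 / 2) ^ k)" for k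
  proof -
    have "\<bar>w k x\<bar> powr p \<le> (1 / 2) ^ k * \<bar>2 ^ k * w k x\<bar> powr p" for x
    proof -
      have "\<bar>w k x\<bar> powr p = \<bar>(1 / 2) ^ k * (2 ^ k * w k x)\<bar> powr p" by (simp add: power_divide)
      also have "\<dots> = ((1 / 2) ^ k) powr p * \<bar>2 ^ k * w k x\<bar> powr p" by (simp add: abs_mult powr_mult)
      also have "((1 / 2 :: real) ^ k) powr p \<le> ((1 / 2) ^ k) powr 1"
        using p by (intro powr_mono') (auto simp: power_le_one)
      finally show ?thesis by (simp add: mult_right_mono)
    qed
    then have "(\<integral>\<^sup>+x. ennreal (\<bar>w k x\<bar> powr p) \<partial>M) \<le> (\<integral>\<^sup>+x. ennreal ((1 / 2) ^ k) * ennreal (\<bar>2 ^ k * w k x\<bar> powr p) \<partial>M)"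
      by (intro nn_integral_mono) (simp add: ennreal_mult'[symmetric] ennreal_leI)
    also have "\<dots> = ennreal ((1 / 2) ^ k) * (\<integral>\<^sup>+x. ennreal (\<bar>2 ^ k * w k x\<bar> powr p) \<partial>M)"
      by (rule nn_integral_cmult) measurable
    also have "\<dots> \<le> ennreal ((1 / 2) ^ k) * 1" by (intro mult_left_mono I) simp
    finally show ?thesis by simp
  qed
  have "(\<integral>\<^sup>+x. (\<Sum>k. ennreal (\<bar>w k x\<bar> powr p)) \<partial>M) = (\<Sum>k. \<integral>\<^sup>+x. ennreal (\<bar>w k x\<bar> powr p) \<partial>M)"
    by (rule nn_integral_suminf) measurable
  also have "\<dots> \<le> (\<Sum>k. ennreal ((1 / 2) ^ k))" by (intro suminf_le le) auto
  also have "\<dots> < \<infinity>" by (subst suminf_ennreal2) (auto intro: summable_geometric)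
  finally have fin: "(\<integral>\<^sup>+x. (\<Sum>k. ennreal (\<bar>w k x\<bar> powr p)) \<partial>M) \<noteq> \<infinity>" by simp
  have "AE x in M. (\<Sum>k. ennreal (\<bar>w k x\<bar> powr p)) \<noteq> \<infinity>"
    by (rule nn_integral_PInf_AE[OF _ fin]) measurable
  then show ?thesis
  proof eventually_elim
    case (elim x)
    then have "summable (\<lambda>k. \<bar>w k x\<bar> powr p)"
      by (intro summable_suminf_not_top) auto
    then have "(\<lambda>k. \<bar>w k x\<bar> powr p) \<longlonglongrightarrow> 0" by (rule summable_LIMSEQ_zero)
    then have "(\<lambda>k. (\<bar>w k x\<bar> powr p) powr (1 / p)) \<longlonglongrightarrow> 0 powr (1 / p)"
      by (rule tendsto_powr2) (use p in auto)
    then have "(\<lambda>k. \<bar>w k x\<bar>) \<longlonglongrightarrow> 0" using p by (simp add: powr_powr)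
    then show ?case by (simp add: tendsto_rabs_zero_iff)
  qed
qed

text \<open>Fatou's lemma, with the limit inferior identified by the almost everywhere
  convergence.\<close>

lemma nn_integral_le_of_AE_tendsto:
  assumes h: "\<And>k. h k \<in> borel_measurable M" and lim: "AE x in M. (\<lambda>k. h k x) \<longlonglongrightarrow> (g x :: real)"
    and I: "\<And>k. (\<integral>\<^sup>+x. ennreal (h k x) \<partial>M) \<le> C"
  shows "(\<integral>\<^sup>+x. ennreal (g x) \<partial>M) \<le> C"
proof -
  note [measurable] = h
  have "(\<integral>\<^sup>+x. ennreal (g x) \<partial>M) = (\<integral>\<^sup>+x. liminf (\<lambda>k. ennreal (h k x)) \<partial>M)"
  proof (rule nn_integral_cong_AE, use lim in eventually_elim)
    case (elim x)
    then have "(\<lambda>k. ennreal (h k x)) \<longlonglongrightarrow> ennreal (g x)" by (rule tendsto_ennrealI)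
    then show ?case by (simp add: lim_imp_Liminf)
  qed
  also have "\<dots> \<le> liminf (\<lambda>k. \<integral>\<^sup>+x. ennreal (h k x) \<partial>M)" by (rule nn_integral_liminf) measurable
  also have "\<dots> \<le> C" by (rule Liminf_le) (use I in auto)
  finally show ?thesis .
qed

text \<open>Interpolation by truncation: below the level \<Lambda> dominated convergence applies
  since the measure is finite, and above it h^t <= \<Lambda>^(t - t') h^t' makes the tail small
  uniformly in k.\<close>

lemma powr_integral_tendsto_0:
  assumes M: "finite_measure M" and h: "\<And>k. h k \<in> borel_measurable M" and h0: "\<And>k x. 0 \<le> h k x"
    and lim: "AE x in M. (\<lambda>k. h k x) \<longlonglongrightarrow> (0::real)" and t: "0 < t" "t < t'"
    and I: "\<And>k. (\<integral>\<^sup>+x. ennreal (h k x powr t') \<partial>M) \<le> ennreal C" and \<eta>: "\<eta> > 0"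
  shows "\<forall>\<^sub>F k in sequentially. (\<integral>\<^sup>+x. ennreal (h k x powr t) \<partial>M) \<le> ennreal \<eta>"
proof -
  interpret finite_measure M by fact
  note [measurable] = h
  define C' where "C' = max C 1"
  \<comment> \<open>The exponent t - t' is negative, so this level grows as \<eta> shrinks; it makes
    the tail at most \<eta> / 2.\<close>
  define \<Lambda> where "\<Lambda> = max 1 ((\<eta> / 2 / C') powr (1 / (t - t')))"
  have L: "\<Lambda> \<ge> 1" by (simp add: \<Lambda>_def)
  have C': "C' > 0" by (simp add: C'_def)
  have "\<Lambda> powr (t - t') \<le> ((\<eta> / 2 / C') powr (1 / (t - t'))) powr (t - t')"
    using t \<eta> C' by (intro powr_mono2') (auto simp: \<Lambda>_def)
  also have "\<dots> = \<eta> / 2 / C'" using t \<eta> C' by (simp add: powr_powr)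
  finally have LC: "\<Lambda> powr (t - t') * C' \<le> \<eta> / 2" using C' by (simp add: field_simps)
  have pw: "h k x powr t \<le> min (h k x) \<Lambda> powr t + \<Lambda> powr (t - t') * h k x powr t'" for k x
  proof (cases "h k x \<le> \<Lambda>")
    case False
    then have hp: "h k x > 0" "\<Lambda> \<le> h k x" using L by auto
    have "h k x powr t = h k x powr (t - t') * h k x powr t'" using hp by (simp add: powr_add[symmetric])
    also have "\<dots> \<le> \<Lambda> powr (t - t') * h k x powr t'"
      using t hp L by (intro mult_right_mono powr_mono2') auto
    finally show ?thesis by (simp add: add_increasing)
  qed simp
  have "(\<lambda>k. \<integral>\<^sup>+x. ennreal (min (h k x) \<Lambda> powr t) \<partial>M) \<longlonglongrightarrow> (\<integral>\<^sup>+x. 0 \<partial>M)"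
  proof (rule nn_integral_dominated_convergence[where w="\<lambda>x. ennreal (\<Lambda> powr t)"])
    show "AE x in M. ennreal (min (h k x) \<Lambda> powr t) \<le> ennreal (\<Lambda> powr t)" for k
      using t L h0 by (intro AE_I2 ennreal_leI powr_mono2) auto
    show "(\<integral>\<^sup>+x. ennreal (\<Lambda> powr t) \<partial>M) < \<infinity>"
      by (simp add: emeasure_eq_measure ennreal_mult'[symmetric])
    show "AE x in M. (\<lambda>k. ennreal (min (h k x) \<Lambda> powr t)) \<longlonglongrightarrow> 0"
      using lim
    proof eventually_elim
      case (elim x)
      have "(\<lambda>k. min (h k x) \<Lambda>) \<longlonglongrightarrow> min 0 \<Lambda>" using elim by (intro tendsto_intros)
      then have "(\<lambda>k. min (h k x) \<Lambda> powr t) \<longlonglongrightarrow> min 0 \<Lambda> powr t"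
        by (rule tendsto_powr2) (use t h0 L in \<open>auto simp: always_eventually\<close>)
      then have "(\<lambda>k. min (h k x) \<Lambda> powr t) \<longlonglongrightarrow> 0" using L t by simp
      then show ?case using tendsto_ennrealI by force
    qed
  qed measurable
  then have "\<forall>\<^sub>F k in sequentially. (\<integral>\<^sup>+x. ennreal (min (h k x) \<Lambda> powr t) \<partial>M) < ennreal (\<eta> / 2)"
    by (rule order_tendstoD(2)) (use \<eta> in simp)
  then show ?thesis
  proof eventually_elim
    case (elim k)
    have "(\<integral>\<^sup>+x. ennreal (h k x powr t) \<partial>M)
        \<le> (\<integral>\<^sup>+x. ennreal (min (h k x) \<Lambda> powr t) + ennreal (\<Lambda> powr (t - t')) * ennreal (h k x powr t') \<partial>M)"
      using pw by (intro nn_integral_mono) (simp add: ennreal_mult'[symmetric] ennreal_plus[symmetric] ennreal_leI del: ennreal_plus)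
    also have "\<dots> = (\<integral>\<^sup>+x. ennreal (min (h k x) \<Lambda> powr t) \<partial>M) + ennreal (\<Lambda> powr (t - t')) * (\<integral>\<^sup>+x. ennreal (h k x powr t') \<partial>M)"
      by (simp add: nn_integral_add nn_integral_cmult)
    also have "\<dots> \<le> ennreal (\<eta> / 2) + ennreal (\<Lambda> powr (t - t')) * ennreal C'"
      using elim by (intro add_mono mult_left_mono order_trans[OF I] ennreal_leI) (auto simp: C'_def)
    also have "\<dots> \<le> ennreal (\<eta> / 2) + ennreal (\<eta> / 2)"
      using LC C' by (intro add_left_mono) (simp add: ennreal_mult'[symmetric] ennreal_leI)
    also have "\<dots> = ennreal \<eta>" using \<eta> by (simp add: ennreal_plus[symmetric] del: ennreal_plus)
    finally show ?case .
  qed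
qed

section \<open>The compact embedding\<close>

text \<open>The Hoelder exponent \<alpha> is left free: its relation to p and q enters only with the
  Sobolev bounds, not with approximation and compactness.\<close>

locale double_phase_domain =
  fixes \<Omega> :: "'a::euclidean_space set" and a :: "'a \<Rightarrow> real" and p q \<alpha> K :: real
  assumes open_domain: "open \<Omega>" and bounded_domain: "bounded \<Omega>"
    and exponents: "1 < p" "p < q" "0 < \<alpha>"
    and weight_measurable: "a \<in> borel_measurable (lebesgue_on \<Omega>)"
    and weight_nonneg: "\<And>x. x \<in> \<Omega> \<Longrightarrow> 0 \<le> a x"
    and weight_holder: "0 \<le> K" "\<And>x y. x \<in> \<Omega> \<Longrightarrow> y \<in> \<Omega> \<Longrightarrow> \<bar>a x - a y\<bar> \<le> K * dist x y powr \<alpha>"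
begin

abbreviation \<A> :: "'a \<Rightarrow> real \<Rightarrow> real" where "\<A> \<equiv> double_phase p q a"

abbreviation unit_gradient :: "('a \<Rightarrow> real) \<Rightarrow> bool" where
  "unit_gradient g \<equiv> (\<integral>\<^sup>+x. ennreal (norm (grad g x) powr p) \<partial>lborel) \<le> 1 \<and>
     (\<integral>\<^sup>+x. ennreal ((indicator \<Omega> x * a x) * norm (grad g x) powr q) \<partial>lborel) \<le> 1"

lemma space_domain [simp]: "space (lebesgue_on \<Omega>) = \<Omega>"
  by (simp add: space_restrict_space)

lemma AE_weight_nonneg: "AE x in lebesgue_on \<Omega>. 0 \<le> a x"
  by (rule AE_I2) (simp add: weight_nonneg)

lemma finite_measure_domain: "finite_measure (lebesgue_on \<Omega>)"
  using emeasure_lebesgue_on_finite open_domain bounded_domain .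

lemma exponents_ge_1: "1 \<le> p" "1 \<le> q" "0 < p" "0 < q"
  using exponents by auto

lemma weight_bounded: obtains A where "0 \<le> A" "\<And>x. x \<in> \<Omega> \<Longrightarrow> a x \<le> A"
proof (cases "\<Omega> = {}")
  case False
  then obtain x0 where x0: "x0 \<in> \<Omega>" by blast
  have A: "a x \<le> a x0 + K * diameter \<Omega> powr \<alpha>" if "x \<in> \<Omega>" for x
  proof -
    have "dist x x0 \<le> diameter \<Omega>" using diameter_bounded_bound bounded_domain x0 that by blast
    then have "K * dist x x0 powr \<alpha> \<le> K * diameter \<Omega> powr \<alpha>"
      using weight_holder(1) exponents by (intro mult_left_mono powr_mono2) auto
    then show ?thesis using weight_holder(2)[OF that x0] by simp
  qed
  show ?thesis
    by (rule that[of "a x0 + K * diameter \<Omega> powr \<alpha>"]) (use A weight_nonneg[OF x0] weight_holder(1) in auto)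
qed (auto intro: that[of 0])

text \<open>The averaging estimates use Borel weights, while a is given as Lebesgue measurable on
  the domain. Hoelder continuity supplies the Borel version, and the indicator removes the arbitrary
  values outside.\<close>

lemma restricted_weight_measurable: "(\<lambda>x. indicator \<Omega> x * a x) \<in> borel_measurable borel"
proof -
  have "continuous_on \<Omega> a"
    unfolding continuous_on_def
  proof
    fix x assume x: "x \<in> \<Omega>"
    have "((\<lambda>y. K * dist y x powr \<alpha>) \<longlongrightarrow> K * 0 powr \<alpha>) (at x within \<Omega>)"
      by (intro tendsto_intros tendsto_powr2)
         (use exponents in \<open>auto intro!: always_eventually tendsto_eq_intros\<close>)
    then have "((\<lambda>y. K * dist y x powr \<alpha>) \<longlongrightarrow> 0) (at x within \<Omega>)" using exponents by simp
    moreover have "\<forall>\<^sub>F y in at x within \<Omega>. norm (a y - a x) \<le> K * dist y x powr \<alpha>"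
      using weight_holder(2) x by (auto simp: eventually_at_filter)
    ultimately have "((\<lambda>y. a y - a x) \<longlongrightarrow> 0) (at x within \<Omega>)" by (rule Lim_null_comparison[rotated])
    then show "(a \<longlongrightarrow> a x) (at x within \<Omega>)" by (simp add: LIM_zero_iff)
  qed
  then have "(\<lambda>x. indicator \<Omega> x *\<^sub>R a x) \<in> borel_measurable borel"
    using open_domain by (intro borel_measurable_continuous_on_indicator) auto
  then show ?thesis by simp
qed

section \<open>Approximation by test functions, and almost everywhere convergent
  subsequences\<close>

lemma modular_bounded_finite:
  assumes "\<And>x. x \<in> \<Omega> \<Longrightarrow> \<bar>w x\<bar> \<le> B"
  shows "modular \<Omega> \<A> w < \<infinity>"
proof -
  interpret finite_measure "lebesgue_on \<Omega>" by (rule finite_measure_domain)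
  obtain A where A: "0 \<le> A" "\<And>x. x \<in> \<Omega> \<Longrightarrow> a x \<le> A" using weight_bounded by blast
  have "modular \<Omega> \<A> w \<le> (\<integral>\<^sup>+x. ennreal (B powr p + A * B powr q) \<partial>lebesgue_on \<Omega>)"
    unfolding modular_def double_phase_def
    using assms A weight_nonneg exponents by (intro nn_integral_mono ennreal_leI add_mono mult_mono powr_mono2) auto
  also have "\<dots> < \<infinity>" by (simp only: nn_integral_const) (simp add: emeasure_eq_measure ennreal_mult_less_top)
  finally show ?thesis .
qed

text \<open>The function f is taken within min \<epsilon> \<theta> of u: \<epsilon> controls the
  values, \<theta> the gradients. As \<open>G\<close> and \<open>G - grad f\<close> both lie in the
  modular unit ball at scale \<theta>, midpoint convexity puts \<open>grad f\<close> there at scale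
  2 \<theta>.\<close>

lemma test_function_approx:
  assumes u: "u \<in> musielak_sobolev_space_0 \<Omega> \<A>" and l: "musielak_sobolev_norm \<Omega> \<A> u < \<theta>" and \<epsilon>: "0 < \<epsilon>"
  shows "0 < \<theta>" "\<exists>f\<in>test_functions \<Omega>. modular \<Omega> \<A> (\<lambda>x. (u x - f x) / \<epsilon>) \<le> 1 \<and>
     modular \<Omega> \<A> (\<lambda>x. norm (grad f x) / (2 * \<theta>)) \<le> 1"
proof -
  note pre = exponents_ge_1(1,2) AE_weight_nonneg weight_measurable
  obtain G where um: "u \<in> borel_measurable (lebesgue_on \<Omega>)" "modular \<Omega> \<A> u < \<infinity>"
    and G: "has_weak_gradient \<Omega> u G" "modular \<Omega> \<A> (\<lambda>x. norm (G x)) < \<infinity>"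
    using u unfolding musielak_sobolev_space_0_def musielak_sobolev_space_def musielak_space_def by blast
  have Gm: "G \<in> borel_measurable (lebesgue_on \<Omega>)"
    using G(1) locally_integrable_measurable[OF open_domain] unfolding has_weak_gradient_def by blast
  note [measurable] = um(1) Gm
  have norm_u: "musielak_sobolev_norm \<Omega> \<A> u = luxemburg_norm \<Omega> \<A> u + luxemburg_norm \<Omega> \<A> (\<lambda>x. norm (G x))"
  proof -
    have "AE x in lebesgue_on \<Omega>. norm (weak_gradient \<Omega> u x) = norm (G x)"
      using AE_weak_gradient[OF open_domain G(1)] by eventually_elim simp
    then show ?thesis unfolding musielak_sobolev_norm_def by (simp only: luxemburg_norm_cong_AE)
  qed
  have nu: "0 \<le> luxemburg_norm \<Omega> \<A> u" by (rule luxemburg_norm_nonneg_and_less(1)[OF pre um])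
  have nG: "0 \<le> luxemburg_norm \<Omega> \<A> (\<lambda>x. norm (G x))"
    by (rule luxemburg_norm_nonneg_and_less(1)[OF pre _ G(2)]) measurable
  show l0: "0 < \<theta>" using nu nG l norm_u by simp
  have mG: "modular \<Omega> \<A> (\<lambda>x. norm (G x) / \<theta>) \<le> 1"
    by (rule luxemburg_norm_nonneg_and_less(2)[OF pre _ G(2)]) (use nu l norm_u in auto)
  have "0 < min \<epsilon> \<theta>" using \<epsilon> l0 by simp
  then obtain f where f: "f \<in> test_functions \<Omega>" "musielak_sobolev_norm \<Omega> \<A> (\<lambda>x. u x - f x) < min \<epsilon> \<theta>"
    using u unfolding musielak_sobolev_space_0_def by blast
  have fC: "C1_supp \<Omega> f" by (rule test_functions_C1_supp[OF f(1)])
  note [measurable] = C1_supp_measurable_lebesgue_on[OF fC]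
  obtain B1 where B1: "\<And>x. norm (f x) \<le> B1" using C1_supp_bounded[OF fC] by blast
  obtain B2 where B2: "\<And>x. norm (grad f x) \<le> B2" using C1_supp_bounded_grad[OF fC] by blast
  \<comment> \<open>Finite modulars make both Luxemburg norms of the difference nonnegative, so a
    bound on their sum bounds each of them.\<close>
  have fin1: "modular \<Omega> \<A> (\<lambda>x. u x - f x) < \<infinity>"
    by (rule modular_add_le[OF exponents_ge_1(3,4) pre(3,4) um(1) _ _ um(2) modular_bounded_finite[where w=f and B=B1]])
       (use B1 in \<open>auto simp: abs_triangle_ineq4\<close>)
  have fin2: "modular \<Omega> \<A> (\<lambda>x. norm (G x - grad f x)) < \<infinity>"
    by (rule modular_add_le[OF exponents_ge_1(3,4) pre(3,4) _ _ _ G(2) modular_bounded_finite[where w="\<lambda>x. norm (grad f x)" and B=B2]])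
       (use B2 in \<open>auto simp: norm_triangle_ineq4\<close>)
  have norm_d: "musielak_sobolev_norm \<Omega> \<A> (\<lambda>x. u x - f x)
      = luxemburg_norm \<Omega> \<A> (\<lambda>x. u x - f x) + luxemburg_norm \<Omega> \<A> (\<lambda>x. norm (G x - grad f x))"
  proof -
    have "AE x in lebesgue_on \<Omega>. norm (weak_gradient \<Omega> (\<lambda>x. u x - f x) x) = norm (G x - grad f x)"
      using AE_weak_gradient_diff[OF open_domain G(1) f(1)] by eventually_elim simp
    then show ?thesis unfolding musielak_sobolev_norm_def by (simp only: luxemburg_norm_cong_AE)
  qed
  have n1: "0 \<le> luxemburg_norm \<Omega> \<A> (\<lambda>x. u x - f x)"
    by (rule luxemburg_norm_nonneg_and_less(1)[OF pre _ fin1]) measurable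
  have n2: "0 \<le> luxemburg_norm \<Omega> \<A> (\<lambda>x. norm (G x - grad f x))"
    by (rule luxemburg_norm_nonneg_and_less(1)[OF pre _ fin2]) measurable
  have m1: "modular \<Omega> \<A> (\<lambda>x. (u x - f x) / \<epsilon>) \<le> 1"
    by (rule luxemburg_norm_nonneg_and_less(2)[OF pre _ fin1]) (use n2 f(2) norm_d in auto)
  have m2: "modular \<Omega> \<A> (\<lambda>x. norm (G x - grad f x) / \<theta>) \<le> 1"
    by (rule luxemburg_norm_nonneg_and_less(2)[OF pre _ fin2]) (use n1 f(2) norm_d in auto)
  have "modular \<Omega> \<A> (\<lambda>x. norm (grad f x) / (2 * \<theta>)) \<le> 1"
  proof (rule modular_midpoint_le_1[OF pre _ _ _ mG m2])
    show "AE x in lebesgue_on \<Omega>. \<bar>norm (grad f x) / (2 * \<theta>)\<bar> \<le> (\<bar>norm (G x) / \<theta>\<bar> + \<bar>norm (G x - grad f x) / \<theta>\<bar>) / 2"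
    proof (rule AE_I2)
      fix x
      have "norm (grad f x) \<le> norm (G x) + norm (G x - grad f x)"
        using norm_triangle_ineq4[of "G x" "G x - grad f x"] by simp
      then show "\<bar>norm (grad f x) / (2 * \<theta>)\<bar> \<le> (\<bar>norm (G x) / \<theta>\<bar> + \<bar>norm (G x - grad f x) / \<theta>\<bar>) / 2"
        using l0 by (simp add: field_simps)
    qed
  qed measurable
  with m1 f(1) show "\<exists>f\<in>test_functions \<Omega>. modular \<Omega> \<A> (\<lambda>x. (u x - f x) / \<epsilon>) \<le> 1 \<and>
     modular \<Omega> \<A> (\<lambda>x. norm (grad f x) / (2 * \<theta>)) \<le> 1" by blast
qed

lemma unit_gradient_scaled:
  assumes f: "C1_supp \<Omega> f" and l: "0 < \<theta>" and m: "modular \<Omega> \<A> (\<lambda>x. norm (grad f x) / (2 * \<theta>)) \<le> 1"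
  shows "unit_gradient (\<lambda>x. 1 / (2 * \<theta>) * f x)"
proof -
  note F = C1_suppD[OF f]
  have ng: "norm (grad (\<lambda>x. 1 / (2 * \<theta>) * f x) x) = norm (grad f x) / (2 * \<theta>)" for x
    unfolding C1_supp_cmult(2)[OF f] using l by simp
  have e1: "(\<integral>\<^sup>+x. ennreal (\<bar>norm (grad f x) / (2 * \<theta>)\<bar> powr p) \<partial>lebesgue_on \<Omega>)
      = (\<integral>\<^sup>+x. ennreal ((norm (grad f x) / (2 * \<theta>)) powr p) \<partial>lborel)"
    by (rule nn_integral_lebesgue_on_eq[OF open_domain]) (use l F in auto)
  have e2: "(\<integral>\<^sup>+x. ennreal (a x * \<bar>norm (grad f x) / (2 * \<theta>)\<bar> powr q) \<partial>lebesgue_on \<Omega>)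
      = (\<integral>\<^sup>+x. ennreal ((indicator \<Omega> x * a x) * (norm (grad f x) / (2 * \<theta>)) powr q) \<partial>lborel)"
    by (rule nn_integral_lebesgue_on_eq[OF open_domain]) (use l F in auto)
  show ?thesis
    using modular_parts[OF AE_weight_nonneg m] unfolding e1 e2 ng by blast
qed

text \<open>Each member gets one approximant with error 2^(-k), so that the differences vanish
  almost everywhere along the full sequence.\<close>

lemma exists_approximants:
  assumes v: "\<And>k::nat. v k \<in> musielak_sobolev_space_0 \<Omega> \<A>" and l: "\<And>k. musielak_sobolev_norm \<Omega> \<A> (v k) < \<theta>"
  obtains f where "\<And>k. C1_supp \<Omega> (f k)" "\<And>k. unit_gradient (\<lambda>x. 1 / (2 * \<theta>) * f k x)"
    "AE x in lebesgue_on \<Omega>. (\<lambda>k. v k x - f k x) \<longlonglongrightarrow> 0"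
proof -
  have l0: "0 < \<theta>" using test_function_approx(1)[OF v l, of 1] by simp
  have "\<forall>k. \<exists>f. f \<in> test_functions \<Omega> \<and> modular \<Omega> \<A> (\<lambda>x. (v k x - f x) / (1 / 2 ^ k)) \<le> 1 \<and>
     modular \<Omega> \<A> (\<lambda>x. norm (grad f x) / (2 * \<theta>)) \<le> 1"
    unfolding Bex_def[symmetric] by (intro allI test_function_approx(2)[OF v l]) simp
  then obtain f where "\<forall>k. f k \<in> test_functions \<Omega> \<and> modular \<Omega> \<A> (\<lambda>x. (v k x - f k x) / (1 / 2 ^ k)) \<le> 1 \<and>
     modular \<Omega> \<A> (\<lambda>x. norm (grad (f k) x) / (2 * \<theta>)) \<le> 1"
    by (rule choice[THEN exE])
  then have f: "\<And>k. f k \<in> test_functions \<Omega>"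
    "\<And>k. modular \<Omega> \<A> (\<lambda>x. (v k x - f k x) / (1 / 2 ^ k)) \<le> 1"
    "\<And>k. modular \<Omega> \<A> (\<lambda>x. norm (grad (f k) x) / (2 * \<theta>)) \<le> 1" by blast+
  have fC: "C1_supp \<Omega> (f k)" for k by (rule test_functions_C1_supp[OF f(1)])
  show thesis
  proof (rule that[OF fC unit_gradient_scaled[OF fC l0 f(3)]])
    show "AE x in lebesgue_on \<Omega>. (\<lambda>k. v k x - f k x) \<longlonglongrightarrow> 0"
    proof (rule AE_tendsto_0_of_summable[OF exponents_ge_1(1)])
      fix k
      have "v k \<in> borel_measurable (lebesgue_on \<Omega>)"
        using v[of k] unfolding musielak_sobolev_space_0_def musielak_sobolev_space_def musielak_space_def by blast
      then show "(\<lambda>x. v k x - f k x) \<in> borel_measurable (lebesgue_on \<Omega>)"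
        using C1_supp_measurable_lebesgue_on[OF fC] by measurable
      show "(\<integral>\<^sup>+x. ennreal (\<bar>2 ^ k * (v k x - f k x)\<bar> powr p) \<partial>lebesgue_on \<Omega>) \<le> 1"
        using modular_parts(1)[OF AE_weight_nonneg f(2)[of k]] by (simp add: mult.commute)
    qed
  qed
qed

text \<open>The approximants of u, divided by 2 \<theta>, have unit gradient, so Fatou's lemma
  carries any uniform bound to u. They are obtained from the constant sequence u.\<close>

lemma extend_bound:
  assumes b: "b \<in> borel_measurable (lebesgue_on \<Omega>)" and b0: "\<And>x. 0 \<le> b x" and t: "0 < t"
    and H: "\<And>g. C1_supp \<Omega> g \<Longrightarrow> unit_gradient g \<Longrightarrow>
      (\<integral>\<^sup>+x. ennreal ((b x * \<bar>g x\<bar>) powr t) \<partial>lebesgue_on \<Omega>) \<le> C"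
    and u: "u \<in> musielak_sobolev_space_0 \<Omega> \<A>" and l: "musielak_sobolev_norm \<Omega> \<A> u < \<theta>"
  shows "(\<integral>\<^sup>+x. ennreal ((b x * \<bar>u x / (2 * \<theta>)\<bar>) powr t) \<partial>lebesgue_on \<Omega>) \<le> C"
proof -
  obtain f where f: "\<And>k. C1_supp \<Omega> (f k)" "\<And>k. unit_gradient (\<lambda>x. 1 / (2 * \<theta>) * f k x)"
    "AE x in lebesgue_on \<Omega>. (\<lambda>k. u x - f k x) \<longlonglongrightarrow> 0"
    by (rule exists_approximants[of "\<lambda>_. u" \<theta>, OF u l]) (rule that)
  note [measurable] = b C1_supp_measurable_lebesgue_on[OF f(1)]
  show ?thesis
  proof (rule nn_integral_le_of_AE_tendsto)
    show "(\<lambda>x. (b x * \<bar>1 / (2 * \<theta>) * f k x\<bar>) powr t) \<in> borel_measurable (lebesgue_on \<Omega>)" for k by measurable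
    show "(\<integral>\<^sup>+x. ennreal ((b x * \<bar>1 / (2 * \<theta>) * f k x\<bar>) powr t) \<partial>lebesgue_on \<Omega>) \<le> C" for k
      by (rule H[OF C1_supp_cmult(1)[OF f(1)] f(2)])
    show "AE x in lebesgue_on \<Omega>. (\<lambda>k. (b x * \<bar>1 / (2 * \<theta>) * f k x\<bar>) powr t) \<longlonglongrightarrow> (b x * \<bar>u x / (2 * \<theta>)\<bar>) powr t"
      using f(3)
    proof eventually_elim
      case (elim x)
      have "(\<lambda>k. u x - (u x - f k x)) \<longlonglongrightarrow> u x - 0" by (intro tendsto_intros elim)
      then have "(\<lambda>k. f k x) \<longlonglongrightarrow> u x" by simp
      then have "(\<lambda>k. b x * \<bar>1 / (2 * \<theta>) * f k x\<bar>) \<longlonglongrightarrow> b x * \<bar>1 / (2 * \<theta>) * u x\<bar>" by (intro tendsto_intros)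
      then have "(\<lambda>k. (b x * \<bar>1 / (2 * \<theta>) * f k x\<bar>) powr t) \<longlonglongrightarrow> (b x * \<bar>1 / (2 * \<theta>) * u x\<bar>) powr t"
        by (rule tendsto_powr2) (use t b0 in auto)
      then show ?case by simp
    qed
  qed
qed

text \<open>On a domain of finite measure y <= 1 + y^p turns the p-bound on the gradients into an
  L^1 bound. Compactness is applied to the approximants and transferred back through the vanishing
  differences.\<close>

lemma AE_convergent_subsequence:
  assumes v: "\<And>k::nat. v k \<in> musielak_sobolev_space_0 \<Omega> \<A>" and l: "\<And>k. musielak_sobolev_norm \<Omega> \<A> (v k) < \<theta>"
  obtains \<sigma> u where "strict_mono \<sigma>" "u \<in> borel_measurable (lebesgue_on \<Omega>)"
    "AE x in lebesgue_on \<Omega>. (\<lambda>k. v (\<sigma> k) x) \<longlonglongrightarrow> u x"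
proof -
  have l0: "0 < \<theta>" using test_function_approx(1)[OF v l, of 1] by simp
  obtain f where f: "\<And>k. C1_supp \<Omega> (f k)" "\<And>k. unit_gradient (\<lambda>x. 1 / (2 * \<theta>) * f k x)"
    "AE x in lebesgue_on \<Omega>. (\<lambda>k. v k x - f k x) \<longlonglongrightarrow> 0"
    by (rule exists_approximants[of v \<theta>, OF v l]) (rule that)
  note [measurable] = C1_supp_measurable[OF f(1)]
  have [measurable]: "\<Omega> \<in> sets borel" using open_domain by simp
  have I: "(\<integral>\<^sup>+x. ennreal (norm (grad (f k) x)) \<partial>lborel) \<le> ennreal (2 * \<theta> * (measure lborel \<Omega> + 1))" for k
  proof -
    define y where "y x = norm (grad (\<lambda>x. 1 / (2 * \<theta>) * f k x) x)" for x
    have y: "y x = norm (grad (f k) x) / (2 * \<theta>)" for x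
      unfolding y_def C1_supp_cmult(2)[OF f(1)] using l0 by simp
    have [measurable]: "y \<in> borel_measurable borel"
      unfolding y_def using C1_supp_measurable(2)[OF C1_supp_cmult(1)[OF f(1)]] by measurable
    have yp: "(\<integral>\<^sup>+x. ennreal (y x powr p) \<partial>lborel) \<le> 1" using f(2)[of k] by (simp only: y_def)
    have "norm (grad (f k) x) \<le> 2 * \<theta> * (indicator \<Omega> x + y x powr p)" for x
    proof (cases "x \<in> \<Omega>")
      case True
      have "y x \<le> 1 + y x powr p"
      proof (cases "y x \<le> 1")
        case False
        then have "y x powr 1 \<le> y x powr p" using exponents by (intro powr_mono) auto
        then show ?thesis using False by simp
      qed (simp add: add_increasing2)
      then have "2 * \<theta> * y x \<le> 2 * \<theta> * (1 + y x powr p)" using l0 by (intro mult_left_mono) auto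
      then show ?thesis using True l0 unfolding y by simp
    qed (use l0 in \<open>simp add: C1_suppD[OF f(1)]\<close>)
    then have "(\<integral>\<^sup>+x. ennreal (norm (grad (f k) x)) \<partial>lborel)
        \<le> (\<integral>\<^sup>+x. ennreal (2 * \<theta>) * (indicator \<Omega> x + ennreal (y x powr p)) \<partial>lborel)"
      using l0 by (intro nn_integral_mono)
        (simp add: ennreal_mult'[symmetric] ennreal_plus[symmetric] ennreal_indicator[symmetric] ennreal_leI del: ennreal_plus)
    also have "\<dots> = ennreal (2 * \<theta>) * (emeasure lborel \<Omega> + (\<integral>\<^sup>+x. ennreal (y x powr p) \<partial>lborel))"
      by (simp add: nn_integral_cmult nn_integral_add)
    also have "\<dots> \<le> ennreal (2 * \<theta>) * (ennreal (measure lborel \<Omega>) + 1)"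
      using yp emeasure_bounded_finite[OF bounded_domain]
      by (intro mult_left_mono add_mono) (auto simp: emeasure_eq_ennreal_measure less_top[symmetric])
    also have "\<dots> = ennreal (2 * \<theta>) * ennreal (measure lborel \<Omega> + 1)"
      by (simp add: ennreal_plus)
    also have "\<dots> = ennreal (2 * \<theta> * (measure lborel \<Omega> + 1))"
      using l0 by (intro ennreal_mult'[symmetric]) simp
    finally show ?thesis .
  qed
  obtain \<sigma> where \<sigma>: "strict_mono \<sigma>" "AE x in lborel. Cauchy (\<lambda>k. f (\<sigma> k) x)"
    by (rule C1_supp_L1_compact[of \<Omega> f, OF bounded_domain f(1) I]) (rule that)
  define u where "u x = lim (\<lambda>k. f (\<sigma> k) x)" for x
  have "u \<in> borel_measurable borel" unfolding u_def by measurable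
  then have um: "u \<in> borel_measurable (lebesgue_on \<Omega>)"
    by (auto intro!: measurable_restrict_space1 measurable_completion)
  have "AE x in lebesgue. Cauchy (\<lambda>k. f (\<sigma> k) x)" using \<sigma>(2) by (rule AE_completion)
  then have "AE x in lebesgue_on \<Omega>. Cauchy (\<lambda>k. f (\<sigma> k) x)"
    using open_domain by (subst AE_restrict_space_iff) auto
  with f(3) have "AE x in lebesgue_on \<Omega>. (\<lambda>k. v (\<sigma> k) x) \<longlonglongrightarrow> u x"
  proof eventually_elim
    case (elim x)
    have "(\<lambda>k. f (\<sigma> k) x) \<longlonglongrightarrow> u x"
      using elim(2) unfolding u_def by (simp add: Cauchy_convergent_iff convergent_LIMSEQ_iff)
    moreover have "(\<lambda>k. v (\<sigma> k) x - f (\<sigma> k) x) \<longlonglongrightarrow> 0"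
      using LIMSEQ_subseq_LIMSEQ[OF elim(1) \<sigma>(1)] by (simp add: o_def)
    ultimately have "(\<lambda>k. (v (\<sigma> k) x - f (\<sigma> k) x) + f (\<sigma> k) x) \<longlonglongrightarrow> 0 + u x" by (intro tendsto_add)
    then show ?case by simp
  qed
  with \<sigma>(1) um show thesis by (rule that)
qed

end

text \<open>Pointwise h^t <= 1 + h^t', which here takes the place of Hoelder's inequality.\<close>

lemma nn_integral_powr_le_measure_add:
  assumes M: "finite_measure M" and h: "h \<in> borel_measurable M" and h0: "\<And>x. 0 \<le> h x"
    and t: "0 < t" "t \<le> t'" and I: "(\<integral>\<^sup>+x. ennreal (h x powr t') \<partial>M) \<le> ennreal C" and C: "0 \<le> C"
  shows "(\<integral>\<^sup>+x. ennreal (h x powr t) \<partial>M) \<le> ennreal (measure M (space M) + C)"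
proof -
  interpret finite_measure M by fact
  note [measurable] = h
  have "h x powr t \<le> 1 + h x powr t'" for x
  proof (cases "h x \<le> 1")
    case True
    then have "h x powr t \<le> 1" using h0 t by (intro powr_le1) auto
    then show ?thesis by (simp add: add_increasing2)
  next
    case False
    then have "h x powr t \<le> h x powr t'" using t by (intro powr_mono) auto
    then show ?thesis by simp
  qed
  then have "(\<integral>\<^sup>+x. ennreal (h x powr t) \<partial>M) \<le> (\<integral>\<^sup>+x. 1 + ennreal (h x powr t') \<partial>M)"
    by (intro nn_integral_mono) (simp add: ennreal_plus[symmetric] ennreal_1[symmetric] ennreal_leI del: ennreal_plus ennreal_1)
  also have "\<dots> = emeasure M (space M) + (\<integral>\<^sup>+x. ennreal (h x powr t') \<partial>M)" by (simp add: nn_integral_add)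
  also have "\<dots> \<le> ennreal (measure M (space M)) + ennreal C"
    using I by (intro add_mono) (auto simp: emeasure_eq_measure)
  finally show ?thesis using C by (simp add: ennreal_plus)
qed

text \<open>The exponents in \<open>bounds\<close> lie strictly above r and s. That gap yields
  boundedness, through finiteness of the measure, and compactness, through interpolation with almost
  everywhere convergence.\<close>

lemma (in double_phase_domain) compact_embedding_of_bounds:
  assumes r: "0 < r" "r < r'" and s: "0 < s" "s < s'" and rs1: "1 \<le> r" "1 \<le> s"
    and c: "c \<in> borel_measurable (lebesgue_on \<Omega>)" "AE x in lebesgue_on \<Omega>. 0 \<le> c x"
    and Cw: "0 \<le> Cw" "AE x in lebesgue_on \<Omega>. c x \<le> Cw * a x powr (s / q)"
    and bounds: "\<And>g. C1_supp \<Omega> g \<Longrightarrow> unit_gradient g \<Longrightarrow>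
        (\<integral>\<^sup>+x. ennreal (\<bar>g x\<bar> powr r') \<partial>lebesgue_on \<Omega>) \<le> ennreal C1"
      "\<And>g. C1_supp \<Omega> g \<Longrightarrow> unit_gradient g \<Longrightarrow>
        (\<integral>\<^sup>+x. ennreal ((a x powr (1 / q) * \<bar>g x\<bar>) powr s') \<partial>lebesgue_on \<Omega>) \<le> ennreal C2"
  shows "compactly_embedded (musielak_sobolev_space_0 \<Omega> \<A>) (musielak_sobolev_norm \<Omega> \<A>)
     (musielak_space \<Omega> (double_phase r s c)) (luxemburg_norm \<Omega> (double_phase r s c))"
proof -
  interpret finite_measure "lebesgue_on \<Omega>" by (rule finite_measure_domain)
  let ?M = "lebesgue_on \<Omega>" and ?X = "musielak_sobolev_space_0 \<Omega> \<A>" and ?C = "double_phase r s c"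
  let ?n = "musielak_sobolev_norm \<Omega> \<A>"
  note [measurable] = c(1) weight_measurable
  define b where "b x = a x powr (1 / q)" for x
  have b0: "0 \<le> b x" for x by (simp add: b_def)
  have [measurable]: "b \<in> borel_measurable ?M" unfolding b_def by measurable
  define D1 where "D1 = max C1 0"
  define D2 where "D2 = max C2 0"
  have D: "0 \<le> D1" "0 \<le> D2" by (auto simp: D1_def D2_def)
  have ub: "(\<integral>\<^sup>+x. ennreal (\<bar>u x / (2 * \<theta>)\<bar> powr r') \<partial>?M) \<le> ennreal D1"
    "(\<integral>\<^sup>+x. ennreal ((b x * \<bar>u x / (2 * \<theta>)\<bar>) powr s') \<partial>?M) \<le> ennreal D2"
    if u: "u \<in> ?X" "?n u < \<theta>" for u \<theta>
  proof -
    have "(\<integral>\<^sup>+x. ennreal ((1 * \<bar>u x / (2 * \<theta>)\<bar>) powr r') \<partial>?M) \<le> ennreal D1"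
      by (rule extend_bound[OF _ _ _ _ u])
         (use r order_trans[OF bounds(1)] in \<open>auto simp: D1_def ennreal_leI\<close>)
    then show "(\<integral>\<^sup>+x. ennreal (\<bar>u x / (2 * \<theta>)\<bar> powr r') \<partial>?M) \<le> ennreal D1" by simp
    show "(\<integral>\<^sup>+x. ennreal ((b x * \<bar>u x / (2 * \<theta>)\<bar>) powr s') \<partial>?M) \<le> ennreal D2"
      by (rule extend_bound[OF _ _ _ _ u])
         (use s b0 order_trans[OF bounds(2)] in \<open>auto simp: D2_def b_def ennreal_leI\<close>)
  qed
  have Xm: "u \<in> borel_measurable ?M" if "u \<in> ?X" for u
    using that unfolding musielak_sobolev_space_0_def musielak_sobolev_space_def musielak_space_def by blast
  have modC: "modular \<Omega> ?C w \<le> (\<integral>\<^sup>+x. ennreal (\<bar>w x\<bar> powr r) \<partial>?M) + ennreal Cw * (\<integral>\<^sup>+x. ennreal ((b x * \<bar>w x\<bar>) powr s) \<partial>?M)"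
    if [measurable]: "w \<in> borel_measurable ?M" for w
  proof -
    have "modular \<Omega> ?C w \<le> (\<integral>\<^sup>+x. ennreal (\<bar>w x\<bar> powr r) + ennreal Cw * ennreal ((b x * \<bar>w x\<bar>) powr s) \<partial>?M)"
      unfolding modular_def
    proof (rule nn_integral_mono_AE, use Cw(2) AE_weight_nonneg in eventually_elim)
      case (elim x)
      have "(b x * \<bar>w x\<bar>) powr s = a x powr (s / q) * \<bar>w x\<bar> powr s"
        by (simp add: b_def powr_mult powr_powr)
      moreover have "c x * \<bar>w x\<bar> powr s \<le> Cw * a x powr (s / q) * \<bar>w x\<bar> powr s"
        using elim by (intro mult_right_mono) auto
      ultimately have "?C x \<bar>w x\<bar> \<le> \<bar>w x\<bar> powr r + Cw * (b x * \<bar>w x\<bar>) powr s"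
        by (simp add: double_phase_def mult.assoc)
      then show ?case using Cw(1)
        by (simp add: ennreal_mult'[symmetric] ennreal_plus[symmetric] ennreal_leI del: ennreal_plus)
    qed
    also have "\<dots> = (\<integral>\<^sup>+x. ennreal (\<bar>w x\<bar> powr r) \<partial>?M) + ennreal Cw * (\<integral>\<^sup>+x. ennreal ((b x * \<bar>w x\<bar>) powr s) \<partial>?M)"
      by (simp add: nn_integral_add nn_integral_cmult)
    finally show ?thesis .
  qed
  define m where "m = measure ?M (space ?M)"
  define K0 where "K0 = (m + D1) + Cw * (m + D2)"
  have m0: "0 \<le> m" by (simp add: m_def)
  have K0: "0 \<le> K0" using m0 D Cw by (simp add: K0_def)
  have modK: "modular \<Omega> ?C w \<le> ennreal K0"
    if w: "w \<in> borel_measurable ?M" "(\<integral>\<^sup>+x. ennreal (\<bar>w x\<bar> powr r') \<partial>?M) \<le> ennreal D1"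
      "(\<integral>\<^sup>+x. ennreal ((b x * \<bar>w x\<bar>) powr s') \<partial>?M) \<le> ennreal D2" for w
  proof -
    note [measurable] = w(1)
    have 1: "(\<integral>\<^sup>+x. ennreal (\<bar>w x\<bar> powr r) \<partial>?M) \<le> ennreal (m + D1)"
      unfolding m_def by (rule nn_integral_powr_le_measure_add[OF finite_measure_domain _ _ _ _ w(2) D(1)]) (use r in auto)
    have 2: "(\<integral>\<^sup>+x. ennreal ((b x * \<bar>w x\<bar>) powr s) \<partial>?M) \<le> ennreal (m + D2)"
      unfolding m_def by (rule nn_integral_powr_le_measure_add[OF finite_measure_domain _ _ _ _ w(3) D(2)]) (use s b0 in auto)
    have "modular \<Omega> ?C w \<le> ennreal (m + D1) + ennreal Cw * ennreal (m + D2)"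
      by (rule order_trans[OF modC[OF w(1)]]) (intro add_mono mult_left_mono 1 2, simp)
    also have "\<dots> = ennreal K0"
      using m0 D Cw by (simp add: K0_def ennreal_mult'[symmetric] ennreal_plus[symmetric] del: ennreal_plus)
    finally show ?thesis .
  qed
  have finC: "modular \<Omega> ?C w < \<infinity>"
    if w: "w \<in> borel_measurable ?M" "modular \<Omega> ?C (\<lambda>x. w x / \<mu>) \<le> ennreal K0" "0 < \<mu>" for w \<mu>
  proof -
    have "modular \<Omega> ?C (\<lambda>x. \<mu> * (w x / \<mu>)) \<le> ennreal (\<mu> powr r + \<mu> powr s) * modular \<Omega> ?C (\<lambda>x. w x / \<mu>)"
      by (rule modular_cmult_le) (use r s c w in auto)
    also have "\<dots> \<le> ennreal (\<mu> powr r + \<mu> powr s) * ennreal K0" by (intro mult_left_mono w(2)) simp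
    also have "\<dots> < \<infinity>" by (simp add: ennreal_mult_less_top)
    finally show ?thesis using w(3) by simp
  qed
  have scale_pos: "0 < \<theta>" if "u \<in> ?X" "?n u < \<theta>" for u \<theta>
    using test_function_approx(1)[OF that, of 1] by simp
  have XY: "u \<in> musielak_space \<Omega> ?C" if u: "u \<in> ?X" for u
  proof -
    have l: "?n u < ?n u + 1" by simp
    have "modular \<Omega> ?C (\<lambda>x. u x / (2 * (?n u + 1))) \<le> ennreal K0"
      by (rule modK[OF _ ub[OF u l]]) (use Xm[OF u] in measurable)
    then show ?thesis using finC[OF Xm[OF u]] scale_pos[OF u l] Xm[OF u] by (auto simp: musielak_space_def)
  qed
  define \<kappa> where "\<kappa> = max 1 K0"
  have nK: "luxemburg_norm \<Omega> ?C u \<le> 2 * \<kappa> * ?n u" if u: "u \<in> ?X" for u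
  proof -
    \<comment> \<open>Only \<theta> strictly above the norm is admissible as a scale, since the norm
      itself may be 0; the excess is then sent to 0.\<close>
    have le: "luxemburg_norm \<Omega> ?C u \<le> 2 * \<kappa> * \<theta>" if l: "?n u < \<theta>" for \<theta>
    proof (rule luxemburg_norm_le(1))
      show "0 < 2 * \<kappa> * \<theta>" using scale_pos[OF u l] by (simp add: \<kappa>_def)
      have um: "(\<lambda>x. u x / (2 * \<theta>)) \<in> borel_measurable ?M" using Xm[OF u] by measurable
      have "modular \<Omega> ?C (\<lambda>x. u x / (2 * \<theta>) / \<kappa>) \<le> 1"
        by (rule modular_finite_scaled[OF rs1 c(2,1) um modK[OF um ub[OF u l]]]) (auto simp: \<kappa>_def)
      then show "modular \<Omega> ?C (\<lambda>x. u x / (2 * \<kappa> * \<theta>)) \<le> 1" by (simp add: mult_ac)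
    qed
    show ?thesis
    proof (rule field_le_epsilon)
      fix e :: real assume "0 < e"
      then have "luxemburg_norm \<Omega> ?C u \<le> 2 * \<kappa> * (?n u + e / (2 * \<kappa>))" by (intro le) (simp add: \<kappa>_def)
      also have "\<dots> = 2 * \<kappa> * ?n u + e" by (simp add: \<kappa>_def field_simps)
      finally show "luxemburg_norm \<Omega> ?C u \<le> 2 * \<kappa> * ?n u + e" .
    qed
  qed
  have comp: "\<exists>u\<in>musielak_space \<Omega> ?C. \<exists>\<sigma>. strict_mono \<sigma> \<and> (\<lambda>k. luxemburg_norm \<Omega> ?C (\<lambda>x. v (\<sigma> k) x - u x)) \<longlonglongrightarrow> 0"
    if v: "\<And>k::nat. v k \<in> ?X" "\<And>k. ?n (v k) \<le> B" for v B
  proof -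
    define \<theta> where "\<theta> = B + 1"
    have l: "?n (v k) < \<theta>" for k using v(2)[of k] by (simp add: \<theta>_def)
    have l0: "0 < \<theta>" using scale_pos[OF v(1) l] .
    obtain \<sigma> u where \<sigma>: "strict_mono \<sigma>" and um [measurable]: "u \<in> borel_measurable ?M"
      and lim: "AE x in ?M. (\<lambda>k. v (\<sigma> k) x) \<longlonglongrightarrow> u x"
      by (rule AE_convergent_subsequence[of v \<theta>, OF v(1) l]) (rule that)
    have [measurable]: "v k \<in> borel_measurable ?M" for k by (rule Xm[OF v(1)])
    define h where "h \<beta> k x = \<beta> x * \<bar>(v (\<sigma> k) x - u x) / (2 * \<theta>)\<bar>" for \<beta> :: "'a \<Rightarrow> real" and k x
    \<comment> \<open>Stated for a general factor \<beta> because it is applied with 1 for the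
      exponent r and with \<open>b\<close> for s. Fatou bounds the limit in the higher exponent,
      hence the differences too, and interpolation gives convergence in the lower one.\<close>
    have step: "(\<integral>\<^sup>+x. ennreal ((\<beta> x * \<bar>u x / (2 * \<theta>)\<bar>) powr t') \<partial>?M) \<le> ennreal E \<and>
        (\<forall>\<eta>>0. \<forall>\<^sub>F k in sequentially. (\<integral>\<^sup>+x. ennreal (h \<beta> k x powr t) \<partial>?M) \<le> ennreal \<eta>)"
      if \<beta>[measurable]: "\<beta> \<in> borel_measurable ?M" and \<beta>0: "\<And>x. 0 \<le> \<beta> x" and t: "0 < t" "t < t'" and E: "0 \<le> E"
        and vE: "\<And>k. (\<integral>\<^sup>+x. ennreal ((\<beta> x * \<bar>v k x / (2 * \<theta>)\<bar>) powr t') \<partial>?M) \<le> ennreal E" for \<beta> t t' E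
    proof (intro conjI allI impI)
      show uE: "(\<integral>\<^sup>+x. ennreal ((\<beta> x * \<bar>u x / (2 * \<theta>)\<bar>) powr t') \<partial>?M) \<le> ennreal E"
      proof (rule nn_integral_le_of_AE_tendsto[OF _ _ vE])
        show "AE x in ?M. (\<lambda>k. (\<beta> x * \<bar>v (\<sigma> k) x / (2 * \<theta>)\<bar>) powr t') \<longlonglongrightarrow> (\<beta> x * \<bar>u x / (2 * \<theta>)\<bar>) powr t'"
          using lim
        proof eventually_elim
          case (elim x)
          have "(\<lambda>k. \<beta> x * \<bar>v (\<sigma> k) x / (2 * \<theta>)\<bar>) \<longlonglongrightarrow> \<beta> x * \<bar>u x / (2 * \<theta>)\<bar>"
            by (intro tendsto_intros elim) (use l0 in auto)
          then show ?case by (rule tendsto_powr2) (use t \<beta>0 in auto)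
        qed
      qed measurable
      fix \<eta> :: real assume \<eta>: "0 < \<eta>"
      show "\<forall>\<^sub>F k in sequentially. (\<integral>\<^sup>+x. ennreal (h \<beta> k x powr t) \<partial>?M) \<le> ennreal \<eta>"
      proof (rule powr_integral_tendsto_0[OF finite_measure_domain _ _ _ t _ \<eta>])
        show "h \<beta> k \<in> borel_measurable ?M" for k unfolding h_def by measurable
        show "0 \<le> h \<beta> k x" for k x using \<beta>0 by (simp add: h_def)
        show "AE x in ?M. (\<lambda>k. h \<beta> k x) \<longlonglongrightarrow> 0"
          using lim
        proof eventually_elim
          case (elim x)
          have "(\<lambda>k. h \<beta> k x) \<longlonglongrightarrow> \<beta> x * \<bar>(u x - u x) / (2 * \<theta>)\<bar>"
            unfolding h_def by (intro tendsto_intros elim) (use l0 in auto)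
          then show ?case by simp
        qed
        fix k
        have pw: "h \<beta> k x powr t' \<le> 2 powr t' * ((\<beta> x * \<bar>v (\<sigma> k) x / (2 * \<theta>)\<bar>) powr t' + (\<beta> x * \<bar>u x / (2 * \<theta>)\<bar>) powr t')" for x
        proof -
          have "\<bar>(v (\<sigma> k) x - u x) / (2 * \<theta>)\<bar> \<le> \<bar>v (\<sigma> k) x / (2 * \<theta>)\<bar> + \<bar>u x / (2 * \<theta>)\<bar>"
            unfolding diff_divide_distrib by (rule abs_triangle_ineq4)
          then have "h \<beta> k x \<le> \<beta> x * \<bar>v (\<sigma> k) x / (2 * \<theta>)\<bar> + \<beta> x * \<bar>u x / (2 * \<theta>)\<bar>"
            unfolding h_def distrib_left[symmetric] by (intro mult_left_mono \<beta>0)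
          then have "h \<beta> k x powr t' \<le> (\<beta> x * \<bar>v (\<sigma> k) x / (2 * \<theta>)\<bar> + \<beta> x * \<bar>u x / (2 * \<theta>)\<bar>) powr t'"
            using t \<beta>0 by (intro powr_mono2) (auto simp: h_def)
          also have "\<dots> \<le> 2 powr t' * ((\<beta> x * \<bar>v (\<sigma> k) x / (2 * \<theta>)\<bar>) powr t' + (\<beta> x * \<bar>u x / (2 * \<theta>)\<bar>) powr t')"
            using t \<beta>0 by (intro powr_add_le) auto
          finally show ?thesis .
        qed
        have "(\<integral>\<^sup>+x. ennreal (h \<beta> k x powr t') \<partial>?M) \<le> (\<integral>\<^sup>+x. ennreal (2 powr t') *
            (ennreal ((\<beta> x * \<bar>v (\<sigma> k) x / (2 * \<theta>)\<bar>) powr t') + ennreal ((\<beta> x * \<bar>u x / (2 * \<theta>)\<bar>) powr t')) \<partial>?M)"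
          by (intro nn_integral_mono) (simp only: ennreal_mult'[symmetric] ennreal_plus[symmetric] powr_ge_zero ennreal_leI[OF pw])
        also have "\<dots> = ennreal (2 powr t') * ((\<integral>\<^sup>+x. ennreal ((\<beta> x * \<bar>v (\<sigma> k) x / (2 * \<theta>)\<bar>) powr t') \<partial>?M)
            + (\<integral>\<^sup>+x. ennreal ((\<beta> x * \<bar>u x / (2 * \<theta>)\<bar>) powr t') \<partial>?M))"
          by (subst nn_integral_cmult, measurable, subst nn_integral_add) auto
        also have "\<dots> \<le> ennreal (2 powr t') * (ennreal E + ennreal E)" by (intro mult_left_mono add_mono vE uE) simp
        also have "\<dots> = ennreal (2 powr t' * (E + E))" using E by (simp add: ennreal_mult'[symmetric] ennreal_plus[symmetric] del: ennreal_plus)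
        finally show "(\<integral>\<^sup>+x. ennreal (h \<beta> k x powr t') \<partial>?M) \<le> ennreal (2 powr t' * (E + E))" .
      qed
    qed
    have s1: "(\<integral>\<^sup>+x. ennreal (\<bar>u x / (2 * \<theta>)\<bar> powr r') \<partial>?M) \<le> ennreal D1"
      "\<And>\<eta>. 0 < \<eta> \<Longrightarrow> \<forall>\<^sub>F k in sequentially. (\<integral>\<^sup>+x. ennreal (h (\<lambda>_. 1) k x powr r) \<partial>?M) \<le> ennreal \<eta>"
      using step[of "\<lambda>_. 1" r r' D1] r D ub(1)[OF v(1) l] by auto
    have s2: "(\<integral>\<^sup>+x. ennreal ((b x * \<bar>u x / (2 * \<theta>)\<bar>) powr s') \<partial>?M) \<le> ennreal D2"
      "\<And>\<eta>. 0 < \<eta> \<Longrightarrow> \<forall>\<^sub>F k in sequentially. (\<integral>\<^sup>+x. ennreal (h b k x powr s) \<partial>?M) \<le> ennreal \<eta>"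
      using step[of b s s' D2] s b0 D ub(2)[OF v(1) l] by auto
    have "modular \<Omega> ?C (\<lambda>x. u x / (2 * \<theta>)) \<le> ennreal K0" by (rule modK[OF _ s1(1) s2(1)]) measurable
    then have uY: "u \<in> musielak_space \<Omega> ?C" using finC[OF um, of "2 * \<theta>"] l0 um by (auto simp: musielak_space_def)
    have ev: "\<forall>\<^sub>F k in sequentially. modular \<Omega> ?C (\<lambda>x. (v (\<sigma> k) x - u x) / \<epsilon>) \<le> 1" if \<epsilon>: "0 < \<epsilon>" for \<epsilon>
    proof -
      \<comment> \<open>\<open>S\<close> is the cost of passing from scale 2 \<theta> to scale
        \<epsilon>, and \<open>\<eta>\<close> is chosen so that S \<eta> (1 + Cw) = 1.\<close>
      define S where "S = (2 * \<theta> / \<epsilon>) powr r + (2 * \<theta> / \<epsilon>) powr s"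
      have S: "S > 0" using l0 \<epsilon> by (simp add: S_def add_pos_pos)
      define \<eta> where "\<eta> = 1 / (S * (1 + Cw))"
      have \<eta>: "0 < \<eta>" using S Cw by (simp add: \<eta>_def)
      show ?thesis
        using s1(2)[OF \<eta>] s2(2)[OF \<eta>]
      proof eventually_elim
        case (elim k)
        let ?w = "\<lambda>x. (v (\<sigma> k) x - u x) / (2 * \<theta>)"
        have "modular \<Omega> ?C ?w \<le> ennreal \<eta> + ennreal Cw * ennreal \<eta>"
          by (rule order_trans[OF modC], measurable)
             (intro add_mono mult_left_mono, use elim in \<open>auto simp: h_def\<close>)
        also have "\<dots> = ennreal (\<eta> * (1 + Cw))"
          using \<eta> Cw by (simp add: ennreal_mult'[symmetric] ennreal_plus[symmetric] distrib_left mult.commute del: ennreal_plus)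
        finally have le: "modular \<Omega> ?C ?w \<le> ennreal (\<eta> * (1 + Cw))" .
        have "modular \<Omega> ?C (\<lambda>x. 2 * \<theta> / \<epsilon> * ?w x) \<le> ennreal S * modular \<Omega> ?C ?w"
          by (rule modular_cmult_le) (use r s c l0 \<epsilon> in \<open>auto simp: S_def\<close>)
        also have "\<dots> \<le> ennreal S * ennreal (\<eta> * (1 + Cw))" by (intro mult_left_mono le) simp
        also have "\<dots> = 1" using S Cw by (simp add: \<eta>_def ennreal_mult'[symmetric])
        finally show ?case using l0 by simp
      qed
    qed
    have "(\<lambda>k. luxemburg_norm \<Omega> ?C (\<lambda>x. v (\<sigma> k) x - u x)) \<longlonglongrightarrow> 0"
      unfolding tendsto_iff
    proof (intro allI impI)
      fix e :: real assume "0 < e"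
      then have "0 < e / 2" by simp
      from ev[OF this] show "\<forall>\<^sub>F k in sequentially. dist (luxemburg_norm \<Omega> ?C (\<lambda>x. v (\<sigma> k) x - u x)) 0 < e"
      proof eventually_elim
        case (elim k)
        from luxemburg_norm_le[OF \<open>0 < e / 2\<close> elim] \<open>0 < e\<close> show ?case by simp
      qed
    qed
    with uY \<sigma> show ?thesis by blast
  qed
  show ?thesis
    unfolding compactly_embedded_def using XY nK comp by blast
qed

theorem proposition4p10:
  fixes \<Omega> :: "(real ^ 'n) set"
    and a c :: "real ^ 'n \<Rightarrow> real"
    and p q r s :: real
  assumes "CARD('n) \<ge> 2"
    and "smooth_bounded_domain \<Omega>"
    and "1 < p" and "p < q" and "q < real CARD('n)"
    and "q / p \<le> real CARD('n) / (real CARD('n) - 1)"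
    and "a \<in> L_infty \<Omega> \<inter> holder_space (real CARD('n) / p * (q - p)) \<Omega>"
    and "\<forall>x\<in>\<Omega>. 0 \<le> a x"
    and "1 < r" and "r < sobolev_exponent CARD('n) p"
    and "sobolev_exponent CARD('n) p \<le> s" and "s < sobolev_exponent CARD('n) q"
    and "c \<in> L_infty \<Omega>"
    and "AE x in lebesgue_on \<Omega>. 0 \<le> c x"
    and "\<exists>C>0. AE x in lebesgue_on \<Omega>. c x \<le> C * a x powr (s / q)"
  shows "compactly_embedded
           (musielak_sobolev_space_0 \<Omega> (double_phase p q a))
           (musielak_sobolev_norm \<Omega> (double_phase p q a))
           (musielak_space \<Omega> (double_phase r s c))
           (luxemburg_norm \<Omega> (double_phase r s c))"
proof -
  let ?N = "real CARD('n)"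
  define \<alpha> where "\<alpha> = ?N / p * (q - p)"
  have pq: "1 < p" "p < q" "q < ?N" "0 < \<alpha>" using assms(3-5) by (auto simp: \<alpha>_def)
  obtain K' where K': "\<And>x y. x \<in> \<Omega> \<Longrightarrow> y \<in> \<Omega> \<Longrightarrow> \<bar>a x - a y\<bar> \<le> K' * dist x y powr \<alpha>"
    using assms(7) by (auto simp: holder_space_def \<alpha>_def)
  define K where "K = \<bar>K'\<bar>"
  have K: "\<bar>a x - a y\<bar> \<le> K * dist x y powr \<alpha>" if "x \<in> \<Omega>" "y \<in> \<Omega>" for x y
    unfolding K_def by (rule order_trans[OF K'[OF that]]) (intro mult_right_mono, auto)
  interpret double_phase_domain \<Omega> a p q \<alpha> K
    by unfold_locales
       (use assms(2,7,8) pq K in \<open>auto simp: smooth_bounded_domain_def L_infty_def K_def\<close>)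
  have sob: "1 / sobolev_exponent CARD('n) e = 1 / e - 1 / ?N" "e < sobolev_exponent CARD('n) e" if "1 < e" "e < ?N" for e
    using that by (auto simp: sobolev_exponent_def field_simps)
  let ?p = "sobolev_exponent CARD('n) p" and ?q = "sobolev_exponent CARD('n) q"
  \<comment> \<open>These midpoints lie strictly between the given exponents and the Sobolev
    exponents. The maximum with p, respectively q, also puts them above the exponent of the
    gradient, as the averaging estimates require.\<close>
  define r' where "r' = (max r p + ?p) / 2"
  define s' where "s' = (max s q + ?q) / 2"
  have pN: "p < ?N" using pq by simp
  have q1: "1 < q" using pq by simp
  have r': "r < r'" "p < r'" "r' < ?p" using assms(10) sob(2)[OF pq(1) pN] by (auto simp: r'_def)
  have s': "s < s'" "q < s'" "s' < ?q" using assms(12) sob(2)[OF q1 pq(3)] by (auto simp: s'_def)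
  have s1: "1 < s" using assms(9,10,11) by linarith
  have "1 / r' > 1 / ?p" using r' pq by (intro divide_strict_left_mono) auto
  then have "1 / p - 1 / r' < 1 / ?N" using sob(1)[OF pq(1) pN] by simp
  then have subr: "?N * (1 / p - 1 / r') < 1" using pq by (simp add: field_simps)
  have "1 / s' > 1 / ?q" using s' pq by (intro divide_strict_left_mono) auto
  then have "1 / q - 1 / s' < 1 / ?N" using sob(1)[OF q1 pq(3)] by simp
  then have subs: "?N * (1 / q - 1 / s') < 1" using pq by (simp add: field_simps)
  \<comment> \<open>Here the Hoelder exponent N (q - p) / p fits: the gain \<alpha> / q equals the
    loss from starting at p instead of q, so the second subcriticality condition reduces to the
    first.\<close>
  have "\<alpha> / q = ?N * (1 / p - 1 / q)" using pq by (simp add: \<alpha>_def field_simps)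
  then have subs': "?N * (1 / p - 1 / s') < 1 + \<alpha> / q" using subs by (simp add: right_diff_distrib)
  obtain C1 where C1: "\<And>f. \<lbrakk>C1_supp \<Omega> f; (\<integral>\<^sup>+x. ennreal (norm (grad f x) powr p) \<partial>lborel) \<le> 1\<rbrakk> \<Longrightarrow>
      (\<integral>\<^sup>+x. ennreal (\<bar>f x\<bar> powr r') \<partial>lborel) \<le> ennreal C1"
    using sobolev_bound[OF bounded_domain, of p r'] pq r' subr by auto
  let ?a = "\<lambda>x. indicator \<Omega> x * a x"
  obtain A where A: "0 \<le> A" "\<And>x. x \<in> \<Omega> \<Longrightarrow> a x \<le> A" using weight_bounded by blast
  obtain C2 where C2: "\<And>f. \<lbrakk>C1_supp \<Omega> f; (\<integral>\<^sup>+x. ennreal (norm (grad f x) powr p) \<partial>lborel) \<le> 1;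
      (\<integral>\<^sup>+x. ennreal (?a x * norm (grad f x) powr q) \<partial>lborel) \<le> 1\<rbrakk> \<Longrightarrow>
      (\<integral>\<^sup>+x. ennreal ((?a x powr (1 / q) * \<bar>f x\<bar>) powr s') \<partial>lborel) \<le> ennreal C2"
  proof (rule weighted_sobolev_bound[where a="?a" and p=p and q=q and t=s' and \<alpha>=\<alpha> and A=A and K=K, OF bounded_domain])
    show "?a x \<le> A" for x using A by (cases "x \<in> \<Omega>") auto
    show "0 \<le> ?a x" for x using weight_nonneg by (cases "x \<in> \<Omega>") auto
  qed (use pq s' subs subs' restricted_weight_measurable weight_holder in auto)
  obtain Cw where Cw: "Cw > 0" "AE x in lebesgue_on \<Omega>. c x \<le> Cw * a x powr (s / q)" using assms(15) by blast
  show ?thesis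
  proof (rule compact_embedding_of_bounds[where r'=r' and s'=s' and Cw=Cw])
    fix g assume g: "C1_supp \<Omega> g" "unit_gradient g"
    have "(\<integral>\<^sup>+x. ennreal (\<bar>g x\<bar> powr r') \<partial>lebesgue_on \<Omega>) = (\<integral>\<^sup>+x. ennreal (\<bar>g x\<bar> powr r') \<partial>lborel)"
      by (rule nn_integral_lebesgue_on_eq[OF open_domain]) (use C1_suppD(4)[OF g(1)] in auto)
    then show "(\<integral>\<^sup>+x. ennreal (\<bar>g x\<bar> powr r') \<partial>lebesgue_on \<Omega>) \<le> ennreal C1" using C1 g by simp
    have "(\<integral>\<^sup>+x. ennreal ((a x powr (1 / q) * \<bar>g x\<bar>) powr s') \<partial>lebesgue_on \<Omega>)
        = (\<integral>\<^sup>+x. ennreal ((?a x powr (1 / q) * \<bar>g x\<bar>) powr s') \<partial>lborel)"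
      by (rule nn_integral_lebesgue_on_eq[OF open_domain]) (use C1_suppD(4)[OF g(1)] in auto)
    then show "(\<integral>\<^sup>+x. ennreal ((a x powr (1 / q) * \<bar>g x\<bar>) powr s') \<partial>lebesgue_on \<Omega>) \<le> ennreal C2" using C2 g by simp
  qed (use assms(9,13,14) r' s' s1 Cw in \<open>auto simp: L_infty_def\<close>)
qed

end
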